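(* Let $B$ be a standard Brownian motion started at $0$ and consider the reflected Brownian motion $|B|$ on $[0,t]$, $t>0$. For every $\varepsilon>0$, $$\mathbb{E}[N_t^\varepsilon]=\sum_{k\ge1}2k\left[\mathrm{erfc}\!\left(\frac{k\varepsilon}{\sqrt{2t}}\right)-2\,\mathrm{erfc}\!\left(\frac{2k\varepsilon}{\sqrt{2t}}\right)\right],$$ and, for $t=1$, also $$\mathbb{E}[N_1^\varepsilon]=\frac1{2\varepsilon^2}+\frac16+\sum_{k\ge1}\frac{4\pi^2k^2e^{-\frac{2\pi^2k^2}{\varepsilon^2}}+\varepsilon^2e^{-\frac{2\pi^2k^2}{\varepsilon^2}}-2e^{-\frac{\pi^2k^2}{2\varepsilon^2}}(\pi^2k^2+\varepsilon^2)}{\pi^2k^2\varepsilon^2}.$$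
   Context: With $X=|B|$ and $\varepsilon>0$, put $S_0^\varepsilon=T_0^\varepsilon=0$ and $T_{i+1}^\varepsilon=\inf\{u\ge S_i^\varepsilon:\sup_{[S_i^\varepsilon,u]}X-X_u>\varepsilon\}$, $S_{i+1}^\varepsilon=\inf\{u\ge T_{i+1}^\varepsilon:X_u-\inf_{[T_{i+1}^\varepsilon,u]}X>\varepsilon\}$. With $R_t=\sup_{[0,t]}X-\inf_{[0,t]}X$, $N_t^\varepsilon=\mathbf{1}_{\{R_t\ge\varepsilon\}}+\max\{k\ge0:S_k^\varepsilon\le t\}$ is the number of bars of length $\ge\varepsilon$ in the $H_0$ superlevel-set barcode of $X|_{[0,t]}$ (infinite bar given length $R_t$). $\mathrm{erfc}(x)=\frac{2}{\sqrt\pi}\int_x^\infty e^{-u^2}du$. *)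

theory Defs
  imports "HOL-Probability.Probability"
begin

text \<open>
  Standard real Brownian motion started at 0. The index type is \<^typ>\<open>real\<close>, but only times
  \<open>t \<ge> 0\<close> matter: \<open>B\<close> is unconstrained at negative times.
\<close>

locale standard_brownian_motion = prob_space M
  for M :: "'a measure" and B :: "real \<Rightarrow> 'a \<Rightarrow> real" +
  assumes random_variable_B: "\<And>t. 0 \<le> t \<Longrightarrow> random_variable borel (B t)"
    and start_zero: "AE \<omega> in M. B 0 \<omega> = 0"
    and indep_increments:
      "\<And>(n::nat) \<tau>. 0 \<le> \<tau> 0 \<Longrightarrow> (\<And>i. i < n \<Longrightarrow> \<tau> i \<le> \<tau> (Suc i)) \<Longrightarrow>
         indep_vars (\<lambda>_. borel) (\<lambda>i \<omega>. B (\<tau> (Suc i)) \<omega> - B (\<tau> i) \<omega>) {..<n}"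
    and gaussian_increments:
      "\<And>s t. 0 \<le> s \<Longrightarrow> s < t \<Longrightarrow>
         distributed M lborel (\<lambda>\<omega>. B t \<omega> - B s \<omega>) (normal_density 0 (sqrt (t - s)))"
    and continuous_paths: "AE \<omega> in M. continuous_on {0..} (\<lambda>t. B t \<omega>)"

text \<open>
  The times \<open>S\<^sub>i\<close>, \<open>T\<^sub>i\<close> of a path \<open>X\<close> on \<open>[0,\<infinity>)\<close> take values in \<open>[0,\<infinity>]\<close>: the infimum of the
  empty set is \<open>\<infinity>\<close>, and once a time is \<open>\<infinity>\<close>, so are all later ones.
\<close>

fun S_time :: "real \<Rightarrow> (real \<Rightarrow> real) \<Rightarrow> nat \<Rightarrow> ereal"
  and T_time :: "real \<Rightarrow> (real \<Rightarrow> real) \<Rightarrow> nat \<Rightarrow> ereal" where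
  "S_time \<epsilon> X 0 = 0"
| "T_time \<epsilon> X 0 = 0"
| "T_time \<epsilon> X (Suc i) =
     (INF u \<in> {u::real. S_time \<epsilon> X i \<le> ereal u \<and>
        (SUP r \<in> {r. S_time \<epsilon> X i \<le> ereal r \<and> r \<le> u}. X r) - X u > \<epsilon>}. ereal u)"
| "S_time \<epsilon> X (Suc i) =
     (INF u \<in> {u::real. T_time \<epsilon> X (Suc i) \<le> ereal u \<and>
        X u - (INF r \<in> {r. T_time \<epsilon> X (Suc i) \<le> ereal r \<and> r \<le> u}. X r) > \<epsilon>}. ereal u)"

definition path_range :: "(real \<Rightarrow> real) \<Rightarrow> real \<Rightarrow> real" where
  "path_range X t = (SUP r \<in> {0..t}. X r) - (INF r \<in> {0..t}. X r)"

text \<open>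
  The number of bars of length at least \<open>\<epsilon>\<close> in the superlevel-set barcode in degree 0 of \<open>X\<close> on
  \<open>[0,t]\<close>. For \<open>\<epsilon> > 0\<close>, \<open>t \<ge> 0\<close> and \<open>X\<close> continuous, the set under \<^const>\<open>Max\<close> is finite and
  contains 0.
\<close>

definition bar_count :: "real \<Rightarrow> (real \<Rightarrow> real) \<Rightarrow> real \<Rightarrow> nat" where
  "bar_count \<epsilon> X t = of_bool (path_range X t \<ge> \<epsilon>) + Max {k. S_time \<epsilon> X k \<le> ereal t}"

definition erfc :: "real \<Rightarrow> real" where
  "erfc x = 2 / sqrt pi * (LBINT u:{x..}. exp (- u\<^sup>2))"

end

theory Submission
  imports Defs "HOL-Real_Asymp.Real_Asymp"
begin

text \<open>
  Counting lattice steps. Let \<open>k\<close> be the number of alternating swings of size \<open>\<epsilon>\<close> completed by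
  \<open>|B|\<close> before time \<open>t\<close>, the first one upward; then \<open>N\<^sub>t\<close> is \<open>k / 2\<close> rounded up. By reflection, each
  swing is distributed as the passage of a Brownian motion from one point of the lattice \<open>\<epsilon>\<int>\<close> to a
  neighbouring one, so that \<open>k\<close> is also the number of lattice steps of a Brownian motion \<open>W\<close>. With
  \<open>h(x) = 2 r\<^sup>2\<close>, where \<open>r\<close> is \<open>x / (2\<epsilon>)\<close> rounded to the nearest integer, the mean of \<open>h(W\<^sub>t)\<close> over all
  choices of the signs of the lattice steps is \<open>k / 2\<close> rounded up: this is the martingale
  \<open>Z\<^sub>k\<^sup>2 - k\<close> of the lattice walk, up to parity. Hence \<open>E N\<^sub>t = E h(W\<^sub>t) = E h(B\<^sub>t)\<close>.

  No strong Markov property is needed: on a time grid, \<open>W\<close> arises from \<open>B\<close> by flipping the signs of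
  the increments in a predictable way, which does not change the law of the endpoint, and all
  discretisation errors are bounded by the largest increment.

  Slicing \<open>h\<close> into its level sets gives \<open>E h(B\<^sub>t) = \<Sum> 2 m erfc(m \<epsilon> / sqrt(2t))\<close> over odd \<open>m\<close>, which is the
  first series. The second one comes from the Fourier series of \<open>h(x) - x\<^sup>2 / (2\<epsilon>\<^sup>2)\<close>.
\<close>

subsection \<open>Predictable sign flips\<close>

text \<open>For every fixed sequence of signs the walk has the law of \<open>B t\<close>, so
  averaging over the signs does not change an expectation; along a single path, however, the average
  collapses to a function of \<open>k\<close> alone. The function h is forced by this:
  \<open>Z^2\<close> has mean \<open>k\<close> over the signs, and the step still unfinished at time
  t, which also has a free sign, must turn \<open>Z^2 / 2\<close> into \<open>(Z^2 + 1) / 2\<close>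
  at odd lattice points. Two obstacles shape the rest. The function h jumps, and the bar count is
  defined by strict inequalities that limits do not preserve; hence thresholds slightly below and
  above \<open>\<epsilon>\<close> and a shift \<open>\<eta>\<close>, with equality only in the
  limit, as the Gaussian law does not charge the jumps. Moreover, the mesh needed for the bounds
  depends on the path, and the bar count is not known to be measurable. So it is enclosed between a
  limsup and a liminf of integrable functions; Fatou's lemma above and its reverse below, the latter
  after truncation, force the two envelopes to agree almost everywhere.\<close>

lemma char_normal:
  assumes "0 < \<sigma>"
  shows "char (density lborel (normal_density \<mu> \<sigma>)) \<theta> = iexp (\<theta> * \<mu>) * exp (- (\<sigma> * \<theta>)\<^sup>2 / 2)"
proof -
  interpret std: prob_space "density lborel std_normal_density"
    by (rule prob_space_normal_density) simp
  have X: "distributed (density lborel std_normal_density) lborel (\<lambda>x. x) std_normal_density"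
    unfolding distributed_def by (auto simp: distr_id2)
  have d: "distributed (density lborel std_normal_density) lborel (\<lambda>x. \<mu> + \<sigma> * x) (normal_density \<mu> \<sigma>)"
    using std.normal_density_affine[OF X, of \<sigma> \<mu>] assms by simp
  have "density lborel (normal_density \<mu> \<sigma>) = distr (density lborel std_normal_density) borel (\<lambda>x. \<mu> + \<sigma> * x)"
    using d unfolding distributed_def
    by (metis (no_types, lifting) distr_cong sets_lborel)
  hence "char (density lborel (normal_density \<mu> \<sigma>)) \<theta> = (\<integral>x. iexp (\<theta> * (\<mu> + \<sigma> * x)) \<partial>density lborel std_normal_density)"
    by (simp add: char_def integral_distr)
  also have "\<dots> = (\<integral>x. iexp (\<theta> * \<mu>) * iexp ((\<sigma> * \<theta>) * x) \<partial>density lborel std_normal_density)"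
    by (simp add: exp_add[symmetric] algebra_simps)
  also have "\<dots> = iexp (\<theta> * \<mu>) * char std_normal_distribution (\<sigma> * \<theta>)"
    by (simp add: char_def)
  also have "\<dots> = iexp (\<theta> * \<mu>) * exp (- (\<sigma> * \<theta>)\<^sup>2 / 2)"
    by (simp add: char_std_normal_distribution)
  finally show ?thesis .
qed

text \<open>Split along the two values of \<open>\<tau>\<close>: on each part the last factor
  contributes the characteristic function of \<open>\<xi>\<close> at \<open>\<theta>\<close> or at
  \<open>- \<theta>\<close>, and these agree by symmetry. Independence is assumed of
  \<open>Z\<close> and \<open>Z'\<close> because \<open>W\<close> and \<open>\<tau>\<close> have to
  be jointly independent of \<open>\<xi>\<close>.\<close>

lemma (in prob_space) indep_var_char_sign:
  fixes w s :: "'b \<Rightarrow> real" and x :: "'b \<Rightarrow> real"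
  assumes ind: "indep_var N Z N' Z'"
    and meas [measurable]: "w \<in> borel_measurable N" "s \<in> borel_measurable N" "x \<in> borel_measurable N'"
  defines "W \<equiv> \<lambda>\<omega>. w (Z \<omega>)" and "\<tau> \<equiv> \<lambda>\<omega>. s (Z \<omega>)" and "\<xi> \<equiv> \<lambda>\<omega>. x (Z' \<omega>)"
  assumes
    sym: "char (distr M borel \<xi>) (- \<theta>) = char (distr M borel \<xi>) \<theta>"
    and \<tau>: "\<And>\<omega>. \<omega> \<in> space M \<Longrightarrow> \<tau> \<omega> = 1 \<or> \<tau> \<omega> = -1"
  shows "char (distr M borel (\<lambda>\<omega>. W \<omega> + \<tau> \<omega> * \<xi> \<omega>)) \<theta> =
    char (distr M borel W) \<theta> * char (distr M borel \<xi>) \<theta>"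
proof -
  have [measurable]: "W \<in> borel_measurable M" "\<tau> \<in> borel_measurable M" "\<xi> \<in> borel_measurable M"
    using measurable_compose[OF indep_var_rv1[OF ind] meas(1)]
      measurable_compose[OF indep_var_rv1[OF ind] meas(2)]
      measurable_compose[OF indep_var_rv2[OF ind] meas(3)]
    by (simp_all add: W_def \<tau>_def \<xi>_def)
  define A where "A c \<omega> = (if \<tau> \<omega> = c then iexp (\<theta> * W \<omega>) else 0)" for c :: real and \<omega>
  have [measurable]: "A c \<in> borel_measurable M" for c unfolding A_def by measurable
  have A_int [simp]: "integrable M (A c)" for c
    by (rule integrable_const_bound[of _ 1]) (auto simp: A_def)
  have E_int [simp]: "integrable M (\<lambda>\<omega>. iexp (r * f \<omega>))" if "f \<in> borel_measurable M" for f :: "'a \<Rightarrow> real" and r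
    using that by (intro integrable_const_bound[of _ 1]) auto
  have indep: "indep_var borel (A c) borel (\<lambda>\<omega>. iexp (r * \<xi> \<omega>))" for c r
  proof -
    have "indep_var borel ((\<lambda>z. if s z = c then iexp (\<theta> * w z) else 0) \<circ> Z) borel ((\<lambda>z. iexp (r * x z)) \<circ> Z')"
      by (rule indep_var_compose[OF ind]) measurable
    moreover have "(\<lambda>z. if s z = c then iexp (\<theta> * w z) else 0) \<circ> Z = A c"
      by (auto simp: fun_eq_iff A_def W_def \<tau>_def)
    ultimately show ?thesis by (simp add: comp_def \<xi>_def)
  qed
  have prod: "(\<integral>\<omega>. A c \<omega> * iexp (r * \<xi> \<omega>) \<partial>M) = (\<integral>\<omega>. A c \<omega> \<partial>M) * char (distr M borel \<xi>) r"
    "integrable M (\<lambda>\<omega>. A c \<omega> * iexp (r * \<xi> \<omega>))" for c r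
    using indep_var_lebesgue_integral[OF indep[of c r] A_int E_int[of \<xi> r]]
      indep_var_integrable[OF indep[of c r] A_int E_int[of \<xi> r]]
    by (simp_all add: char_def integral_distr)
  have "char (distr M borel (\<lambda>\<omega>. W \<omega> + \<tau> \<omega> * \<xi> \<omega>)) \<theta> = (\<integral>\<omega>. iexp (\<theta> * (W \<omega> + \<tau> \<omega> * \<xi> \<omega>)) \<partial>M)"
    by (simp add: char_def integral_distr)
  also have "\<dots> = (\<integral>\<omega>. A 1 \<omega> * iexp (\<theta> * \<xi> \<omega>) + A (-1) \<omega> * iexp ((- \<theta>) * \<xi> \<omega>) \<partial>M)"
  proof (rule Bochner_Integration.integral_cong[OF refl])
    fix \<omega> assume "\<omega> \<in> space M"
    then show "iexp (\<theta> * (W \<omega> + \<tau> \<omega> * \<xi> \<omega>)) = A 1 \<omega> * iexp (\<theta> * \<xi> \<omega>) + A (-1) \<omega> * iexp ((- \<theta>) * \<xi> \<omega>)"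
      using \<tau> by (auto simp: A_def exp_add[symmetric] algebra_simps)
  qed
  also have "\<dots> = ((\<integral>\<omega>. A 1 \<omega> \<partial>M) + (\<integral>\<omega>. A (-1) \<omega> \<partial>M)) * char (distr M borel \<xi>) \<theta>"
    unfolding prod Bochner_Integration.integral_add[OF prod(2) prod(2)] sym by (simp add: algebra_simps)
  also have "(\<integral>\<omega>. A 1 \<omega> \<partial>M) + (\<integral>\<omega>. A (-1) \<omega> \<partial>M) = (\<integral>\<omega>. A 1 \<omega> + A (-1) \<omega> \<partial>M)"
    by simp
  also have "\<dots> = (\<integral>\<omega>. iexp (\<theta> * W \<omega>) \<partial>M)"
    by (rule Bochner_Integration.integral_cong[OF refl]) (use \<tau> in \<open>auto simp: A_def\<close>)
  also have "\<dots> = char (distr M borel W) \<theta>"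
    by (simp add: char_def integral_distr)
  finally show ?thesis .
qed

text \<open>A step flipped by a sign that depends on the past multiplies the characteristic function
  by the same Gaussian factor as an unflipped one; Levy's uniqueness theorem then identifies the law
  of the endpoint. Predictability means here that \<open>\<tau> i\<close> is determined by the
  coordinates below \<open>i\<close> and measurable in them.\<close>

theorem (in prob_space) predictable_sign_walk:
  fixes \<xi> :: "nat \<Rightarrow> 'a \<Rightarrow> real" and \<tau> :: "nat \<Rightarrow> (nat \<Rightarrow> real) \<Rightarrow> real"
  assumes ind: "indep_vars (\<lambda>_. borel) \<xi> {..<n}"
    and normal: "\<And>i. i < n \<Longrightarrow> distributed M lborel (\<xi> i) (normal_density 0 \<sigma>)"
    and "0 < \<sigma>" "0 < n"
    and \<tau>_meas: "\<And>i. i < n \<Longrightarrow> \<tau> i \<in> borel_measurable (PiM {..<i} (\<lambda>_. borel))"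
    and \<tau>_restrict: "\<And>i z. \<tau> i (restrict z {..<i}) = \<tau> i z"
    and \<tau>_sign: "\<And>i z. \<tau> i z = 1 \<or> \<tau> i z = -1"
  shows "(\<lambda>\<omega>. \<Sum>i<n. \<tau> i (\<lambda>j. \<xi> j \<omega>) * \<xi> i \<omega>) \<in> borel_measurable M"
    and "distr M borel (\<lambda>\<omega>. \<Sum>i<n. \<tau> i (\<lambda>j. \<xi> j \<omega>) * \<xi> i \<omega>) =
      density lborel (normal_density 0 (sqrt n * \<sigma>))"
proof -
  define W where "W m z = (\<Sum>i<m. \<tau> i z * z i)" for m :: nat and z :: "nat \<Rightarrow> real"
  define \<Xi> where "\<Xi> m \<omega> = restrict (\<lambda>i. \<xi> i \<omega>) {..<m}" for m :: nat and \<omega>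
  have \<xi>_m [measurable]: "\<xi> i \<in> borel_measurable M" if "i < n" for i
    using ind that by (auto simp: indep_vars_def)
  have \<tau>_meas': "\<tau> i \<in> borel_measurable (PiM {..<m} (\<lambda>_. borel))" if "i \<le> m" "i < n" for i m
  proof -
    have "(\<lambda>z. \<tau> i (restrict z {..<i})) \<in> borel_measurable (PiM {..<m} (\<lambda>_. borel))"
      using \<tau>_meas[OF that(2)] that(1)
      by (intro measurable_compose[OF measurable_restrict_subset]) auto
    thus ?thesis by (simp add: \<tau>_restrict)
  qed
  have W_meas: "W m \<in> borel_measurable (PiM {..<m} (\<lambda>_. borel))" if "m \<le> n" for m
    unfolding W_def using \<tau>_meas' that by (intro borel_measurable_sum borel_measurable_times) auto
  have W_restrict: "W m (\<Xi> m \<omega>) = W m (\<lambda>i. \<xi> i \<omega>)" for m \<omega>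
  proof -
    have "\<tau> i (\<Xi> m \<omega>) = \<tau> i (\<lambda>j. \<xi> j \<omega>)" if "i < m" for i
    proof -
      have "restrict (\<Xi> m \<omega>) {..<i} = restrict (\<lambda>j. \<xi> j \<omega>) {..<i}"
        using that by (auto simp: \<Xi>_def restrict_def)
      thus ?thesis by (metis \<tau>_restrict)
    qed
    thus ?thesis unfolding W_def by (intro sum.cong) (auto simp: \<Xi>_def)
  qed
  have [measurable]: "(\<lambda>\<omega>. W m (\<lambda>i. \<xi> i \<omega>)) \<in> borel_measurable M" if "m \<le> n" for m
    unfolding W_restrict[symmetric]
    by (rule measurable_compose[OF _ W_meas[OF that]])
       (use that in \<open>auto simp: \<Xi>_def intro!: measurable_restrict\<close>)
  have \<xi>_distr: "distr M borel (\<xi> i) = density lborel (normal_density 0 \<sigma>)" if "i < n" for i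
    using normal[OF that] unfolding distributed_def
    by (metis (no_types, lifting) distr_cong sets_lborel)
  have ch: "char (distr M borel (\<lambda>\<omega>. W m (\<lambda>i. \<xi> i \<omega>))) \<theta> = exp (- (sqrt m * \<sigma> * \<theta>)\<^sup>2 / 2)"
    if "m \<le> n" for m \<theta>
    using that
  proof (induction m)
    case 0
    then show ?case by (simp add: W_def char_def integral_distr prob_space integral_return)
  next
    case (Suc m)
    have mn: "m < n" using Suc by simp
    have i: "indep_var (PiM {..<m} (\<lambda>_. borel)) (\<Xi> m) (PiM {m} (\<lambda>_. borel)) (\<lambda>\<omega>. restrict (\<lambda>i. \<xi> i \<omega>) {m})"
      unfolding \<Xi>_def using mn by (intro indep_var_restrict[OF ind]) auto
    have \<tau>: "\<tau> m (\<Xi> m \<omega>) = \<tau> m (\<lambda>j. \<xi> j \<omega>)" for \<omega>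
      by (simp add: \<Xi>_def \<tau>_restrict)
    have "char (distr M borel (\<lambda>\<omega>. W (Suc m) (\<lambda>i. \<xi> i \<omega>))) \<theta> =
       char (distr M borel (\<lambda>\<omega>. W m (\<lambda>i. \<xi> i \<omega>))) \<theta> * char (distr M borel (\<xi> m)) \<theta>"
      using indep_var_char_sign[OF i, of "W m" "\<tau> m" "\<lambda>z. z m" \<theta>] W_meas[of m] \<tau>_meas[of m] \<tau>_sign mn \<open>0 < \<sigma>\<close>
      by (simp add: \<xi>_distr char_normal W_restrict \<tau>) (simp add: W_def)
    also have "\<dots> = of_real (exp (- (sqrt m * \<sigma> * \<theta>)\<^sup>2 / 2) * exp (- (\<sigma> * \<theta>)\<^sup>2 / 2))"
      using Suc mn \<open>0 < \<sigma>\<close> by (simp add: \<xi>_distr char_normal)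
    also have "exp (- (sqrt m * \<sigma> * \<theta>)\<^sup>2 / 2) * exp (- (\<sigma> * \<theta>)\<^sup>2 / 2) = exp (- (sqrt (Suc m) * \<sigma> * \<theta>)\<^sup>2 / 2)"
      unfolding exp_add[symmetric] by (simp add: power_mult_distrib field_simps)
    finally show ?case .
  qed
  have "distr M borel (\<lambda>\<omega>. W n (\<lambda>i. \<xi> i \<omega>)) = density lborel (normal_density 0 (sqrt n * \<sigma>))"
  proof (rule Levy_uniqueness)
    show "real_distribution (distr M borel (\<lambda>\<omega>. W n (\<lambda>i. \<xi> i \<omega>)))"
      by (intro real_distribution_distr) auto
    have "prob_space (density lborel (normal_density 0 (sqrt n * \<sigma>)))"
      using assms(3,4) by (intro prob_space_normal_density) simp
    then show "real_distribution (density lborel (normal_density 0 (sqrt n * \<sigma>)))"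
      by (simp add: real_distribution_def real_distribution_axioms_def)
    show "char (distr M borel (\<lambda>\<omega>. W n (\<lambda>i. \<xi> i \<omega>))) = char (density lborel (normal_density 0 (sqrt n * \<sigma>)))"
      using assms(3,4) by (simp add: fun_eq_iff ch char_normal)
  qed
  thus "distr M borel (\<lambda>\<omega>. \<Sum>i<n. \<tau> i (\<lambda>j. \<xi> j \<omega>) * \<xi> i \<omega>) =
      density lborel (normal_density 0 (sqrt n * \<sigma>))"
    by (simp add: W_def)
  have "(\<lambda>\<omega>. W n (\<lambda>i. \<xi> i \<omega>)) \<in> borel_measurable M" by simp
  thus "(\<lambda>\<omega>. \<Sum>i<n. \<tau> i (\<lambda>j. \<xi> j \<omega>) * \<xi> i \<omega>) \<in> borel_measurable M"
    by (simp add: W_def)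
qed

subsection \<open>Swings on a grid\<close>

text \<open>The value at 0 is 1, so that every flip is 1 or -1, also when \<open>v\<close> or
  \<open>b\<close> is at 0.\<close>

definition sg :: "real \<Rightarrow> real" where "sg x = (if x < 0 then -1 else 1)"

text \<open>
  The state \<open>(k, y, v, b)\<close> records the number \<open>k\<close> of completed swings, the size \<open>y\<close> of the current
  swing (up for even \<open>k\<close>, down for odd \<open>k\<close>), a copy \<open>v\<close> of \<open>\<plusminus>y\<close> driven by sign-flipped increments, and
  the position \<open>b\<close>. For odd \<open>k\<close> the term \<open>sg b * x\<close> differs from the increment of \<open>|b|\<close> only when \<open>b\<close>
  changes its sign; \<open>|b|\<close> then visits \<open>0\<close> between two grid points, and the step ends the swing.
\<close>

definition chain_step :: "real \<Rightarrow> real \<Rightarrow> nat \<times> real \<times> real \<times> real \<Rightarrow> nat \<times> real \<times> real \<times> real" where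
  "chain_step \<epsilon> x st = (case st of (k, y, v, b) \<Rightarrow>
     let y' = max 0 (if even k then y + (\<bar>b + x\<bar> - \<bar>b\<bar>) else y - sg b * x)
     in if \<epsilon> \<le> y' then (Suc k, 0, 0, b + x) else (k, y', v + sg v * ((-1) ^ k * sg b * x), b + x))"

primrec chain :: "real \<Rightarrow> (nat \<Rightarrow> real) \<Rightarrow> nat \<Rightarrow> nat \<times> real \<times> real \<times> real" where
  "chain \<epsilon> z 0 = (0, 0, 0, 0)"
| "chain \<epsilon> z (Suc i) = chain_step \<epsilon> (z i) (chain \<epsilon> z i)"

text \<open>\<open>sg b\<close> turns an increment of \<open>b\<close> into one of
  \<open>\<bar>b\<bar>\<close>, up to crossings of 0; \<open>(-1) ^ k\<close> turns it into one of
  the swing size; \<open>sg v\<close> makes \<open>\<bar>v\<bar>\<close> follow, reflected at 0. The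
  factor \<open>s k\<close> is a free sign for the whole \<open>k\<close>-th lattice step.\<close>

definition flip :: "real \<Rightarrow> (nat \<Rightarrow> real) \<Rightarrow> nat \<Rightarrow> (nat \<Rightarrow> real) \<Rightarrow> real" where
  "flip \<epsilon> s i z = (case chain \<epsilon> z i of (k, y, v, b) \<Rightarrow> s k * (sg v * ((-1) ^ k * sg b)))"

definition walk :: "real \<Rightarrow> (nat \<Rightarrow> real) \<Rightarrow> nat \<Rightarrow> (nat \<Rightarrow> real) \<Rightarrow> real" where
  "walk \<epsilon> s n z = (\<Sum>i<n. flip \<epsilon> s i z * z i)"

lemma abs_sg [simp]: "\<bar>sg x\<bar> = 1"
  by (simp add: sg_def)

lemma abs_add_sg: "\<bar>v + sg v * g\<bar> = \<bar>\<bar>v\<bar> + g\<bar>"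
  by (auto simp: sg_def)

text \<open>
  Two nonnegative walks with the same increments \<open>g\<close>, each of them pushed upwards only near \<open>0\<close>, stay
  close together: the pushes do not accumulate.
\<close>

lemma skorokhod_step:
  fixes y v y' v' g \<delta> :: real
  assumes "\<bar>y - v\<bar> \<le> \<delta>" "0 \<le> y'" "0 \<le> v'"
    and "y + g \<le> y'" "y + g < y' \<Longrightarrow> y' \<le> \<delta>"
    and "v + g \<le> v'" "v + g < v' \<Longrightarrow> v' \<le> \<delta>"
  shows "\<bar>y' - v'\<bar> \<le> \<delta>"
  using assms by linarith

text \<open>\<open>\<delta>\<close> bounds the increments. The last two clauses say that an upward
  swing starts at height at least 0 and a downward one at height at least \<open>\<epsilon>\<close>;
  by the latter a downward swing is complete as soon as \<open>b\<close> changes its sign.\<close>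

definition chain_inv :: "real \<Rightarrow> real \<Rightarrow> nat \<times> real \<times> real \<times> real \<Rightarrow> bool" where
  "chain_inv \<epsilon> \<delta> st = (case st of (k, y, v, b) \<Rightarrow>
     0 \<le> y \<and> y < \<epsilon> \<and> \<bar>y - \<bar>v\<bar>\<bar> \<le> \<delta> \<and> (even k \<longrightarrow> y \<le> \<bar>b\<bar>) \<and> (odd k \<longrightarrow> \<epsilon> \<le> \<bar>b\<bar> + y))"

lemma chain_step_close:
  fixes x y v b \<delta> \<epsilon> :: real and k :: nat
  assumes inv: "chain_inv \<epsilon> \<delta> (k, y, v, b)" and x: "\<bar>x\<bar> \<le> \<delta>"
  defines "y' \<equiv> max 0 (if even k then y + (\<bar>b + x\<bar> - \<bar>b\<bar>) else y - sg b * x)"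
  shows "\<bar>y' - \<bar>v + sg v * ((-1) ^ k * sg b * x)\<bar>\<bar> \<le> \<delta>"
    and "y' \<le> y + \<bar>x\<bar>"
proof -
  let ?g = "(-1) ^ k * sg b * x"
  have y: "0 \<le> y" "\<bar>y - \<bar>v\<bar>\<bar> \<le> \<delta>" "even k \<Longrightarrow> y \<le> \<bar>b\<bar>"
    using inv by (auto simp: chain_inv_def)
  have g: "\<bar>?g\<bar> = \<bar>x\<bar>" by (simp add: abs_mult)
  have 1: "y + ?g \<le> y'" by (cases "even k") (auto simp: y'_def sg_def)
  \<comment> \<open>Besides the clamp at 0, the push can come from a sign change of \<open>b\<close>
    for even \<open>k\<close>. Then \<open>\<bar>b + x\<bar> \<le> \<bar>x\<bar>\<close>, and
    \<open>y \<le> \<bar>b\<bar>\<close> gives \<open>y' \<le> \<bar>b + x\<bar>\<close>.\<close>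
  have 2: "y' \<le> \<delta>" if "y + ?g < y'"
    using that y x by (cases "even k") (auto simp: y'_def sg_def max_def abs_if split: if_splits)
  have v': "\<bar>v + sg v * ?g\<bar> = \<bar>\<bar>v\<bar> + ?g\<bar>" by (rule abs_add_sg)
  show "\<bar>y' - \<bar>v + sg v * ?g\<bar>\<bar> \<le> \<delta>"
    unfolding v'
    by (rule skorokhod_step[OF y(2) _ _ 1 2]) (use g x in \<open>auto simp: y'_def\<close>)
  show "y' \<le> y + \<bar>x\<bar>"
    using y by (cases "even k") (auto simp: y'_def sg_def)
qed

lemma chain_inv_step:
  fixes x :: real
  assumes inv: "chain_inv \<epsilon> \<delta> st" and x: "\<bar>x\<bar> \<le> \<delta>" and "0 < \<epsilon>" "0 \<le> \<delta>"
  shows "chain_inv \<epsilon> \<delta> (chain_step \<epsilon> x st)"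
proof -
  obtain k y v b where st: "st = (k, y, v, b)" by (cases st) auto
  define y' where "y' = max 0 (if even k then y + (\<bar>b + x\<bar> - \<bar>b\<bar>) else y - sg b * x)"
  have y: "0 \<le> y" "even k \<Longrightarrow> y \<le> \<bar>b\<bar>" "odd k \<Longrightarrow> \<epsilon> \<le> \<bar>b\<bar> + y"
    using inv by (auto simp: chain_inv_def st)
  note c = chain_step_close(1)[OF inv[unfolded st] x, folded y'_def]
  have step: "chain_step \<epsilon> x st = (if \<epsilon> \<le> y' then (Suc k, 0, 0, b + x)
      else (k, y', v + sg v * ((-1) ^ k * sg b * x), b + x))"
    by (simp add: chain_step_def st y'_def Let_def)
  have e: "y' \<le> \<bar>b + x\<bar>" if "even k" using that y by (auto simp: y'_def)
  have o: "\<epsilon> \<le> \<bar>b + x\<bar> + y'" if "odd k" using that y by (auto simp: y'_def sg_def)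
  show ?thesis
  proof (cases "\<epsilon> \<le> y'")
    case True
    then show ?thesis using e assms(3,4) by (simp add: step chain_inv_def) linarith
  next
    case False
    moreover have "0 \<le> y'" by (simp add: y'_def)
    ultimately show ?thesis using e o c by (simp add: step chain_inv_def)
  qed
qed

lemma chain_inv_chain:
  assumes "\<And>i. i < n \<Longrightarrow> \<bar>z i\<bar> \<le> \<delta>" and "0 < \<epsilon>" "0 \<le> \<delta>"
  shows "chain_inv \<epsilon> \<delta> (chain \<epsilon> z n)"
  using assms(1)
proof (induction n)
  case 0
  then show ?case using assms(2,3) by (simp add: chain_inv_def)
next
  case (Suc n)
  then show ?case using chain_inv_step[OF _ _ assms(2,3)] by auto
qed

text \<open>All increments of one swing carry the same free sign, so they add up to that sign times
  \<open>v\<close>. Hence \<open>cs\<close> lists the final values of \<open>v\<close> in the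
  completed swings, and the entry appended to it belongs to the unfinished one.\<close>

lemma walk_decomposition:
  assumes "\<And>i. i < n \<Longrightarrow> \<bar>z i\<bar> \<le> \<delta>" and "0 < \<epsilon>" "0 \<le> \<delta>"
  shows "\<exists>cs. length cs = fst (chain \<epsilon> z n) \<and> (\<forall>c\<in>set cs. \<bar>\<bar>c\<bar> - \<epsilon>\<bar> \<le> 2 * \<delta>) \<and>
     (\<forall>s. walk \<epsilon> s n z = (\<Sum>j<Suc (length cs). s j * (cs @ [fst (snd (snd (chain \<epsilon> z n)))]) ! j))"
  using assms(1)
proof (induction n)
  case 0
  then show ?case by (intro exI[of _ "[]"]) (auto simp: walk_def)
next
  case (Suc n)
  obtain k y v b where st: "chain \<epsilon> z n = (k, y, v, b)" by (cases "chain \<epsilon> z n") auto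
  obtain cs where cs: "length cs = k" "\<forall>c\<in>set cs. \<bar>\<bar>c\<bar> - \<epsilon>\<bar> \<le> 2 * \<delta>"
     "\<forall>s. walk \<epsilon> s n z = (\<Sum>j<Suc k. s j * (cs @ [v]) ! j)"
    using Suc by (auto simp: st)
  let ?v = "v + sg v * ((-1) ^ k * sg b * z n)"
  define y' where "y' = max 0 (if even k then y + (\<bar>b + z n\<bar> - \<bar>b\<bar>) else y - sg b * z n)"
  have inv: "chain_inv \<epsilon> \<delta> (k, y, v, b)"
    using chain_inv_chain[of n z \<delta> \<epsilon>] Suc.prems assms(2,3) by (simp add: st)
  have z: "\<bar>z n\<bar> \<le> \<delta>" using Suc.prems by simp
  note c = chain_step_close[OF inv z, folded y'_def]
  have w: "walk \<epsilon> s (Suc n) z = (\<Sum>j<Suc k. s j * (cs @ [?v]) ! j)" for s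
  proof -
    have "walk \<epsilon> s (Suc n) z = walk \<epsilon> s n z + s k * (sg v * ((-1) ^ k * sg b)) * z n"
      by (simp add: walk_def flip_def st)
    also have "\<dots> = (\<Sum>j<Suc k. s j * (cs @ [?v]) ! j)"
      using cs by (simp add: nth_append algebra_simps)
    finally show ?thesis .
  qed
  have step: "chain \<epsilon> z (Suc n) = (if \<epsilon> \<le> y' then (Suc k, 0, 0, b + z n) else (k, y', ?v, b + z n))"
    by (simp add: chain_step_def st y'_def Let_def)
  show ?case
  proof (cases "\<epsilon> \<le> y'")
    case True
    \<comment> \<open>One \<open>\<delta>\<close> is the overshoot,
      \<open>y' < \<epsilon> + \<delta>\<close>; the other is the distance between \<open>y'\<close>
      and \<open>\<bar>?v\<bar>\<close>.\<close>
    have "\<bar>\<bar>?v\<bar> - \<epsilon>\<bar> \<le> 2 * \<delta>"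
    proof -
      have "y < \<epsilon>" using inv by (simp add: chain_inv_def)
      then show ?thesis using c z True by linarith
    qed
    moreover have "(\<Sum>j<Suc (Suc k). s j * ((cs @ [?v]) @ [0]) ! j) = (\<Sum>j<Suc k. s j * (cs @ [?v]) ! j)" for s
    proof -
      have "(\<Sum>j<Suc k. s j * ((cs @ [?v]) @ [0]) ! j) = (\<Sum>j<Suc k. s j * (cs @ [?v]) ! j)"
        using cs(1) by (intro sum.cong) (auto simp: nth_append)
      thus ?thesis using cs(1) by (simp add: nth_append)
    qed
    ultimately show ?thesis
      using True cs(1,2) by (intro exI[of _ "cs @ [?v]"]) (simp add: step w del: chain.simps append_assoc sum.lessThan_Suc)
  next
    case False
    then show ?thesis using cs(1,2) by (intro exI[of _ cs]) (simp add: step w del: chain.simps append_assoc sum.lessThan_Suc)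
  qed
qed

text \<open>
  For \<open>\<eta> = 0\<close> and up to the jumps, this is twice the squared integer closest to \<open>x / (2\<epsilon>)\<close>. The shift
  \<open>\<eta>\<close> absorbs the discretisation errors, from above if \<open>\<eta> > 0\<close> and from below if \<open>\<eta> < 0\<close>.
\<close>

definition cell :: "real \<Rightarrow> real \<Rightarrow> real \<Rightarrow> real" where
  "cell \<epsilon> \<eta> x = 2 * (real_of_int \<lfloor>(max 0 (\<bar>x\<bar> + \<eta>) + \<epsilon>) / (2 * \<epsilon>)\<rfloor>)\<^sup>2"

section \<open>Averages over the signs of the lattice steps\<close>

primrec sign_avg :: "nat \<Rightarrow> ((nat \<Rightarrow> real) \<Rightarrow> real) \<Rightarrow> real" where
  "sign_avg 0 F = F (\<lambda>_. 1)"
| "sign_avg (Suc n) F = (sign_avg n (\<lambda>s. F (s(n := 1))) + sign_avg n (\<lambda>s. F (s(n := -1)))) / 2"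

primrec list_avg :: "real list \<Rightarrow> (real \<Rightarrow> real) \<Rightarrow> real \<Rightarrow> real" where
  "list_avg [] f w = f w"
| "list_avg (c # cs) f w = (list_avg cs f (w + c) + list_avg cs f (w - c)) / 2"

lemma list_avg_snoc: "list_avg (cs @ [c]) f w = (list_avg cs (\<lambda>x. f (x + c)) w + list_avg cs (\<lambda>x. f (x - c)) w) / 2"
  by (induction cs arbitrary: w) (simp_all add: add_divide_distrib)

text \<open>Averaging over the sign of an absent step changes nothing, so one fixed number
  \<open>n\<close> of signs serves all paths, whatever their number of swings.
  \<open>list_avg\<close> branches at the first step, which suits an induction along the walk,
  whereas \<open>sign_avg\<close> releases the last sign first.\<close>

lemma sign_avg_list_avg:
  assumes "length cs \<le> n"
  shows "sign_avg n (\<lambda>s. f (w + (\<Sum>j<length cs. s j * cs ! j))) = list_avg cs f w"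
  using assms
proof (induction n arbitrary: cs f)
  case 0
  then show ?case by simp
next
  case (Suc n)
  show ?case
  proof (cases "length cs \<le> n")
    case True
    have "(\<Sum>j<length cs. (s(n := x)) j * cs ! j) = (\<Sum>j<length cs. s j * cs ! j)" for s x
      using True by (intro sum.cong) auto
    then show ?thesis using Suc.IH[OF True] by (simp del: fun_upd_apply)
  next
    case False
    then obtain ds c where cs: "cs = ds @ [c]" "length ds = n"
      using Suc.prems by (metis append_butlast_last_id diff_Suc_1 le_SucE length_butlast list.size(3) zero_le)
    have sum: "(\<Sum>j<n. s j * (ds @ [c]) ! j) = (\<Sum>j<n. s j * ds ! j)" "(ds @ [c]) ! n = c" for s
      using cs(2) by (auto intro!: sum.cong simp: nth_append)
    show ?thesis
      using Suc.IH[of ds "\<lambda>x. f (x + c)"] Suc.IH[of ds "\<lambda>x. f (x - c)"] cs(2)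
      by (simp add: cs(1) list_avg_snoc sum add.assoc[symmetric] add_diff_eq)
  qed
qed

text \<open>Averaging is free under the integral because every single choice of signs already gives
  the same value \<open>h\<close>.\<close>

lemma has_bochner_integral_sign_avg:
  fixes g :: "(nat \<Rightarrow> real) \<Rightarrow> 'a \<Rightarrow> real"
  assumes "\<And>s. (\<And>j. s j = 1 \<or> s j = -1) \<Longrightarrow> has_bochner_integral M (g s) h"
  shows "has_bochner_integral M (\<lambda>\<omega>. sign_avg n (\<lambda>s. g s \<omega>)) h"
  using assms
proof (induction n arbitrary: g)
  case 0
  then show ?case by simp
next
  case (Suc n)
  have "has_bochner_integral M (\<lambda>\<omega>. sign_avg n (\<lambda>s. g (s(n := c)) \<omega>)) h" if "c = 1 \<or> c = -1" for c :: real
    using Suc.prems that by (intro Suc.IH) auto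
  from has_bochner_integral_add[OF this this, of 1 "-1"]
  have "has_bochner_integral M (\<lambda>\<omega>. (sign_avg n (\<lambda>s. g (s(n := 1)) \<omega>) + sign_avg n (\<lambda>s. g (s(n := -1)) \<omega>)) / 2)
     ((h + h) / 2)"
    by (intro has_bochner_integral_divide_zero) auto
  then show ?case by simp
qed

lemma sign_avg_mono: "(\<And>s. F s \<le> G s) \<Longrightarrow> sign_avg n F \<le> sign_avg n G"
proof (induction n arbitrary: F G)
  case (Suc n)
  have "sign_avg n (\<lambda>s. F (s(n := c))) \<le> sign_avg n (\<lambda>s. G (s(n := c)))" for c
    by (rule Suc.IH) (rule Suc.prems)
  from add_mono[OF this[of 1] this[of "-1"]] show ?case by (simp add: divide_right_mono)
qed simp

lemma sign_avg_const [simp]: "sign_avg n (\<lambda>s. c) = c"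
  by (induction n) auto

lemma cell_nonneg: "0 \<le> cell \<epsilon> \<eta> x"
  by (simp add: cell_def)

lemma cell_abs: "\<bar>x\<bar> = \<bar>y\<bar> \<Longrightarrow> cell \<epsilon> \<eta> x = cell \<epsilon> \<eta> y"
  by (simp add: cell_def)

lemma cell_ge:
  fixes j :: int
  assumes "0 < \<epsilon>" "0 \<le> j" "2 * real_of_int j * \<epsilon> \<le> \<bar>x\<bar> + \<eta> + \<epsilon>"
  shows "2 * (real_of_int j)\<^sup>2 \<le> cell \<epsilon> \<eta> x"
proof -
  have "real_of_int j \<le> (max 0 (\<bar>x\<bar> + \<eta>) + \<epsilon>) / (2 * \<epsilon>)"
    using assms by (simp add: field_simps)
  hence "j \<le> \<lfloor>(max 0 (\<bar>x\<bar> + \<eta>) + \<epsilon>) / (2 * \<epsilon>)\<rfloor>" by (simp add: le_floor_iff)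
  thus ?thesis using assms(2) by (auto simp: cell_def intro!: power_mono)
qed

lemma cell_le:
  fixes j :: int
  assumes "0 < \<epsilon>" "\<bar>x\<bar> + \<eta> + \<epsilon> < 2 * (real_of_int j + 1) * \<epsilon>" "0 \<le> j"
  shows "cell \<epsilon> \<eta> x \<le> 2 * (real_of_int j)\<^sup>2"
proof -
  have "\<epsilon> < 2 * (real_of_int j + 1) * \<epsilon>"
    using assms(1,3) by simp
  hence "(max 0 (\<bar>x\<bar> + \<eta>) + \<epsilon>) / (2 * \<epsilon>) < real_of_int j + 1"
    using assms by (simp add: field_simps)
  hence "\<lfloor>(max 0 (\<bar>x\<bar> + \<eta>) + \<epsilon>) / (2 * \<epsilon>)\<rfloor> \<le> j" by linarith
  moreover have "0 \<le> (max 0 (\<bar>x\<bar> + \<eta>) + \<epsilon>) / (2 * \<epsilon>)" using assms(1) by simp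
  ultimately show ?thesis by (auto simp: cell_def intro!: power_mono)
qed

text \<open>\<open>cell\<close> is even, so the signs of \<open>w\<close> and \<open>v\<close> only
  permute the two terms.\<close>

lemma cell_pair: "cell \<epsilon> \<eta> (w + v) + cell \<epsilon> \<eta> (w - v) = cell \<epsilon> \<eta> (\<bar>w\<bar> + \<bar>v\<bar>) + cell \<epsilon> \<eta> (\<bar>w\<bar> - \<bar>v\<bar>)"
proof -
  have "cell \<epsilon> \<eta> (- v - w) = cell \<epsilon> \<eta> (w + v)" "cell \<epsilon> \<eta> (- w - v) = cell \<epsilon> \<eta> (w + v)" "cell \<epsilon> \<eta> (v - w) = cell \<epsilon> \<eta> (w - v)"
    by (auto intro!: cell_abs)
  then show ?thesis
    by (cases "0 \<le> w"; cases "0 \<le> v") (simp_all add: add.commute)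
qed

text \<open>The mean of \<open>cell \<epsilon> 0\<close> over the two signs of an unfinished nonzero
  step from \<open>Z * \<epsilon>\<close>. For even \<open>Z\<close> both ends lie in the cell of
  value \<open>Z^2 / 2\<close>; for odd \<open>Z\<close> they lie in the two adjacent cells, and the
  mean of \<open>(Z - 1)^2 / 2\<close> and \<open>(Z + 1)^2 / 2\<close> is
  \<open>(Z^2 + 1) / 2\<close>.\<close>

definition parity_sq :: "int \<Rightarrow> real" where
  "parity_sq Z = (real_of_int Z)\<^sup>2 / 2 + of_bool (odd Z) / 2"

text \<open>The shift \<open>\<eta>\<close> pays for two errors: less than
  \<open>\<eta> - \<delta>\<close> for the distance of \<open>w\<close> from the lattice point, and
  \<open>\<delta>\<close> for that of \<open>\<bar>v\<bar>\<close> from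
  \<open>y < \<epsilon>\<close>. After the shift both ends are in the intended cell or farther
  out.\<close>

lemma cell_pair_ge:
  assumes "0 < \<epsilon>" "\<bar>\<bar>v\<bar> - y\<bar> \<le> \<delta>" "0 \<le> y" "y < \<epsilon>" "\<bar>w - real_of_int Z * \<epsilon>\<bar> < \<eta> - \<delta>"
  shows "parity_sq Z \<le> (cell \<epsilon> \<eta> (w + v) + cell \<epsilon> \<eta> (w - v)) / 2"
proof -
  have "\<bar>real_of_int Z * \<epsilon>\<bar> = real_of_int \<bar>Z\<bar> * \<epsilon>" using assms(1) by (simp add: abs_mult)
  hence w: "real_of_int \<bar>Z\<bar> * \<epsilon> < \<bar>w\<bar> + \<eta> - \<delta>" using assms(5) by linarith
  show ?thesis
  proof (cases "even Z")
    case True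
    then obtain j where j: "\<bar>Z\<bar> = 2 * j" by (metis evenE even_abs_add_iff abs_eq_iff dvd_abs_iff)
    have "0 \<le> j" using j by linarith
    have "(real_of_int Z)\<^sup>2 = (real_of_int (2 * j))\<^sup>2"
      unfolding j[symmetric] by simp
    hence "parity_sq Z = 2 * (real_of_int j)\<^sup>2" using True by (simp add: parity_sq_def power_mult_distrib)
    moreover have "2 * (real_of_int j)\<^sup>2 \<le> cell \<epsilon> \<eta> (\<bar>w\<bar> + \<bar>v\<bar>)"
      using w assms \<open>0 \<le> j\<close> by (intro cell_ge) (auto simp: j)
    moreover have "2 * (real_of_int j)\<^sup>2 \<le> cell \<epsilon> \<eta> (\<bar>w\<bar> - \<bar>v\<bar>)"
      using w assms \<open>0 \<le> j\<close> by (intro cell_ge) (auto simp: j)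
    ultimately show ?thesis using cell_pair[of \<epsilon> \<eta> w v] by (simp add: field_simps)
  next
    case False
    hence "odd \<bar>Z\<bar>" by simp
    then obtain j where j: "\<bar>Z\<bar> = 2 * j + 1" by (rule oddE)
    have "0 \<le> j" using j by linarith
    have Z: "real_of_int \<bar>Z\<bar> = 2 * real_of_int j + 1" by (simp add: j)
    have "(real_of_int Z)\<^sup>2 = (2 * real_of_int j + 1)\<^sup>2"
      unfolding Z[symmetric] by simp
    hence "parity_sq Z = (2 * (real_of_int j)\<^sup>2 + 2 * (real_of_int (j + 1))\<^sup>2) / 2"
      using False by (simp add: parity_sq_def power2_eq_square algebra_simps)
    moreover have "2 * (real_of_int (j + 1))\<^sup>2 \<le> cell \<epsilon> \<eta> (\<bar>w\<bar> + \<bar>v\<bar>)"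
      using w assms \<open>0 \<le> j\<close> unfolding Z by (intro cell_ge) (auto simp: algebra_simps)
    moreover have "2 * (real_of_int j)\<^sup>2 \<le> cell \<epsilon> \<eta> (\<bar>w\<bar> - \<bar>v\<bar>)"
      using w assms \<open>0 \<le> j\<close> unfolding Z by (intro cell_ge) (auto simp: algebra_simps)
    ultimately show ?thesis using cell_pair[of \<epsilon> \<eta> w v] by (simp add: field_simps)
  qed
qed

lemma cell_pair_le:
  assumes "0 < \<epsilon>" "\<bar>\<bar>v\<bar> - y\<bar> \<le> \<delta>" "0 \<le> y" "y < \<epsilon>" "\<bar>w - real_of_int Z * \<epsilon>\<bar> < \<eta> - \<delta>"
  shows "(cell \<epsilon> (- \<eta>) (w + v) + cell \<epsilon> (- \<eta>) (w - v)) / 2 \<le> parity_sq Z"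
proof -
  have "\<bar>real_of_int Z * \<epsilon>\<bar> = real_of_int \<bar>Z\<bar> * \<epsilon>" using assms(1) by (simp add: abs_mult)
  hence w: "\<bar>w\<bar> < real_of_int \<bar>Z\<bar> * \<epsilon> + \<eta> - \<delta>" "real_of_int \<bar>Z\<bar> * \<epsilon> < \<bar>w\<bar> + \<eta> - \<delta>"
    using assms(5) by linarith+
  show ?thesis
  proof (cases "even Z")
    case True
    then obtain j where j: "\<bar>Z\<bar> = 2 * j" by (metis evenE even_abs_add_iff abs_eq_iff dvd_abs_iff)
    have "0 \<le> j" using j by linarith
    have "(real_of_int Z)\<^sup>2 = (real_of_int (2 * j))\<^sup>2"
      unfolding j[symmetric] by simp
    hence "parity_sq Z = 2 * (real_of_int j)\<^sup>2" using True by (simp add: parity_sq_def power_mult_distrib)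
    moreover have "cell \<epsilon> (- \<eta>) (\<bar>w\<bar> + \<bar>v\<bar>) \<le> 2 * (real_of_int j)\<^sup>2"
      using w assms \<open>0 \<le> j\<close> by (intro cell_le) (auto simp: j algebra_simps)
    moreover have "cell \<epsilon> (- \<eta>) (\<bar>w\<bar> - \<bar>v\<bar>) \<le> 2 * (real_of_int j)\<^sup>2"
      using w assms \<open>0 \<le> j\<close> by (intro cell_le) (auto simp: j algebra_simps)
    ultimately show ?thesis using cell_pair[of \<epsilon> "- \<eta>" w v] by (simp add: field_simps)
  next
    case False
    hence "odd \<bar>Z\<bar>" by simp
    then obtain j where j: "\<bar>Z\<bar> = 2 * j + 1" by (rule oddE)
    have "0 \<le> j" using j by linarith
    have Z: "real_of_int \<bar>Z\<bar> = 2 * real_of_int j + 1" by (simp add: j)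
    have "(real_of_int Z)\<^sup>2 = (2 * real_of_int j + 1)\<^sup>2"
      unfolding Z[symmetric] by simp
    hence "parity_sq Z = (2 * (real_of_int j)\<^sup>2 + 2 * (real_of_int (j + 1))\<^sup>2) / 2"
      using False by (simp add: parity_sq_def power2_eq_square algebra_simps)
    moreover have "cell \<epsilon> (- \<eta>) (\<bar>w\<bar> + \<bar>v\<bar>) \<le> 2 * (real_of_int (j + 1))\<^sup>2"
    proof (rule cell_le)
      have "\<bar>w\<bar> < 2 * (real_of_int j * \<epsilon>) + \<epsilon> + \<eta> - \<delta>"
        using w unfolding Z by (simp add: algebra_simps)
      hence "\<bar>\<bar>w\<bar> + \<bar>v\<bar>\<bar> + - \<eta> + \<epsilon> < 2 * (real_of_int j * \<epsilon>) + 4 * \<epsilon>"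
        using assms(1-4) by linarith
      thus "\<bar>\<bar>w\<bar> + \<bar>v\<bar>\<bar> + - \<eta> + \<epsilon> < 2 * (real_of_int (j + 1) + 1) * \<epsilon>"
        by (simp add: algebra_simps)
    qed (use assms \<open>0 \<le> j\<close> in auto)
    moreover have "cell \<epsilon> (- \<eta>) (\<bar>w\<bar> - \<bar>v\<bar>) \<le> 2 * (real_of_int j)\<^sup>2"
    proof (rule cell_le)
      define J where "J = real_of_int j * \<epsilon>"
      have "0 \<le> J" using assms(1) \<open>0 \<le> j\<close> by (simp add: J_def)
      moreover have "\<bar>w\<bar> < 2 * J + \<epsilon> + \<eta> - \<delta>" "2 * J + \<epsilon> < \<bar>w\<bar> + \<eta> - \<delta>"
        using w unfolding Z J_def by (simp_all add: algebra_simps)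
      ultimately have "\<bar>\<bar>w\<bar> - \<bar>v\<bar>\<bar> + - \<eta> + \<epsilon> < 2 * J + 2 * \<epsilon>"
        using assms(1-4) by linarith
      thus "\<bar>\<bar>w\<bar> - \<bar>v\<bar>\<bar> + - \<eta> + \<epsilon> < 2 * (real_of_int j + 1) * \<epsilon>"
        by (simp add: J_def algebra_simps)
    qed (use assms \<open>0 \<le> j\<close> in auto)
    ultimately show ?thesis using cell_pair[of \<epsilon> "- \<eta>" w v] by (simp add: field_simps)
  qed
qed

text \<open>Averaging \<open>(Z + 1)^2\<close> and \<open>(Z - 1)^2\<close> gives
  \<open>Z^2 + 1\<close>, the martingale property, while the parity of \<open>Z\<close> plus the
  number of remaining steps is preserved. Each step uses up \<open>\<beta>\<close> of the allowance
  \<open>\<eta> - \<delta>\<close>. With \<open>\<sigma>\<close> equal to 1 or -1 the same induction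
  yields the upper and the lower bound.\<close>

lemma list_avg_lattice:
  fixes R :: "real \<Rightarrow> real \<Rightarrow> bool"
  assumes "0 < \<epsilon>"
    and base: "\<And>w Z. \<bar>w - real_of_int Z * \<epsilon>\<bar> < \<eta> - \<delta> \<Longrightarrow> \<sigma> * ((f (w + v) + f (w - v)) / 2) \<le> \<sigma> * parity_sq Z"
    and cs: "\<forall>c\<in>set cs. \<bar>\<bar>c\<bar> - \<epsilon>\<bar> \<le> \<beta>"
    and "\<bar>w - real_of_int Z * \<epsilon>\<bar> + \<beta> * real (length cs) < \<eta> - \<delta>"
  shows "\<sigma> * list_avg (cs @ [v]) f w \<le>
    \<sigma> * ((real_of_int Z)\<^sup>2 / 2 + real (length cs) / 2 + of_bool (odd (Z + int (length cs))) / 2)"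
  using cs assms(4)
proof (induction cs arbitrary: w Z)
  case Nil
  then show ?case using base[of w Z] by (simp add: parity_sq_def)
next
  case (Cons c cs)
  let ?r = "\<lambda>Z. (real_of_int Z)\<^sup>2 / 2 + real (length cs) / 2 + of_bool (odd (Z + int (length cs))) / 2 :: real"
  have c: "\<bar>\<bar>c\<bar> - \<epsilon>\<bar> \<le> \<beta>" and cs: "\<forall>c\<in>set cs. \<bar>\<bar>c\<bar> - \<epsilon>\<bar> \<le> \<beta>" using Cons by auto
  have IH: "\<sigma> * list_avg (cs @ [v]) f (w + u) \<le> \<sigma> * ?r (Z + i)"
    if "\<bar>u - real_of_int i * \<epsilon>\<bar> \<le> \<beta>" for u i
  proof (rule Cons.IH[OF cs])
    have "w + u - real_of_int (Z + i) * \<epsilon> = (w - real_of_int Z * \<epsilon>) + (u - real_of_int i * \<epsilon>)"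
      by (simp add: algebra_simps)
    hence "\<bar>w + u - real_of_int (Z + i) * \<epsilon>\<bar> \<le> \<bar>w - real_of_int Z * \<epsilon>\<bar> + \<bar>u - real_of_int i * \<epsilon>\<bar>"
      by linarith
    moreover have "\<beta> * real (length (c # cs)) = \<beta> + \<beta> * real (length cs)" by (simp add: algebra_simps)
    ultimately show "\<bar>w + u - real_of_int (Z + i) * \<epsilon>\<bar> + \<beta> * real (length cs) < \<eta> - \<delta>"
      using that Cons.prems(2) by linarith
  qed
  have "\<sigma> * list_avg (cs @ [v]) f (w + c) + \<sigma> * list_avg (cs @ [v]) f (w - c) \<le> \<sigma> * ?r (Z + 1) + \<sigma> * ?r (Z - 1)"
  proof (cases "0 \<le> c")
    case True
    then have "\<bar>c - real_of_int 1 * \<epsilon>\<bar> \<le> \<beta>" "\<bar>- c - real_of_int (- 1) * \<epsilon>\<bar> \<le> \<beta>"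
      using c by auto
    from add_mono[OF IH[OF this(1)] IH[OF this(2)]] show ?thesis by simp
  next
    case False
    then have "\<bar>c - real_of_int (- 1) * \<epsilon>\<bar> \<le> \<beta>" "\<bar>- c - real_of_int 1 * \<epsilon>\<bar> \<le> \<beta>"
      using c by auto
    from add_mono[OF IH[OF this(1)] IH[OF this(2)]] show ?thesis by (simp add: add.commute)
  qed
  also have "\<dots> = 2 * (\<sigma> * ((real_of_int Z)\<^sup>2 / 2 + real (length (c # cs)) / 2 + of_bool (odd (Z + int (length (c # cs)))) / 2))"
    by (auto simp: power2_eq_square algebra_simps add_divide_distrib diff_divide_distrib)
  finally show ?case by (simp add: algebra_simps)
qed

text \<open>The total error is \<open>(2 * k + 1) * \<delta>\<close>: \<open>2 * \<delta>\<close>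
  for each completed lattice step and \<open>\<delta>\<close> for the unfinished one. The condition
  \<open>k < K\<close> reserves a sign for the unfinished step.\<close>

lemma sign_avg_cell_chain:
  assumes z: "\<And>i. i < n \<Longrightarrow> \<bar>z i\<bar> \<le> \<delta>" and "0 < \<epsilon>" "0 \<le> \<delta>"
    and k: "k = fst (chain \<epsilon> z n)" "k < K" and small: "(2 * real k + 1) * \<delta> < \<eta>"
  shows "real ((k + 1) div 2) \<le> sign_avg K (\<lambda>s. cell \<epsilon> \<eta> (walk \<epsilon> s n z))"
    and "sign_avg K (\<lambda>s. cell \<epsilon> (- \<eta>) (walk \<epsilon> s n z)) \<le> real ((k + 1) div 2)"
proof -
  obtain y v b where st: "chain \<epsilon> z n = (k, y, v, b)" using k by (cases "chain \<epsilon> z n") auto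
  have y: "0 \<le> y" "y < \<epsilon>" "\<bar>\<bar>v\<bar> - y\<bar> \<le> \<delta>"
    using chain_inv_chain[of n z \<delta> \<epsilon>] assms(1-3) by (auto simp: chain_inv_def st abs_minus_commute)
  obtain cs where cs: "length cs = k" "\<forall>c\<in>set cs. \<bar>\<bar>c\<bar> - \<epsilon>\<bar> \<le> 2 * \<delta>"
     and w: "walk \<epsilon> s n z = 0 + (\<Sum>j<length (cs @ [v]). s j * (cs @ [v]) ! j)" for s
    using walk_decomposition[of n z \<delta> \<epsilon>] assms(1-3) by (auto simp: st)
  have avg: "sign_avg K (\<lambda>s. f (walk \<epsilon> s n z)) = list_avg (cs @ [v]) f 0" for f
    unfolding w using cs(1) k(2) by (intro sign_avg_list_avg) simp
  have val: "real k / 2 + of_bool (odd k) / 2 = real ((k + 1) div 2)"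
    by (cases "even k") (auto elim!: evenE oddE simp: field_simps)
  have sm: "\<bar>0 - real_of_int 0 * \<epsilon>\<bar> + 2 * \<delta> * real (length cs) < \<eta> - \<delta>"
    using small by (simp add: cs(1) algebra_simps)
  have "- 1 * list_avg (cs @ [v]) (cell \<epsilon> \<eta>) 0 \<le> -1 * ((real_of_int 0)\<^sup>2 / 2 + real (length cs) / 2 + of_bool (odd (0 + int (length cs))) / 2)"
  proof (rule list_avg_lattice[OF assms(2) _ cs(2) sm])
    fix w Z assume "\<bar>w - real_of_int Z * \<epsilon>\<bar> < \<eta> - \<delta>"
    from cell_pair_ge[OF assms(2) y(3,1,2) this]
    show "- 1 * ((cell \<epsilon> \<eta> (w + v) + cell \<epsilon> \<eta> (w - v)) / 2) \<le> - 1 * parity_sq Z"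
      by simp
  qed
  then show "real ((k + 1) div 2) \<le> sign_avg K (\<lambda>s. cell \<epsilon> \<eta> (walk \<epsilon> s n z))"
    unfolding avg using val cs(1) by simp
  have "1 * list_avg (cs @ [v]) (cell \<epsilon> (- \<eta>)) 0 \<le> 1 * ((real_of_int 0)\<^sup>2 / 2 + real (length cs) / 2 + of_bool (odd (0 + int (length cs))) / 2)"
  proof (rule list_avg_lattice[OF assms(2) _ cs(2) sm])
    fix w Z assume "\<bar>w - real_of_int Z * \<epsilon>\<bar> < \<eta> - \<delta>"
    from cell_pair_le[OF assms(2) y(3,1,2) this]
    show "1 * ((cell \<epsilon> (- \<eta>) (w + v) + cell \<epsilon> (- \<eta>) (w - v)) / 2) \<le> 1 * parity_sq Z"
      by simp
  qed
  then show "sign_avg K (\<lambda>s. cell \<epsilon> (- \<eta>) (walk \<epsilon> s n z)) \<le> real ((k + 1) div 2)"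
    unfolding avg using val cs(1) by simp
qed

subsection \<open>Swings of a continuous path\<close>

text \<open>Existence of witnesses, instead of recursively defined times, gives a notion that is
  monotone in \<open>u\<close> and can be compared both with the grid process and with
  \<open>S_time\<close> and \<open>T_time\<close>. The inequality is non-strict because limits of
  strict swings satisfy no more than that.\<close>

primrec swings :: "(real \<Rightarrow> real) \<Rightarrow> real \<Rightarrow> nat \<Rightarrow> real \<Rightarrow> bool" where
  "swings X \<epsilon> 0 u = (0 \<le> u)"
| "swings X \<epsilon> (Suc k) u = (\<exists>p q r. swings X \<epsilon> k p \<and> p \<le> q \<and> q \<le> r \<and> r \<le> u \<and> \<epsilon> \<le> (-1) ^ k * (X r - X q))"

lemma swings_nonneg: "swings X \<epsilon> k u \<Longrightarrow> 0 \<le> u"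
  by (induction k arbitrary: u) force+

lemma swings_mono: "swings X \<epsilon> k u \<Longrightarrow> u \<le> v \<Longrightarrow> swings X \<epsilon> k v"
  by (cases k) (auto intro: order_trans)

lemma swings_Suc_imp: "swings X \<epsilon> (Suc k) u \<Longrightarrow> swings X \<epsilon> k u"
  by (auto intro: swings_mono order_trans)

lemma swings_le: "swings X \<epsilon> k u \<Longrightarrow> j \<le> k \<Longrightarrow> swings X \<epsilon> j u"
  by (induction k) (use swings_Suc_imp le_Suc_eq in blast)+

text \<open>Within a time shorter than \<open>\<rho>\<close> the path moves by less than
  \<open>\<epsilon>\<close>, so each swing lasts at least \<open>\<rho>\<close>. This bounds the
  number of swings independently of any grid.\<close>

lemma swings_bound:
  assumes "\<And>u v. 0 \<le> u \<Longrightarrow> u \<le> v \<Longrightarrow> v \<le> t \<Longrightarrow> v - u < \<rho> \<Longrightarrow> \<bar>X v - X u\<bar> < \<epsilon>"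
    and "swings X \<epsilon> k u" "u \<le> t"
  shows "real k * \<rho> \<le> u"
  using assms(2,3)
proof (induction k arbitrary: u)
  case 0
  then show ?case by simp
next
  case (Suc k)
  then obtain p q r where *: "swings X \<epsilon> k p" "p \<le> q" "q \<le> r" "r \<le> u" "\<epsilon> \<le> (-1) ^ k * (X r - X q)"
    by auto
  have "real k * \<rho> \<le> p" using Suc * by auto
  moreover have "\<rho> \<le> r - q"
  proof (rule ccontr)
    assume "\<not> \<rho> \<le> r - q"
    then have "\<bar>X r - X q\<bar> < \<epsilon>"
      using assms(1)[of q r] * Suc.prems swings_nonneg[OF *(1)] by auto
    moreover have "(-1) ^ k * (X r - X q) \<le> \<bar>X r - X q\<bar>"
      by (cases "even k") auto
    ultimately show False using * by linarith
  qed
  ultimately show ?case using * by (simp add: algebra_simps)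
qed

text \<open>\<open>q\<close> is the start of the current swing, moved to the present whenever the
  clamp at 0 acts. Grid swings are thus swings of the path for the same threshold. The one case that
  cannot be read off at grid points is a sign change of \<open>b\<close> for odd \<open>k\<close>,
  where a zero in between ends the swing.\<close>

lemma chain_swings:
  fixes \<beta> :: "real \<Rightarrow> real" and \<tau> :: "nat \<Rightarrow> real"
  assumes cont: "continuous_on {0..} \<beta>" and "\<beta> 0 = 0" and "\<tau> 0 = 0" "mono \<tau>" and "0 < \<epsilon>"
  defines "z \<equiv> \<lambda>i. \<beta> (\<tau> (Suc i)) - \<beta> (\<tau> i)" and "X \<equiv> \<lambda>u. \<bar>\<beta> u\<bar>"
  assumes st: "chain \<epsilon> z i = (k, y, v, b)"
  shows "b = \<beta> (\<tau> i) \<and> (\<exists>p q. swings X \<epsilon> k p \<and> p \<le> q \<and> q \<le> \<tau> i \<and> y = (-1) ^ k * (X (\<tau> i) - X q))"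
  using st
proof (induction i arbitrary: k y v b)
  case 0
  then show ?case using assms by (auto intro!: exI[of _ "0::real"])
next
  case (Suc i)
  obtain k' y0 v0 b0 where st: "chain \<epsilon> z i = (k', y0, v0, b0)" by (cases "chain \<epsilon> z i") auto
  obtain p q where b0: "b0 = \<beta> (\<tau> i)" and q: "swings X \<epsilon> k' p" "p \<le> q" "q \<le> \<tau> i" "y0 = (-1) ^ k' * (X (\<tau> i) - X q)"
    using Suc.IH[OF st] by blast
  define y' where "y' = max 0 (if even k' then y0 + (\<bar>b0 + z i\<bar> - \<bar>b0\<bar>) else y0 - sg b0 * z i)"
  have step: "(k, y, v, b) = (if \<epsilon> \<le> y' then (Suc k', 0, 0, b0 + z i)
      else (k', y', v0 + sg v0 * ((-1) ^ k' * sg b0 * z i), b0 + z i))"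
    unfolding Suc.prems[symmetric] by (simp add: st chain_step_def y'_def Let_def)
  have \<tau>: "\<tau> i \<le> \<tau> (Suc i)" "0 \<le> \<tau> i" using \<open>mono \<tau>\<close> \<open>\<tau> 0 = 0\<close> by (auto simp: mono_def) (metis le0)
  have b: "b0 + z i = \<beta> (\<tau> (Suc i))" by (simp add: b0 z_def)
  \<comment> \<open>The largest increment so far serves as \<open>\<delta>\<close>; what is drawn
    from the invariant is \<open>\<epsilon> \<le> \<bar>b0\<bar> + y0\<close> for odd
    \<open>k'\<close>.\<close>
  have inv: "chain_inv \<epsilon> (Max (insert 0 ((\<lambda>j. \<bar>z j\<bar>) ` {..<i}))) (chain \<epsilon> z i)"
    using \<open>0 < \<epsilon>\<close> by (intro chain_inv_chain) auto
  have swing: "swings X \<epsilon> (Suc k') r" if "q \<le> r" "\<epsilon> \<le> (-1) ^ k' * (X r - X q)" for r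
    using that q by auto
  show ?case
  proof (cases "even k' \<or> (b0 < 0 \<longleftrightarrow> b0 + z i < 0)")
    case True
    have y': "y' = max 0 ((-1) ^ k' * (X (\<tau> (Suc i)) - X q))"
      using True q(4) b b0 unfolding y'_def X_def sg_def
      by (cases "even k'") (auto simp: abs_if split: if_splits)
    show ?thesis
    proof (cases "\<epsilon> \<le> y'")
      case ge: True
      have "swings X \<epsilon> (Suc k') (\<tau> (Suc i))"
        using ge \<tau> q(3) \<open>0 < \<epsilon>\<close> by (intro swing) (auto simp: y' max_def split: if_splits)
      then show ?thesis using step ge b \<tau> by (auto simp del: swings.simps)
    next
      case False
      show ?thesis
      proof (cases "y' = 0")
        case True
        have "p \<le> \<tau> (Suc i)" using q \<tau> by linarith
        then show ?thesis using step False b True q(1) by auto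
      next
        case nz: False
        hence "y' = (-1) ^ k' * (X (\<tau> (Suc i)) - X q)" using y' by (simp add: max_def split: if_splits)
        moreover have "q \<le> \<tau> (Suc i)" using q \<tau> by linarith
        ultimately show ?thesis using step False b q(1,2) by auto
      qed
    qed
  next
    case False
    then have odd: "odd k'" and cross: "\<not> (b0 < 0 \<longleftrightarrow> b0 + z i < 0)" by auto
    have big: "\<epsilon> \<le> \<bar>b0\<bar> + y0" using inv odd by (simp add: chain_inv_def st)
    have "\<epsilon> \<le> y'" using big cross odd by (auto simp: y'_def sg_def abs_if split: if_splits)
    have c: "continuous_on {\<tau> i..\<tau> (Suc i)} \<beta>"
      using \<tau> by (intro continuous_on_subset[OF cont]) auto
    have "\<exists>u\<ge>\<tau> i. u \<le> \<tau> (Suc i) \<and> \<beta> u = 0"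
    proof (cases "b0 < 0")
      case True
      then show ?thesis using cross b b0 c \<tau> by (intro IVT') auto
    next
      case False
      then show ?thesis using cross b b0 c \<tau> by (intro IVT2') auto
    qed
    then obtain u where u: "\<tau> i \<le> u" "u \<le> \<tau> (Suc i)" "\<beta> u = 0" by blast
    \<comment> \<open>With \<open>X u = 0\<close> the drop from \<open>q\<close> is
      \<open>X q = \<bar>b0\<bar> + y0\<close>.\<close>
    have "swings X \<epsilon> (Suc k') u"
      using big odd q(3,4) u b0 by (intro swing) (auto simp: X_def)
    hence "swings X \<epsilon> (Suc k') (\<tau> (Suc i))" using u swings_mono by blast
    then show ?thesis using step \<open>\<epsilon> \<le> y'\<close> b \<tau> by (auto simp del: swings.simps)
  qed
qed

lemma chain_count_mono: "i \<le> j \<Longrightarrow> fst (chain \<epsilon> z i) \<le> fst (chain \<epsilon> z j)"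
proof (induction j)
  case 0
  then show ?case by simp
next
  case (Suc j)
  have "fst (chain \<epsilon> z j) \<le> fst (chain \<epsilon> z (Suc j))"
    by (cases "chain \<epsilon> z j") (simp add: chain_step_def Let_def)
  with Suc show ?case by (cases "i = Suc j") auto
qed

lemma chain_count_le: "fst (chain \<epsilon> z n) \<le> n"
proof (induction n)
  case (Suc n)
  then show ?case by (cases "chain \<epsilon> z n") (simp add: chain_step_def Let_def)
qed simp

lemma chain_position: "snd (snd (snd (chain \<epsilon> z n))) = (\<Sum>i<n. z i)"
proof (induction n)
  case (Suc n)
  then show ?case by (cases "chain \<epsilon> z n") (simp add: chain_step_def Let_def)
qed simp

text \<open>The clamp, and for odd \<open>k\<close> the use of \<open>sg b * x\<close>, can only
  raise \<open>y\<close>. So the swing size dominates the displacement from every earlier grid point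
  of the same swing.\<close>

lemma chain_run:
  assumes "i \<le> j" "fst (chain \<epsilon> z i) = k" "fst (chain \<epsilon> z j) = k" "0 < \<epsilon>"
  shows "(-1) ^ k * (\<bar>\<Sum>l<j. z l\<bar> - \<bar>\<Sum>l<i. z l\<bar>) \<le> fst (snd (chain \<epsilon> z j))"
  using assms(1,3)
proof (induction j rule: dec_induct)
  case base
  have "chain_inv \<epsilon> (Max (insert 0 ((\<lambda>j. \<bar>z j\<bar>) ` {..<i}))) (chain \<epsilon> z i)"
    using \<open>0 < \<epsilon>\<close> by (intro chain_inv_chain) auto
  then show ?case by (auto simp: chain_inv_def split: prod.splits)
next
  case (step j)
  have kj: "fst (chain \<epsilon> z j) = k"
    using chain_count_mono[OF step(1), of \<epsilon> z] chain_count_mono[of j "Suc j" \<epsilon> z] step.prems assms(2) by simp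
  obtain y v b where st: "chain \<epsilon> z j = (k, y, v, b)" using kj by (cases "chain \<epsilon> z j") auto
  have b: "b = (\<Sum>l<j. z l)" using chain_position[of \<epsilon> z j] by (simp add: st)
  define y' where "y' = max 0 (if even k then y + (\<bar>b + z j\<bar> - \<bar>b\<bar>) else y - sg b * z j)"
  have "fst (snd (chain \<epsilon> z (Suc j))) = y'"
    using step.prems by (auto simp: st chain_step_def y'_def Let_def split: if_splits)
  moreover have "y + (-1) ^ k * (\<bar>b + z j\<bar> - \<bar>b\<bar>) \<le> y'"
    by (cases "even k") (auto simp: y'_def sg_def abs_if)
  moreover have "(-1) ^ k * (\<bar>b\<bar> - \<bar>\<Sum>l<i. z l\<bar>) \<le> y"
    using step.IH[OF kj] by (simp add: st b)
  ultimately show ?case by (cases "even k") (auto simp: b)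
qed

text \<open>Moving both ends of a swing to the next grid points costs at most
  \<open>2 * \<delta>\<close>, which leaves \<open>\<epsilon>'\<close>. If no grid swing ended in
  between, \<open>chain_run\<close> would push the current swing size up to
  \<open>\<epsilon>'\<close>, against the invariant.\<close>

lemma swings_chain:
  fixes \<beta> :: "real \<Rightarrow> real" and n :: nat
  assumes "\<beta> 0 = 0" "0 < t" "0 < n" "0 < \<epsilon>'"
    and osc: "\<And>u v. 0 \<le> u \<Longrightarrow> u \<le> v \<Longrightarrow> v \<le> t \<Longrightarrow> v - u \<le> t / n \<Longrightarrow> \<bar>\<beta> v - \<beta> u\<bar> \<le> \<delta>"
    and "\<epsilon>' + 2 * \<delta> \<le> \<epsilon>"
  defines "\<tau> \<equiv> \<lambda>i. t * real i / real n"
  defines "z \<equiv> \<lambda>i. \<beta> (\<tau> (Suc i)) - \<beta> (\<tau> i)" and "X \<equiv> \<lambda>u. \<bar>\<beta> u\<bar>"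
  assumes "swings X \<epsilon> k u" "i \<le> n" "u \<le> \<tau> i"
  shows "k \<le> fst (chain \<epsilon>' z i)"
  using assms(10-12)
proof (induction k arbitrary: u i)
  case 0
  then show ?case by simp
next
  case (Suc k)
  then obtain p q r where *: "swings X \<epsilon> k p" "p \<le> q" "q \<le> r" "r \<le> u" "\<epsilon> \<le> (-1) ^ k * (X r - X q)"
    by auto
  have z: "(\<Sum>l<j. z l) = \<beta> (\<tau> j)" for j
    using sum_lessThan_telescope[of "\<lambda>i. \<beta> (\<tau> i)" j] by (simp add: z_def \<open>\<beta> 0 = 0\<close> \<tau>_def)
  have \<tau>_le: "x \<le> \<tau> j \<longleftrightarrow> x * n / t \<le> real j" for x :: real and j
    using assms(2,3) by (simp add: \<tau>_def field_simps)
  \<comment> \<open>For \<open>x \<ge> 0\<close>, the index of the first grid point at or after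
    \<open>x\<close>.\<close>
  define g where "g x = nat \<lceil>x * n / t\<rceil>" for x :: real
  have g_le: "g x \<le> j \<longleftrightarrow> x \<le> \<tau> j" for x j
    unfolding \<tau>_le g_def by (simp add: nat_le_iff ceiling_le_iff)
  have g_ge: "\<tau> (g x) \<le> x + t / n" "x \<le> \<tau> (g x)" if "0 \<le> x" for x
  proof -
    have "real (g x) = of_int \<lceil>x * n / t\<rceil>"
      using that assms(2,3) by (simp add: g_def)
    also have "\<dots> \<le> x * n / t + 1" by linarith
    finally have "t * real (g x) / n \<le> t * (x * n / t + 1) / n"
      using assms(2,3) by (intro divide_right_mono mult_left_mono) auto
    also have "\<dots> = x + t / n" using assms(2,3) by (simp add: field_simps)
    finally show "\<tau> (g x) \<le> x + t / n" by (simp add: \<tau>_def)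
    show "x \<le> \<tau> (g x)" using g_le[of x "g x"] by simp
  qed
  have q0: "0 \<le> q" "0 \<le> r" using swings_nonneg[OF *(1)] * by auto
  have gi: "g q \<le> g r" "g r \<le> i" using * Suc.prems g_le by (auto simp: g_le intro: order_trans[OF _ g_ge(2)[OF q0(2)]])
  have \<tau>t: "\<tau> j \<le> t" if "j \<le> n" for j using that assms(2,3) by (simp add: \<tau>_def field_simps)
  have near: "\<bar>X (\<tau> (g x)) - X x\<bar> \<le> \<delta>" if "0 \<le> x" "g x \<le> n" for x
    using osc[OF that(1) g_ge(2)[OF that(1)] \<tau>t[OF that(2)]] g_ge(1)[OF that(1)] unfolding X_def by linarith
  show ?case
  proof (rule ccontr)
    assume "\<not> Suc k \<le> fst (chain \<epsilon>' z i)"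
    moreover have "k \<le> fst (chain \<epsilon>' z (g q))"
      using * Suc.prems gi order_trans[OF _ g_ge(2)[OF q0(1)]] by (intro Suc.IH[OF *(1)]) auto
    moreover note chain_count_mono[OF gi(1), of \<epsilon>' z] chain_count_mono[OF gi(2), of \<epsilon>' z]
    ultimately have k: "fst (chain \<epsilon>' z (g q)) = k" "fst (chain \<epsilon>' z (g r)) = k" by auto
    have "(-1) ^ k * (X (\<tau> (g r)) - X (\<tau> (g q))) \<le> fst (snd (chain \<epsilon>' z (g r)))"
      using chain_run[OF gi(1) k assms(4)] by (simp add: z X_def)
    moreover have "chain_inv \<epsilon>' (Max (insert 0 ((\<lambda>j. \<bar>z j\<bar>) ` {..<g r}))) (chain \<epsilon>' z (g r))"
      using assms(4) by (intro chain_inv_chain) auto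
    hence "fst (snd (chain \<epsilon>' z (g r))) < \<epsilon>'" by (auto simp: chain_inv_def split: prod.splits)
    moreover have "\<epsilon> - 2 * \<delta> \<le> (-1) ^ k * (X (\<tau> (g r)) - X (\<tau> (g q)))"
      using near[OF q0(1)] near[OF q0(2)] gi Suc.prems *(5) by (cases "even k") auto
    ultimately show False using assms(6) by linarith
  qed
qed

section \<open>The times S and T in terms of swings\<close>

lemma T_time_ge: "S_time \<epsilon> X i \<le> T_time \<epsilon> X (Suc i)"
  by (auto intro!: INF_greatest)

lemma S_time_ge: "T_time \<epsilon> X (Suc i) \<le> S_time \<epsilon> X (Suc i)"
  unfolding S_time.simps(2) by (rule INF_greatest) simp

lemma S_time_nonneg: "0 \<le> S_time \<epsilon> X i"
proof (induction i)
  case (Suc i)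
  then show ?case using T_time_ge S_time_ge order_trans by meson
qed simp

lemma T_time_nonneg: "0 \<le> T_time \<epsilon> X (Suc i)"
  using S_time_nonneg T_time_ge order_trans by meson

text \<open>The pairs \<open>(q, r)\<close> with a drop of at least \<open>\<epsilon>\<close> up to
  time \<open>u0\<close> form a compact set, on which \<open>r\<close> attains its minimum.\<close>

lemma first_swing:
  fixes X :: "real \<Rightarrow> real"
  assumes cont: "continuous_on {\<sigma>..} X" and u: "\<sigma> \<le> q0" "q0 \<le> u0" "\<epsilon> \<le> X q0 - X u0"
  obtains q r where "\<sigma> \<le> q" "q \<le> r" "\<epsilon> \<le> X q - X r"
    "\<And>q' r'. \<sigma> \<le> q' \<Longrightarrow> q' \<le> r' \<Longrightarrow> \<epsilon> \<le> X q' - X r' \<Longrightarrow> r \<le> r'"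
proof -
  let ?R = "{\<sigma>..u0} \<times> {\<sigma>..u0}"
  let ?K = "{p \<in> ?R. fst p \<le> snd p} \<inter> {p \<in> ?R. \<epsilon> \<le> X (fst p) - X (snd p)}"
  have X: "continuous_on {\<sigma>..u0} X" by (rule continuous_on_subset[OF cont]) auto
  have "closed {p \<in> ?R. fst p \<le> snd p}"
    by (intro continuous_on_closed_Collect_le continuous_intros closed_Times)
  moreover have "closed {p \<in> ?R. \<epsilon> \<le> X (fst p) - X (snd p)}"
    by (intro continuous_on_closed_Collect_le continuous_intros closed_Times
          continuous_on_compose2[OF X]) auto
  ultimately have comp: "compact (?R \<inter> ?K)"
    by (intro compact_Int_closed closed_Int compact_Times) auto
  have "(q0, u0) \<in> ?R \<inter> ?K" using u by auto
  hence ne: "?R \<inter> ?K \<noteq> {}" by blast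
  have "continuous_on (?R \<inter> ?K) snd" by (intro continuous_intros)
  from continuous_attains_inf[OF comp ne this]
  obtain p where p: "p \<in> ?R \<inter> ?K" "\<forall>p'\<in>?R \<inter> ?K. snd p \<le> snd p'" by blast
  show ?thesis
  proof (rule that[of "fst p" "snd p"])
    fix q' r' assume *: "\<sigma> \<le> q'" "q' \<le> r'" "\<epsilon> \<le> X q' - X r'"
    show "snd p \<le> r'"
    proof (cases "r' \<le> u0")
      case True
      then have "(q', r') \<in> ?R \<inter> ?K" using * by auto
      then show ?thesis using p(2) by force
    next
      case False
      then show ?thesis using p(1) by auto
    qed
  qed (use p(1) in auto)
qed

text \<open>The set under the infimum is given by a strict inequality and need not contain its
  infimum. The earliest non-strict drop does exist, and it ends no later than any member of the set,
  hence no later than the infimum.\<close>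

lemma Sup_drawdown_swing:
  fixes X :: "real \<Rightarrow> real"
  assumes cont: "continuous_on {\<sigma>..} X"
    and fin: "(INF u \<in> {u. \<sigma> \<le> u \<and> \<epsilon> < (SUP r \<in> {\<sigma>..u}. X r) - X u}. ereal u) \<le> ereal v"
  shows "\<exists>q r. \<sigma> \<le> q \<and> q \<le> r \<and> r \<le> v \<and> \<epsilon> \<le> X q - X r"
proof -
  let ?A = "{u. \<sigma> \<le> u \<and> \<epsilon> < (SUP r \<in> {\<sigma>..u}. X r) - X u}"
  have bdd: "bdd_above (X ` {\<sigma>..u})" for u
    by (intro compact_imp_bounded[THEN bounded_imp_bdd_above] compact_continuous_image
        continuous_on_subset[OF cont]) auto
  have ex: "\<exists>q. \<sigma> \<le> q \<and> q \<le> u \<and> \<epsilon> \<le> X q - X u" if "u \<in> ?A" for u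
  proof -
    have "\<epsilon> + X u < (SUP r \<in> {\<sigma>..u}. X r)" using that by auto
    moreover have "{\<sigma>..u} \<noteq> {}" using that by auto
    ultimately obtain q where "q \<in> {\<sigma>..u}" "\<epsilon> + X u < X q"
      using less_cSUP_iff[OF _ bdd] by blast
    thus ?thesis by (intro exI[of _ q]) auto
  qed
  have "?A \<noteq> {}"
  proof
    assume "?A = {}"
    then have "(INF u \<in> ?A. ereal u) = \<infinity>" by (simp only:) (simp add: top_ereal_def)
    with fin show False by (simp only:) simp
  qed
  then obtain u0 where "u0 \<in> ?A" by blast
  then obtain q0 where "\<sigma> \<le> q0" "q0 \<le> u0" "\<epsilon> \<le> X q0 - X u0" using ex by blast
  from first_swing[OF cont this]
  obtain q r where qr: "\<sigma> \<le> q" "q \<le> r" "\<epsilon> \<le> X q - X r"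
    "\<And>q' r'. \<sigma> \<le> q' \<Longrightarrow> q' \<le> r' \<Longrightarrow> \<epsilon> \<le> X q' - X r' \<Longrightarrow> r \<le> r'" by metis
  have "ereal r \<le> (INF u \<in> ?A. ereal u)"
    using ex qr(4) by (intro INF_greatest) (metis ereal_less_eq(3))
  hence "r \<le> v" using fin order_trans by fastforce
  thus ?thesis using qr by blast
qed

lemma T_time_finite_swing:
  assumes cont: "continuous_on {0..} X" and S: "S_time \<epsilon> X i = ereal \<sigma>" and T: "T_time \<epsilon> X (Suc i) \<le> ereal v"
  shows "\<exists>q r. \<sigma> \<le> q \<and> q \<le> r \<and> r \<le> v \<and> \<epsilon> \<le> X q - X r"
proof (rule Sup_drawdown_swing)
  have "0 \<le> \<sigma>" using S_time_nonneg[of \<epsilon> X i] by (simp add: S)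
  show "continuous_on {\<sigma>..} X" using \<open>0 \<le> \<sigma>\<close> by (intro continuous_on_subset[OF cont]) auto
  have "{r. \<sigma> \<le> r \<and> r \<le> u} = {\<sigma>..u}" for u by auto
  then show "(INF u \<in> {u. \<sigma> \<le> u \<and> \<epsilon> < (SUP r \<in> {\<sigma>..u}. X r) - X u}. ereal u) \<le> ereal v"
    using T by (simp add: S)
qed

lemma S_time_finite_swing:
  assumes cont: "continuous_on {0..} X" and T: "T_time \<epsilon> X (Suc i) = ereal \<sigma>" and S: "S_time \<epsilon> X (Suc i) \<le> ereal v"
  shows "\<exists>q r. \<sigma> \<le> q \<and> q \<le> r \<and> r \<le> v \<and> \<epsilon> \<le> X r - X q"
proof -
  have "0 \<le> \<sigma>" using T_time_nonneg[of \<epsilon> X i] by (simp only: T) simp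
  have "\<exists>q r. \<sigma> \<le> q \<and> q \<le> r \<and> r \<le> v \<and> \<epsilon> \<le> (\<lambda>u. - X u) q - (\<lambda>u. - X u) r"
  proof (rule Sup_drawdown_swing)
    show "continuous_on {\<sigma>..} (\<lambda>u. - X u)"
      using \<open>0 \<le> \<sigma>\<close> by (intro continuous_on_minus continuous_on_subset[OF cont]) auto
    have *: "{r. \<sigma> \<le> r \<and> r \<le> u} = {\<sigma>..u}" for u by auto
    have "(INF r \<in> {\<sigma>..u}. X r) = - (SUP r \<in> {\<sigma>..u}. - X r)" for u
      by (simp add: Inf_real_def image_image)
    then show "(INF u \<in> {u. \<sigma> \<le> u \<and> \<epsilon> < (SUP r \<in> {\<sigma>..u}. - X r) - - X u}. ereal u) \<le> ereal v"
      using S by (simp add: T * add.commute del: T_time.simps)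
  qed
  then show ?thesis by (auto simp: algebra_simps)
qed

lemma swingsI:
  assumes "swings X \<epsilon> k p" "p \<le> q" "q \<le> r" "r \<le> u" "\<epsilon> \<le> (-1) ^ k * (X r - X q)"
  shows "swings X \<epsilon> (Suc k) u"
  unfolding swings.simps(2) using assms by blast

lemma S_time_finite:
  assumes "S_time \<epsilon> X (Suc i) \<le> ereal u"
  obtains \<sigma> \<tau> where "S_time \<epsilon> X i = ereal \<sigma>" "T_time \<epsilon> X (Suc i) = ereal \<tau>" "0 \<le> \<sigma>" "\<sigma> \<le> \<tau>"
proof -
  note 1 = S_time_nonneg[of \<epsilon> X i] T_time_ge[of \<epsilon> X i]
  have "T_time \<epsilon> X (Suc i) \<le> ereal u" using S_time_ge assms order_trans by blast
  then obtain \<tau> where \<tau>: "T_time \<epsilon> X (Suc i) = ereal \<tau>"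
    using order_trans[OF 1] by (cases "T_time \<epsilon> X (Suc i)") (auto simp del: T_time.simps)
  then obtain \<sigma> where "S_time \<epsilon> X i = ereal \<sigma>"
    using 1 by (cases "S_time \<epsilon> X i") (auto simp del: T_time.simps S_time.simps)
  with \<tau> 1 that show ?thesis by (auto simp del: T_time.simps S_time.simps)
qed

lemma S_time_swing_pair:
  assumes cont: "continuous_on {0..} X" and "S_time \<epsilon> X (Suc i) \<le> ereal u" "S_time \<epsilon> X i = ereal \<sigma>"
  obtains q r q' r' where "\<sigma> \<le> q" "q \<le> r" "r \<le> q'" "q' \<le> r'" "r' \<le> u" "\<epsilon> \<le> X q - X r" "\<epsilon> \<le> X r' - X q'"
proof -
  obtain \<tau> where \<tau>: "T_time \<epsilon> X (Suc i) = ereal \<tau>" "\<sigma> \<le> \<tau>"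
    using S_time_finite[OF assms(2)] assms(3) by (metis ereal.inject)
  have "T_time \<epsilon> X (Suc i) \<le> ereal \<tau>" unfolding \<tau>(1) by (rule order_refl)
  from T_time_finite_swing[OF cont assms(3) this]
  obtain q r where "\<sigma> \<le> q" "q \<le> r" "r \<le> \<tau>" "\<epsilon> \<le> X q - X r" by blast
  moreover obtain q' r' where "\<tau> \<le> q'" "q' \<le> r'" "r' \<le> u" "\<epsilon> \<le> X r' - X q'"
    using S_time_finite_swing[OF cont \<tau>(1) assms(2)] by blast
  ultimately show ?thesis using that[of q r q' r'] by linarith
qed

text \<open>Each pair of times \<open>T\<close>, \<open>S\<close> yields a swing down and a swing
  up. One more upward swing comes for free at the beginning: if \<open>q\<close> is the top of the
  first drop and \<open>r\<close> its bottom, then \<open>X r \<ge> 0\<close> gives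
  \<open>X q - X 0 \<ge> \<epsilon>\<close>.\<close>

lemma S_time_imp_swings:
  assumes cont: "continuous_on {0..} X" and "X 0 = 0" "\<And>u. 0 \<le> X u"
  shows "S_time \<epsilon> X (Suc i) \<le> ereal u \<Longrightarrow> swings X \<epsilon> (Suc (2 * Suc i)) u"
proof (induction i arbitrary: u)
  case 0
  have "S_time \<epsilon> X 0 = ereal 0" by simp
  from S_time_swing_pair[OF cont 0 this] obtain q r q' r' where
    *: "0 \<le> q" "q \<le> r" "r \<le> q'" "q' \<le> r'" "r' \<le> u" "\<epsilon> \<le> X q - X r" "\<epsilon> \<le> X r' - X q'" by metis
  have "swings X \<epsilon> (Suc 0) q"
    by (rule swingsI[of _ _ 0 0 0 q]) (use * assms(2) assms(3)[of r] in auto)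
  hence "swings X \<epsilon> (Suc (Suc 0)) r" by (rule swingsI[where q = q and r = r]) (use * in auto)
  hence "swings X \<epsilon> (Suc (Suc (Suc 0))) u" by (rule swingsI[where q = q' and r = r']) (use * in auto)
  then show ?case by (simp only: mult_2 add_Suc add_0 add_Suc_right)
next
  case (Suc i)
  obtain \<sigma> where \<sigma>: "S_time \<epsilon> X (Suc i) = ereal \<sigma>" using S_time_finite[OF Suc.prems] by metis
  from S_time_swing_pair[OF cont Suc.prems this] obtain q r q' r' where
    *: "\<sigma> \<le> q" "q \<le> r" "r \<le> q'" "q' \<le> r'" "r' \<le> u" "\<epsilon> \<le> X q - X r" "\<epsilon> \<le> X r' - X q'" by metis
  have "S_time \<epsilon> X (Suc i) \<le> ereal \<sigma>" unfolding \<sigma> by (rule order_refl)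
  hence "swings X \<epsilon> (Suc (2 * Suc i)) \<sigma>" by (rule Suc.IH)
  hence "swings X \<epsilon> (Suc (Suc (2 * Suc i))) r" by (rule swingsI[where q = q and r = r]) (use * in auto)
  hence "swings X \<epsilon> (Suc (Suc (Suc (2 * Suc i)))) u" by (rule swingsI[where q = q' and r = r']) (use * in auto)
  then show ?case by (simp only: mult_2 add_Suc add_0 add_Suc_right)
qed

text \<open>The gap \<open>\<epsilon> < \<epsilon>'\<close> turns non-strict swings into the strict
  inequalities that define the times. The first upward swing corresponds to no positive index,
  whence \<open>Suc (2 * i)\<close> swings for index \<open>i\<close>.\<close>

lemma swings_imp_times:
  assumes cont: "continuous_on {0..} X" and "\<epsilon> < \<epsilon>'"
  shows "swings X \<epsilon>' (Suc (2 * i)) u \<Longrightarrow> S_time \<epsilon> X i \<le> ereal u"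
    and "swings X \<epsilon>' (Suc (Suc (2 * i))) u \<Longrightarrow> T_time \<epsilon> X (Suc i) \<le> ereal u"
proof -
  have bdd: "bdd_above (X ` {r. s \<le> ereal r \<and> r \<le> u})" "bdd_below (X ` {r. s \<le> ereal r \<and> r \<le> u})"
    if "0 \<le> s" for s u
  proof -
    have b: "bounded (X ` {0..u})"
      by (intro compact_imp_bounded compact_continuous_image continuous_on_subset[OF cont]) auto
    have "X ` {r. s \<le> ereal r \<and> r \<le> u} \<subseteq> X ` {0..u}"
      using that by (intro image_mono) (auto intro: order_trans simp flip: ereal_less_eq(5))
    from bounded_subset[OF b this]
    show "bdd_above (X ` {r. s \<le> ereal r \<and> r \<le> u})" "bdd_below (X ` {r. s \<le> ereal r \<and> r \<le> u})"
      by (auto intro: bounded_imp_bdd_above bounded_imp_bdd_below)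
  qed
  have T: "T_time \<epsilon> X (Suc i) \<le> ereal u"
    if S: "\<And>p. swings X \<epsilon>' (Suc (2 * i)) p \<Longrightarrow> S_time \<epsilon> X i \<le> ereal p" and sw: "swings X \<epsilon>' (Suc (Suc (2 * i))) u" for i u
  proof -
    obtain p q r where *: "swings X \<epsilon>' (Suc (2 * i)) p" "p \<le> q" "q \<le> r" "r \<le> u"
      "\<epsilon>' \<le> (-1) ^ Suc (2 * i) * (X r - X q)"
      using sw unfolding swings.simps(2)[of X \<epsilon>' "Suc (2 * i)"] by blast
    hence d: "\<epsilon>' \<le> X q - X r" by simp
    have Sq: "S_time \<epsilon> X i \<le> ereal q" using S[OF *(1)] *(2) by (meson ereal_less_eq(3) order_trans)
    have Sr: "S_time \<epsilon> X i \<le> ereal r" using Sq *(3) by (meson ereal_less_eq(3) order_trans)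
    have "X q \<le> (SUP r' \<in> {r'. S_time \<epsilon> X i \<le> ereal r' \<and> r' \<le> r}. X r')"
      using Sq *(3) by (intro cSUP_upper bdd S_time_nonneg) auto
    hence "T_time \<epsilon> X (Suc i) \<le> ereal r"
      unfolding T_time.simps(2) using Sr d assms(2) by (intro INF_lower) auto
    also have "\<dots> \<le> ereal u" using * by simp
    finally show ?thesis .
  qed
  have S: "swings X \<epsilon>' (Suc (2 * i)) u \<Longrightarrow> S_time \<epsilon> X i \<le> ereal u" for i u
  proof (induction i arbitrary: u)
    case 0
    then show ?case using swings_nonneg[OF 0] by simp
  next
    case (Suc i)
    then have "swings X \<epsilon>' (Suc (Suc (Suc (2 * i)))) u" by (simp only: mult_2 add_Suc add_0 add_Suc_right)
    then obtain p q r where *: "swings X \<epsilon>' (Suc (Suc (2 * i))) p" "p \<le> q" "q \<le> r" "r \<le> u"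
      "\<epsilon>' \<le> (-1) ^ Suc (Suc (2 * i)) * (X r - X q)"
      unfolding swings.simps(2)[of X \<epsilon>' "Suc (Suc (2 * i))"] by blast
    hence d: "\<epsilon>' \<le> X r - X q" by simp
    have Tq: "T_time \<epsilon> X (Suc i) \<le> ereal q"
      using T[OF Suc.IH *(1)] *(2) by (meson ereal_less_eq(3) order_trans)
    have Tr: "T_time \<epsilon> X (Suc i) \<le> ereal r" using Tq *(3) by (meson ereal_less_eq(3) order_trans)
    have "(INF r' \<in> {r'. T_time \<epsilon> X (Suc i) \<le> ereal r' \<and> r' \<le> r}. X r') \<le> X q"
      using Tq *(3) by (intro cINF_lower bdd T_time_nonneg) (auto simp del: T_time.simps)
    hence "S_time \<epsilon> X (Suc i) \<le> ereal r"
      unfolding S_time.simps(2) using Tr d assms(2) by (intro INF_lower) (auto simp del: T_time.simps)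
    also have "\<dots> \<le> ereal u" using * by simp
    finally show ?case .
  qed
  show "swings X \<epsilon>' (Suc (2 * i)) u \<Longrightarrow> S_time \<epsilon> X i \<le> ereal u" by (rule S)
  show "swings X \<epsilon>' (Suc (Suc (2 * i))) u \<Longrightarrow> T_time \<epsilon> X (Suc i) \<le> ereal u" by (rule T[OF S])
qed

text \<open>The infimum of \<open>X\<close> on \<open>[0,t]\<close> is 0, so the first upward swing
  accounts for the indicator in \<open>bar_count\<close>. Each further swing down followed by a
  swing up accounts for one more index of \<open>S_time\<close>.\<close>

lemma bar_count_bounds:
  assumes cont: "continuous_on {0..} X" and X: "X 0 = 0" "\<And>u. 0 \<le> X u" and "0 < \<epsilon>" "0 \<le> t"
    and K: "\<And>k. swings X \<epsilon> k t \<Longrightarrow> k \<le> K"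
  shows "bar_count \<epsilon> X t \<le> (K + 1) div 2"
    and "\<epsilon> < \<epsilon>' \<Longrightarrow> swings X \<epsilon>' n t \<Longrightarrow> (n + 1) div 2 \<le> bar_count \<epsilon> X t"
proof -
  let ?A = "{k. S_time \<epsilon> X k \<le> ereal t}"
  have c: "continuous_on {0..t} X" by (rule continuous_on_subset[OF cont]) auto
  have bd: "bdd_above (X ` {0..t})" "bdd_below (X ` {0..t})"
    using compact_imp_bounded[OF compact_continuous_image[OF c compact_Icc]]
    by (auto intro: bounded_imp_bdd_above bounded_imp_bdd_below)
  have A: "Suc (2 * i) \<le> K" if "i \<in> ?A" "i \<noteq> 0" for i
    using S_time_imp_swings[OF cont X, of \<epsilon> "i - 1" t] that K by (cases i) (auto simp del: S_time.simps)
  have "?A \<subseteq> {..K}" using A by force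
  hence fin: "finite ?A" by (rule finite_subset) simp
  have "0 \<in> ?A" using \<open>0 \<le> t\<close> by simp
  hence Max: "Max ?A \<in> ?A" using fin by (intro Max_in) blast+
  have inf: "(INF r\<in>{0..t}. X r) = 0"
  proof (rule antisym)
    show "(INF r\<in>{0..t}. X r) \<le> 0" using cINF_lower[OF bd(2), of 0] X(1) \<open>0 \<le> t\<close> by simp
    show "0 \<le> (INF r\<in>{0..t}. X r)" using X(2) \<open>0 \<le> t\<close> by (intro cINF_greatest) auto
  qed
  show "bar_count \<epsilon> X t \<le> (K + 1) div 2"
  proof (cases "Max ?A = 0")
    case True
    show ?thesis
    proof (cases "\<epsilon> \<le> path_range X t")
      case True
      obtain u where u: "u \<in> {0..t}" "\<And>v. v \<in> {0..t} \<Longrightarrow> X v \<le> X u"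
        using continuous_attains_sup[OF compact_Icc _ c] \<open>0 \<le> t\<close> by auto
      have "(SUP r\<in>{0..t}. X r) \<le> X u" using u \<open>0 \<le> t\<close> by (intro cSUP_least) auto
      hence "\<epsilon> \<le> X u" using True by (simp add: path_range_def inf)
      hence "swings X \<epsilon> (Suc 0) t"
        using u X(1) by (intro swingsI[of _ _ 0 0 0 u]) auto
      then have "1 \<le> (K + 1) div 2" using K[of "Suc 0"] by simp
      moreover have "bar_count \<epsilon> X t \<le> 1" using \<open>Max ?A = 0\<close> by (simp add: bar_count_def)
      ultimately show ?thesis by (rule order_trans[rotated])
    qed (use True in \<open>simp add: bar_count_def\<close>)
  next
    case False
    then have "Suc (2 * Max ?A) \<le> K" using A Max by blast
    then have "Suc (Max ?A) \<le> (K + 1) div 2" by linarith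
    moreover have "bar_count \<epsilon> X t \<le> Suc (Max ?A)" by (simp add: bar_count_def)
    ultimately show ?thesis by linarith
  qed
  assume "\<epsilon> < \<epsilon>'" and sw: "swings X \<epsilon>' n t"
  show "(n + 1) div 2 \<le> bar_count \<epsilon> X t"
  proof (cases n)
    case (Suc m)
    have "swings X \<epsilon>' (Suc 0) t" using swings_le[OF sw, of "Suc 0"] Suc by simp
    then obtain p q r where "0 \<le> p" "p \<le> q" and qr: "q \<le> r" "r \<le> t" "\<epsilon>' \<le> X r - X q" by auto
    hence "0 \<le> q" by linarith
    have "X r \<le> (SUP r\<in>{0..t}. X r)" using qr \<open>0 \<le> q\<close> by (intro cSUP_upper bd) auto
    hence "\<epsilon> \<le> path_range X t"
      using qr X(2)[of q] \<open>\<epsilon> < \<epsilon>'\<close> by (simp add: path_range_def inf)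
    moreover have "swings X \<epsilon>' (Suc (2 * (m div 2))) t" using swings_le[OF sw, of "Suc (2 * (m div 2))"] Suc by simp
    hence "m div 2 \<in> ?A" using swings_imp_times(1)[OF cont \<open>\<epsilon> < \<epsilon>'\<close>] by simp
    hence "m div 2 \<le> Max ?A" using fin by simp
    ultimately show ?thesis using Suc by (simp add: bar_count_def)
  qed simp
qed

subsection \<open>The limit of fine grids\<close>

lemma chain_measurable:
  assumes "i \<le> n"
  shows "(\<lambda>z. chain \<epsilon> z i) \<in> PiM {..<n} (\<lambda>_. borel) \<rightarrow>\<^sub>M count_space UNIV \<Otimes>\<^sub>M borel \<Otimes>\<^sub>M borel \<Otimes>\<^sub>M borel"
  using assms
proof (induction i)
  case 0
  then show ?case by simp
next
  case (Suc i)
  let ?N = "count_space (UNIV :: nat set) \<Otimes>\<^sub>M borel \<Otimes>\<^sub>M borel \<Otimes>\<^sub>M (borel :: real measure)"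
  have [measurable]: "sg \<in> borel_measurable borel" unfolding sg_def by measurable
  have [measurable]: "(\<lambda>z. z i) \<in> borel_measurable (PiM {..<n} (\<lambda>_. borel))"
    using Suc.prems by (intro measurable_component_singleton) auto
  have [measurable]: "(\<lambda>z. chain \<epsilon> z i) \<in> PiM {..<n} (\<lambda>_. borel) \<rightarrow>\<^sub>M ?N"
    using Suc by simp
  have [measurable]: "(\<lambda>k::nat. (-1::real) ^ k) \<in> borel_measurable (count_space UNIV)" by simp
  have eq: "chain_step \<epsilon> x st = (let k = fst st; y = fst (snd st); v = fst (snd (snd st)); b = snd (snd (snd st));
     y' = max 0 (if even k then y + (\<bar>b + x\<bar> - \<bar>b\<bar>) else y - sg b * x)
     in if \<epsilon> \<le> y' then (Suc k, 0, 0, b + x) else (k, y', v + sg v * ((-1) ^ k * sg b * x), b + x))" for x st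
    by (cases st) (simp add: chain_step_def Let_def)
  show ?case unfolding chain.simps eq Let_def by measurable
qed

lemma chain_restrict: "i \<le> n \<Longrightarrow> chain \<epsilon> (restrict z {..<n}) i = chain \<epsilon> z i"
  by (induction i) auto

lemma flip_measurable: "flip \<epsilon> s i \<in> borel_measurable (PiM {..<i} (\<lambda>_. borel))"
proof -
  have [measurable]: "(\<lambda>z. chain \<epsilon> z i) \<in> PiM {..<i} (\<lambda>_. borel) \<rightarrow>\<^sub>M
      count_space UNIV \<Otimes>\<^sub>M borel \<Otimes>\<^sub>M borel \<Otimes>\<^sub>M borel"
    by (rule chain_measurable) simp
  have [measurable]: "sg \<in> borel_measurable borel" unfolding sg_def by measurable
  have [measurable]: "(\<lambda>k::nat. s k * (-1::real) ^ k) \<in> borel_measurable (count_space UNIV)" by simp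
  have "flip \<epsilon> s i = (\<lambda>z. let st = chain \<epsilon> z i in
      (s (fst st) * (-1) ^ fst st) * (sg (fst (snd (snd st))) * sg (snd (snd (snd st)))))"
    by (auto simp: flip_def fun_eq_iff Let_def split: prod.splits)
  also have "\<dots> \<in> borel_measurable (PiM {..<i} (\<lambda>_. borel))"
    unfolding Let_def by measurable
  finally show ?thesis .
qed

lemma flip_sign:
  assumes "\<And>j. s j = 1 \<or> s j = -1"
  shows "flip \<epsilon> s i z = 1 \<or> flip \<epsilon> s i z = -1"
proof -
  obtain k y v b where st: "chain \<epsilon> z i = (k, y, v, b)" by (cases "chain \<epsilon> z i") auto
  show ?thesis
    using assms[of k] by (cases "even k") (auto simp: flip_def st sg_def)
qed

context standard_brownian_motion
begin

definition grid_step :: "real \<Rightarrow> nat \<Rightarrow> nat \<Rightarrow> 'a \<Rightarrow> real" where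
  "grid_step t n i \<omega> = B (t * real (Suc i) / real n) \<omega> - B (t * real i / real n) \<omega>"

lemma walk_distribution:
  assumes "0 < t" "0 < n" and s: "\<And>j. s j = 1 \<or> s j = -1"
  shows "(\<lambda>\<omega>. walk \<epsilon> s n (\<lambda>i. grid_step t n i \<omega>)) \<in> borel_measurable M"
    and "distr M borel (\<lambda>\<omega>. walk \<epsilon> s n (\<lambda>i. grid_step t n i \<omega>)) = density lborel (normal_density 0 (sqrt t))"
proof -
  let ?\<tau> = "\<lambda>i. t * real i / real n"
  have "indep_vars (\<lambda>_. borel) (\<lambda>i \<omega>. B (?\<tau> (Suc i)) \<omega> - B (?\<tau> i) \<omega>) {..<n}"
    using assms by (intro indep_increments) (auto simp: divide_right_mono)
  hence ind: "indep_vars (\<lambda>_. borel) (grid_step t n) {..<n}"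
    by (simp add: grid_step_def[abs_def])
  have normal: "distributed M lborel (grid_step t n i) (normal_density 0 (sqrt (t / n)))" for i
  proof -
    have "?\<tau> (Suc i) - ?\<tau> i = t / n" using assms by (simp add: field_simps)
    moreover have "distributed M lborel (\<lambda>\<omega>. B (?\<tau> (Suc i)) \<omega> - B (?\<tau> i) \<omega>)
        (normal_density 0 (sqrt (?\<tau> (Suc i) - ?\<tau> i)))"
      using assms by (intro gaussian_increments) (auto simp: divide_strict_right_mono)
    ultimately show ?thesis by (simp add: grid_step_def[abs_def])
  qed
  have restr: "flip \<epsilon> s i (restrict z {..<i}) = flip \<epsilon> s i z" for i z
    by (simp add: flip_def chain_restrict)
  note * = predictable_sign_walk[OF ind normal _ \<open>0 < n\<close> flip_measurable restr flip_sign[OF s]]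
  show "(\<lambda>\<omega>. walk \<epsilon> s n (\<lambda>i. grid_step t n i \<omega>)) \<in> borel_measurable M"
    unfolding walk_def using assms by (intro *) simp
  have "sqrt n * sqrt (t / n) = sqrt t" using assms by (simp flip: real_sqrt_mult)
  thus "distr M borel (\<lambda>\<omega>. walk \<epsilon> s n (\<lambda>i. grid_step t n i \<omega>)) = density lborel (normal_density 0 (sqrt t))"
    unfolding walk_def using assms *(2) by simp
qed

lemma has_bochner_integral_walk:
  assumes "0 < t" "0 < n" and s: "\<And>j. s j = 1 \<or> s j = -1"
    and f: "integrable (density lborel (normal_density 0 (sqrt t))) (f :: real \<Rightarrow> real)"
  shows "has_bochner_integral M (\<lambda>\<omega>. f (walk \<epsilon> s n (\<lambda>i. grid_step t n i \<omega>)))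
    (\<integral>x. f x \<partial>density lborel (normal_density 0 (sqrt t)))"
proof -
  note * = walk_distribution[OF assms(1,2) s, of \<epsilon>]
  have m: "f \<in> borel_measurable borel" using borel_measurable_integrable[OF f] by simp
  show ?thesis
    unfolding has_bochner_integral_iff
    using f integrable_distr_eq[OF *(1) m] integral_distr[OF *(1) m] by (simp add: *(2))
qed

end

text \<open>At the lower threshold \<open>\<epsilon>1\<close> the grid detects every swing of size
  \<open>\<epsilon>\<close>; at the higher threshold \<open>\<epsilon>2\<close> every grid swing
  exceeds \<open>\<epsilon>\<close> strictly, as the times require. The mesh needed depends on the
  modulus of continuity of the path. In \<open>n\<close> steps at most \<open>n\<close> swings are
  completed, so \<open>Suc n\<close> signs include one for an unfinished swing.\<close>

lemma grid_bar_count_bounds: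
  fixes \<beta> :: "real \<Rightarrow> real"
  assumes cont: "continuous_on {0..} \<beta>" and "\<beta> 0 = 0" and "0 < t" "0 < \<epsilon>1" "\<epsilon>1 < \<epsilon>" "\<epsilon> < \<epsilon>2" "0 < \<eta>"
  defines "z \<equiv> \<lambda>n i. \<beta> (t * real (Suc i) / real n) - \<beta> (t * real i / real n)"
  shows "\<forall>\<^sub>F n in sequentially.
      sign_avg (Suc n) (\<lambda>s. cell \<epsilon>2 (- \<eta>) (walk \<epsilon>2 s n (z n))) \<le> real (bar_count \<epsilon> (\<lambda>u. \<bar>\<beta> u\<bar>) t) \<and>
      real (bar_count \<epsilon> (\<lambda>u. \<bar>\<beta> u\<bar>) t) \<le> sign_avg (Suc n) (\<lambda>s. cell \<epsilon>1 \<eta> (walk \<epsilon>1 s n (z n)))"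
proof -
  let ?X = "\<lambda>u. \<bar>\<beta> u\<bar>"
  have contX: "continuous_on {0..} ?X" by (intro continuous_intros cont)
  have "uniformly_continuous_on {0..t} \<beta>"
    by (intro compact_uniformly_continuous continuous_on_subset[OF cont]) auto
  hence uc: "\<exists>\<rho>>0. \<forall>u v. 0 \<le> u \<longrightarrow> u \<le> v \<longrightarrow> v \<le> t \<longrightarrow> v - u < \<rho> \<longrightarrow> \<bar>\<beta> v - \<beta> u\<bar> < e" if "0 < e" for e
    using that unfolding uniformly_continuous_on_def dist_real_def
    by (metis (no_types, lifting) abs_of_nonneg atLeastAtMost_iff diff_ge_0_iff_ge order_trans)
  obtain \<rho>1 where \<rho>1: "0 < \<rho>1" "\<And>u v. 0 \<le> u \<Longrightarrow> u \<le> v \<Longrightarrow> v \<le> t \<Longrightarrow> v - u < \<rho>1 \<Longrightarrow> \<bar>\<beta> v - \<beta> u\<bar> < \<epsilon>1"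
    using uc[OF \<open>0 < \<epsilon>1\<close>] by blast
  \<comment> \<open>A bound on the number of swings for all thresholds from
    \<open>\<epsilon>1\<close> on; being independent of the grid, it allows \<open>\<delta>\<close>
    to be chosen before the mesh.\<close>
  define K where "K = nat \<lfloor>t / \<rho>1\<rfloor>"
  have K: "k \<le> K" if "swings ?X e k t" "\<epsilon>1 \<le> e" for e k
  proof -
    have "real k * \<rho>1 \<le> t"
    proof (rule swings_bound[OF _ that(1)])
      fix u v assume "0 \<le> u" "u \<le> v" "v \<le> t" "v - u < \<rho>1"
      from \<rho>1(2)[OF this] that(2) show "\<bar>\<bar>\<beta> v\<bar> - \<bar>\<beta> u\<bar>\<bar> < e" by linarith
    qed simp
    hence "real k \<le> t / \<rho>1" using \<rho>1(1) by (simp add: field_simps)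
    thus ?thesis unfolding K_def by linarith
  qed
  \<comment> \<open>The first entry pays for moving both ends of a swing to the grid; the second
    gives \<open>(2 * K + 1) * \<delta> \<le> \<eta> / 2\<close>.\<close>
  define \<delta> where "\<delta> = min ((\<epsilon> - \<epsilon>1) / 2) (\<eta> / (2 * (2 * real K + 1)))"
  have \<delta>: "0 < \<delta>" "\<epsilon>1 + 2 * \<delta> \<le> \<epsilon>"
    using assms by (auto simp: \<delta>_def min_def field_simps)
  have small: "(2 * real k + 1) * \<delta> < \<eta>" if "k \<le> K" for k
  proof -
    have "(2 * real k + 1) * \<delta> \<le> (2 * real K + 1) * (\<eta> / (2 * (2 * real K + 1)))"
      using that assms by (intro mult_mono) (auto simp: \<delta>_def)
    also have "\<dots> = \<eta> / 2" by (simp add: field_simps)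
    finally show ?thesis using \<open>0 < \<eta>\<close> by linarith
  qed
  obtain \<rho> where \<rho>: "0 < \<rho>" "\<And>u v. 0 \<le> u \<Longrightarrow> u \<le> v \<Longrightarrow> v \<le> t \<Longrightarrow> v - u < \<rho> \<Longrightarrow> \<bar>\<beta> v - \<beta> u\<bar> < \<delta>"
    using uc[OF \<open>0 < \<delta>\<close>] by blast
  have "((\<lambda>n. t / real n) \<longlongrightarrow> 0) sequentially" by (rule lim_const_over_n)
  hence "\<forall>\<^sub>F n in sequentially. t / real n < \<rho>" using \<rho>(1) by (rule order_tendstoD(2))
  moreover have "\<forall>\<^sub>F n in sequentially. 0 < n" by (rule eventually_gt_at_top)
  ultimately show ?thesis
  proof eventually_elim
    case (elim n)
    let ?\<tau> = "\<lambda>i. t * real i / real n"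
    have \<tau>n: "?\<tau> n = t" using elim by simp
    have z: "\<bar>z n i\<bar> \<le> \<delta>" if "i < n" for i
    proof -
      have "?\<tau> (Suc i) \<le> t * real n / real n"
        using that \<open>0 < t\<close> by (intro divide_right_mono mult_left_mono) auto
      moreover have "?\<tau> (Suc i) - ?\<tau> i = t / real n" using elim by (simp add: field_simps)
      moreover have "?\<tau> i \<le> ?\<tau> (Suc i)" using \<open>0 < t\<close> by (intro divide_right_mono mult_left_mono) auto
      ultimately have "\<bar>\<beta> (?\<tau> (Suc i)) - \<beta> (?\<tau> i)\<bar> < \<delta>"
        using elim \<open>0 < t\<close> by (intro \<rho>) auto
      thus ?thesis by (simp add: z_def)
    qed
    have sw: "swings ?X e (fst (chain e (z n) n)) t" if e: "0 < e" for e
    proof -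
      obtain k y v b where st: "chain e (\<lambda>i. \<beta> (?\<tau> (Suc i)) - \<beta> (?\<tau> i)) n = (k, y, v, b)"
        by (cases "chain e (\<lambda>i. \<beta> (?\<tau> (Suc i)) - \<beta> (?\<tau> i)) n") auto
      have "mono ?\<tau>" using \<open>0 < t\<close> by (intro monoI divide_right_mono mult_left_mono) auto
      from chain_swings[OF cont \<open>\<beta> 0 = 0\<close> _ this e st]
      have "\<exists>p q. swings ?X e k p \<and> p \<le> q \<and> q \<le> t" using \<tau>n by auto
      hence "swings ?X e k t" using swings_mono order_trans by blast
      thus ?thesis using st by (simp add: z_def)
    qed
    let ?k1 = "fst (chain \<epsilon>1 (z n) n)" and ?k2 = "fst (chain \<epsilon>2 (z n) n)"
    have k: "?k1 \<le> K" "?k2 \<le> K" using K[OF sw[of \<epsilon>1]] K[OF sw[of \<epsilon>2]] assms(4-6) by auto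
    have up: "k \<le> ?k1" if "swings ?X \<epsilon> k t" for k
      unfolding z_def
    proof (rule swings_chain[OF \<open>\<beta> 0 = 0\<close> \<open>0 < t\<close> _ \<open>0 < \<epsilon>1\<close> _ \<delta>(2) that])
      fix u v assume "0 \<le> u" "u \<le> v" "v \<le> t" "v - u \<le> t / real n"
      thus "\<bar>\<beta> v - \<beta> u\<bar> \<le> \<delta>" using \<rho>(2)[of u v] elim by auto
    qed (use elim \<tau>n in auto)
    note bc = bar_count_bounds[OF contX, of \<epsilon> t]
    have "bar_count \<epsilon> ?X t \<le> (?k1 + 1) div 2"
      using assms(2,3,4,5) up by (intro bc(1)) auto
    moreover have "real ((?k1 + 1) div 2) \<le> sign_avg (Suc n) (\<lambda>s. cell \<epsilon>1 \<eta> (walk \<epsilon>1 s n (z n)))"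
      using sign_avg_cell_chain(1)[of n "z n" \<delta> \<epsilon>1 ?k1 "Suc n" \<eta>] z assms(4) \<delta>(1) small[OF k(1)]
        chain_count_le[of \<epsilon>1 "z n" n] by simp
    moreover have "(?k2 + 1) div 2 \<le> bar_count \<epsilon> ?X t"
      using assms(2,3,4,5,6) up sw[of \<epsilon>2] by (intro bc(2)) auto
    moreover have "sign_avg (Suc n) (\<lambda>s. cell \<epsilon>2 (- \<eta>) (walk \<epsilon>2 s n (z n))) \<le> real ((?k2 + 1) div 2)"
      using sign_avg_cell_chain(2)[of n "z n" \<delta> \<epsilon>2 ?k2 "Suc n" \<eta>] z assms(4,5,6) \<delta>(1) small[OF k(2)]
        chain_count_le[of \<epsilon>2 "z n" n] by simp
    ultimately show ?case by (meson of_nat_le_iff order_trans)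
  qed
qed

section \<open>Gaussian integrals of \<open>cell\<close> under perturbation of its
  parameters\<close>

abbreviation gauss :: "real \<Rightarrow> real measure" where
  "gauss t \<equiv> density lborel (normal_density 0 (sqrt t))"

lemma prob_space_gauss: "0 < t \<Longrightarrow> prob_space (gauss t)"
  by (intro prob_space_normal_density) simp

lemma integrable_gauss_square:
  assumes "0 < t"
  shows "integrable (gauss t) (\<lambda>x. x\<^sup>2)"
proof -
  have "0 < sqrt t" using assms by simp
  then have "integrable lborel (\<lambda>x. normal_density 0 (sqrt t) x * (x - 0) ^ (2 * 1))"
    using normal_moment_even unfolding has_bochner_integral_iff by blast
  then show ?thesis by (subst integrable_density) auto
qed

lemma cell_measurable [measurable]: "cell \<epsilon> \<eta> \<in> borel_measurable borel"
  unfolding cell_def by measurable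

text \<open>A common integrable majorant for all thresholds within a factor 2 of
  \<open>\<epsilon>\<close> and all shifts up to 1, for use in dominated convergence.\<close>

lemma cell_le_square:
  assumes "0 < \<epsilon>" "\<epsilon> \<le> 2 * \<epsilon>'" "\<epsilon>' \<le> 2 * \<epsilon>" "\<bar>\<eta>\<bar> \<le> 1"
  shows "cell \<epsilon>' \<eta> x \<le> 4 * x\<^sup>2 / \<epsilon>\<^sup>2 + 4 * (1 + 2 * \<epsilon>)\<^sup>2 / \<epsilon>\<^sup>2"
proof -
  let ?y = "(max 0 (\<bar>x\<bar> + \<eta>) + \<epsilon>') / (2 * \<epsilon>')" and ?c = "1 + 2 * \<epsilon>"
  have e: "0 < \<epsilon>'" using assms by linarith
  have "0 \<le> ?y" using e by simp
  hence "cell \<epsilon>' \<eta> x \<le> 2 * ?y\<^sup>2"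
    unfolding cell_def by (intro mult_left_mono power_mono) auto
  also have "?y \<le> (\<bar>x\<bar> + ?c) / \<epsilon>"
    using assms e by (intro frac_le) auto
  hence "2 * ?y\<^sup>2 \<le> 2 * ((\<bar>x\<bar> + ?c) / \<epsilon>)\<^sup>2"
    using \<open>0 \<le> ?y\<close> by (intro mult_left_mono power_mono) auto
  also have "\<dots> = 2 * (\<bar>x\<bar> + ?c)\<^sup>2 / \<epsilon>\<^sup>2" by (simp add: power_divide)
  also have "\<dots> \<le> (4 * x\<^sup>2 + 4 * ?c\<^sup>2) / \<epsilon>\<^sup>2"
  proof (rule divide_right_mono)
    have "2 * (a + b)\<^sup>2 \<le> 4 * a\<^sup>2 + 4 * b\<^sup>2" for a b :: real
      using zero_le_power2[of "a - b"] by (simp add: power2_eq_square algebra_simps)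
    from this[of "\<bar>x\<bar>" ?c] show "2 * (\<bar>x\<bar> + ?c)\<^sup>2 \<le> 4 * x\<^sup>2 + 4 * ?c\<^sup>2" by simp
  qed simp
  finally show ?thesis by (simp add: add_divide_distrib)
qed

lemma integrable_gauss_bound: "0 < t \<Longrightarrow> integrable (gauss t) (\<lambda>x. 4 * x\<^sup>2 / \<epsilon>\<^sup>2 + 4 * (1 + 2 * \<epsilon>)\<^sup>2 / \<epsilon>\<^sup>2)"
proof -
  assume t: "0 < t"
  interpret prob_space "gauss t" using t by (rule prob_space_gauss)
  show ?thesis using integrable_gauss_square[OF t] by auto
qed

lemma integrable_gauss_cell:
  assumes "0 < t" "0 < \<epsilon>" "\<bar>\<eta>\<bar> \<le> 1"
  shows "integrable (gauss t) (cell \<epsilon> \<eta>)"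
  by (rule Bochner_Integration.integrable_bound[OF integrable_gauss_bound[OF assms(1), of \<epsilon>]])
     (use cell_le_square[of \<epsilon> \<epsilon> \<eta>] cell_nonneg assms in \<open>auto simp: abs_of_nonneg\<close>)

lemma cell_tendsto:
  assumes "0 < \<epsilon>" "e \<longlonglongrightarrow> \<epsilon>" "\<eta> \<longlonglongrightarrow> 0" "(\<bar>x\<bar> + \<epsilon>) / (2 * \<epsilon>) \<notin> \<int>"
  shows "(\<lambda>n. cell (e n) (\<eta> n) x) \<longlonglongrightarrow> cell \<epsilon> 0 x"
proof -
  have "(\<lambda>n. (max 0 (\<bar>x\<bar> + \<eta> n) + e n) / (2 * e n)) \<longlonglongrightarrow> (max 0 (\<bar>x\<bar> + 0) + \<epsilon>) / (2 * \<epsilon>)"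
    using assms by (intro tendsto_intros) auto
  hence "\<forall>\<^sub>F n in sequentially. \<lfloor>(max 0 (\<bar>x\<bar> + \<eta> n) + e n) / (2 * e n)\<rfloor> = \<lfloor>(max 0 (\<bar>x\<bar> + 0) + \<epsilon>) / (2 * \<epsilon>)\<rfloor>"
    using assms(4) by (intro eventually_floor_eq) auto
  hence "\<forall>\<^sub>F n in sequentially. cell (e n) (\<eta> n) x = cell \<epsilon> 0 x"
    by eventually_elim (simp add: cell_def)
  thus ?thesis by (rule tendsto_eventually)
qed

lemma AE_gauss_not_boundary:
  assumes "0 < \<epsilon>"
  shows "AE x in gauss t. (\<bar>x\<bar> + \<epsilon>) / (2 * \<epsilon>) \<notin> \<int>"
proof -
  let ?A = "(\<lambda>k::int. 2 * \<epsilon> * of_int k - \<epsilon>) ` UNIV \<union> (\<lambda>k::int. \<epsilon> - 2 * \<epsilon> * of_int k) ` UNIV"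
  have "countable ?A" by auto
  hence "AE x in lborel. x \<notin> ?A"
    by (intro AE_not_in countable_imp_null_set_lborel)
  hence "AE x in lborel. (\<bar>x\<bar> + \<epsilon>) / (2 * \<epsilon>) \<notin> \<int>"
  proof eventually_elim
    case (elim x)
    show ?case
    proof
      assume "(\<bar>x\<bar> + \<epsilon>) / (2 * \<epsilon>) \<in> \<int>"
      then obtain k where "(\<bar>x\<bar> + \<epsilon>) / (2 * \<epsilon>) = of_int k" by (auto elim: Ints_cases)
      hence "\<bar>x\<bar> = 2 * \<epsilon> * of_int k - \<epsilon>" using assms by (simp add: field_simps)
      hence "x = 2 * \<epsilon> * of_int k - \<epsilon> \<or> x = \<epsilon> - 2 * \<epsilon> * of_int k" by linarith
      thus False using elim by blast
    qed
  qed
  thus ?thesis by (subst AE_density) auto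
qed

text \<open>The truncation in the second limit gives the lower estimates a bound that is uniform in
  the grid, as the reverse Fatou lemma demands. It disappears in the limit because at each point
  \<open>real n\<close> eventually exceeds the majorant.\<close>

lemma
  assumes "0 < t" "0 < \<epsilon>" "e \<longlonglongrightarrow> \<epsilon>" "\<eta> \<longlonglongrightarrow> 0"
    and e: "\<And>n. \<epsilon> \<le> 2 * e n" "\<And>n. e n \<le> 2 * \<epsilon>" and \<eta>: "\<And>n. \<bar>\<eta> n\<bar> \<le> 1"
  shows integral_cell_tendsto: "(\<lambda>n. \<integral>x. cell (e n) (\<eta> n) x \<partial>gauss t) \<longlonglongrightarrow> (\<integral>x. cell \<epsilon> 0 x \<partial>gauss t)"
    and integral_min_cell_tendsto:
      "(\<lambda>n. \<integral>x. min (real n) (cell (e n) (\<eta> n) x) \<partial>gauss t) \<longlonglongrightarrow> (\<integral>x. cell \<epsilon> 0 x \<partial>gauss t)"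
proof -
  let ?w = "\<lambda>x. 4 * x\<^sup>2 / \<epsilon>\<^sup>2 + 4 * (1 + 2 * \<epsilon>)\<^sup>2 / \<epsilon>\<^sup>2"
  have bound: "cell (e n) (\<eta> n) x \<le> ?w x" for n x
    by (rule cell_le_square[OF \<open>0 < \<epsilon>\<close> e \<eta>])
  have lim: "AE x in gauss t. (\<lambda>n. cell (e n) (\<eta> n) x) \<longlonglongrightarrow> cell \<epsilon> 0 x"
    using AE_gauss_not_boundary[OF \<open>0 < \<epsilon>\<close>] by eventually_elim (rule cell_tendsto[OF assms(2-4)])
  show "(\<lambda>n. \<integral>x. cell (e n) (\<eta> n) x \<partial>gauss t) \<longlonglongrightarrow> (\<integral>x. cell \<epsilon> 0 x \<partial>gauss t)"
    by (rule integral_dominated_convergence[OF _ _ integrable_gauss_bound[OF \<open>0 < t\<close>] lim])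
       (use bound cell_nonneg in \<open>auto simp: abs_of_nonneg\<close>)
  have lim': "AE x in gauss t. (\<lambda>n. min (real n) (cell (e n) (\<eta> n) x)) \<longlonglongrightarrow> cell \<epsilon> 0 x"
    using lim
  proof eventually_elim
    case (elim x)
    have "\<forall>\<^sub>F n in sequentially. min (real n) (cell (e n) (\<eta> n) x) = cell (e n) (\<eta> n) x"
      using eventually_ge_at_top[of "nat \<lceil>?w x\<rceil>"]
    proof eventually_elim
      case (elim n)
      hence "?w x \<le> real n" by linarith
      thus ?case using bound[of n x] by (intro min_absorb2) linarith
    qed
    thus ?case using elim by (simp add: tendsto_cong)
  qed
  have "norm (min (real n) (cell (e n) (\<eta> n) x)) \<le> ?w x" for n x
    using bound[of n x] cell_nonneg[of "e n" "\<eta> n" x] by (auto simp: min_def)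
  thus "(\<lambda>n. \<integral>x. min (real n) (cell (e n) (\<eta> n) x) \<partial>gauss t) \<longlonglongrightarrow> (\<integral>x. cell \<epsilon> 0 x \<partial>gauss t)"
    by (intro integral_dominated_convergence[OF _ _ integrable_gauss_bound[OF \<open>0 < t\<close>] lim']) auto
qed

lemma borel_measurable_completion_AE:
  fixes f g :: "'a \<Rightarrow> 'b::topological_space"
  assumes f: "f \<in> borel_measurable M" and "AE x in M. f x = g x"
  shows "g \<in> borel_measurable (completion M)"
proof (rule measurableI)
  fix A :: "'b set" assume A: "A \<in> sets borel"
  have f': "f \<in> borel_measurable (completion M)" by (rule measurable_completion[OF f])
  have "AE x in completion M. f x = g x" by (rule AE_completion[OF assms(2)])
  then have "AE x in completion M. x \<in> f -` A \<inter> space (completion M) \<longleftrightarrow> x \<in> g -` A \<inter> space (completion M)"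
    by eventually_elim auto
  from completion.in_sets_AE[OF this measurable_sets[OF f' A]]
  show "g -` A \<inter> space (completion M) \<in> sets (completion M)" by simp
qed simp

text \<open>Both integrals equal \<open>h\<close>, which is finite, so \<open>l\<close> and
  \<open>u\<close> agree almost everywhere. Measurability of \<open>f\<close> up to a null set is
  thereby a consequence and not an assumption.\<close>

lemma nn_integral_squeeze:
  fixes f l u :: "'a \<Rightarrow> ennreal"
  assumes [measurable]: "l \<in> borel_measurable M" "u \<in> borel_measurable M"
    and lu: "AE x in M. l x \<le> f x \<and> f x \<le> u x"
    and int: "h \<le> (\<integral>\<^sup>+x. l x \<partial>M)" "(\<integral>\<^sup>+x. u x \<partial>M) \<le> h" "h \<noteq> \<infinity>"
  shows "AE x in M. f x = u x" and "(\<integral>\<^sup>+x. u x \<partial>M) = h"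
proof -
  have le: "AE x in M. l x \<le> u x" using lu by eventually_elim auto
  have "(\<integral>\<^sup>+x. l x \<partial>M) \<le> (\<integral>\<^sup>+x. u x \<partial>M)" using le by (rule nn_integral_mono_AE)
  then have eq: "(\<integral>\<^sup>+x. l x \<partial>M) = h" "(\<integral>\<^sup>+x. u x \<partial>M) = h" using int by auto
  show "(\<integral>\<^sup>+x. u x \<partial>M) = h" by fact
  have "AE x in M. u x \<le> l x"
  proof (rule ccontr)
    assume "\<not> ?thesis"
    then have "(\<integral>\<^sup>+x. l x \<partial>M) < (\<integral>\<^sup>+x. u x \<partial>M)"
      using le int(3) eq(1) by (intro nn_integral_less) auto
    with eq show False by simp
  qed
  with lu show "AE x in M. f x = u x" by eventually_elim auto
qed

context standard_brownian_motion
begin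

text \<open>Two limits are taken in turn: the mesh \<open>n\<close>, for which each path satisfies
  its bounds only eventually, and then the error level \<open>m\<close>, which governs thresholds,
  shift and truncation together. Fatou's lemma controls the upper envelope \<open>U\<close>, the
  reverse Fatou lemma the lower one \<open>L\<close>; the squeeze delivers measurability and value
  at once.\<close>

theorem has_bochner_integral_bar_count:
  assumes "0 < t" "0 < \<epsilon>"
  shows "has_bochner_integral (completion M) (\<lambda>\<omega>. real (bar_count \<epsilon> (\<lambda>u. \<bar>B u \<omega>\<bar>) t))
    (\<integral>x. cell \<epsilon> 0 x \<partial>gauss t)"
proof -
  define N where "N \<omega> = real (bar_count \<epsilon> (\<lambda>u. \<bar>B u \<omega>\<bar>) t)" for \<omega>
  \<comment> \<open>At most 1/2, so that \<open>lo m\<close> and \<open>hi m\<close> stay within a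
    factor 2 of \<open>\<epsilon>\<close>.\<close>
  define \<eta> where "\<eta> m = 1 / real (m + 2)" for m :: nat
  define lo where "lo m = \<epsilon> * (1 - \<eta> m)" for m
  define hi where "hi m = \<epsilon> * (1 + \<eta> m)" for m
  have \<eta>: "0 < \<eta> m" "\<eta> m \<le> 1 / 2" "\<bar>\<eta> m\<bar> \<le> 1" "\<bar>- \<eta> m\<bar> \<le> 1" for m by (auto simp: \<eta>_def field_simps)
  have \<eta>_lim: "\<eta> \<longlonglongrightarrow> 0"
    unfolding \<eta>_def using LIMSEQ_ignore_initial_segment[OF lim_const_over_n[of 1], of 2] by simp
  have lo: "0 < lo m" "lo m < \<epsilon>" "\<epsilon> \<le> 2 * lo m" "lo m \<le> 2 * \<epsilon>" for m
    using \<eta>[of m] assms by (auto simp: lo_def field_simps)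
  have hi: "\<epsilon> < hi m" "\<epsilon> \<le> 2 * hi m" "hi m \<le> 2 * \<epsilon>" for m
    using \<eta>[of m] assms by (auto simp: hi_def field_simps)
  have lo_lim: "lo \<longlonglongrightarrow> \<epsilon>"
    unfolding lo_def using tendsto_mult[OF tendsto_const tendsto_diff[OF tendsto_const \<eta>_lim], of \<epsilon> 1] by simp
  have hi_lim: "hi \<longlonglongrightarrow> \<epsilon>"
    unfolding hi_def using tendsto_mult[OF tendsto_const tendsto_add[OF tendsto_const \<eta>_lim], of \<epsilon> 1] by simp
  define H where "H = (\<integral>x. cell \<epsilon> 0 x \<partial>gauss t)"
  define Hl where "Hl m = (\<integral>x. min (real m) (cell (hi m) (- \<eta> m) x) \<partial>gauss t)" for m
  define Hu where "Hu m = (\<integral>x. cell (lo m) (\<eta> m) x \<partial>gauss t)" for m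
  have Hl: "Hl \<longlonglongrightarrow> H"
    unfolding Hl_def H_def using \<eta> hi tendsto_minus[OF \<eta>_lim] assms hi_lim
    by (intro integral_min_cell_tendsto) (auto intro: order_trans)
  have Hu: "Hu \<longlonglongrightarrow> H"
    unfolding Hu_def H_def using \<eta> lo \<eta>_lim assms lo_lim
    by (intro integral_cell_tendsto) (auto intro: order_trans)
  \<comment> \<open>A grid needs at least one step, hence \<open>Suc n\<close> steps and
    \<open>Suc (Suc n)\<close> signs.\<close>
  define w where "w e s n \<omega> = walk e s (Suc n) (\<lambda>i. grid_step t (Suc n) i \<omega>)" for e s n \<omega>
  define l where "l m n \<omega> = sign_avg (Suc (Suc n)) (\<lambda>s. min (real m) (cell (hi m) (- \<eta> m) (w (hi m) s n \<omega>)))" for m n \<omega>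
  define u where "u m n \<omega> = sign_avg (Suc (Suc n)) (\<lambda>s. cell (lo m) (\<eta> m) (w (lo m) s n \<omega>))" for m n \<omega>
  have l_int: "has_bochner_integral M (l m n) (Hl m)" for m n
  proof -
    have "integrable (gauss t) (\<lambda>x. min (real m) (cell (hi m) (- \<eta> m) x))"
      using hi(1)[of m] \<eta>[of m] assms
      by (intro Bochner_Integration.integrable_bound[OF integrable_gauss_cell[of t "hi m" "- \<eta> m"]])
         (auto simp: cell_nonneg)
    then show ?thesis
      unfolding l_def[abs_def] w_def Hl_def using assms
      by (intro has_bochner_integral_sign_avg has_bochner_integral_walk) auto
  qed
  have u_int: "has_bochner_integral M (u m n) (Hu m)" for m n
    unfolding u_def[abs_def] w_def Hu_def using assms lo(1)[of m] \<eta>[of m]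
    by (intro has_bochner_integral_sign_avg has_bochner_integral_walk integrable_gauss_cell) auto
  have [measurable]: "l m n \<in> borel_measurable M" "u m n \<in> borel_measurable M" for m n
    using l_int[of m n] u_int[of m n] unfolding has_bochner_integral_iff
    by (auto intro: borel_measurable_integrable)
  have nonneg: "0 \<le> l m n \<omega>" "0 \<le> u m n \<omega>" "l m n \<omega> \<le> real m" for m n \<omega>
    using sign_avg_mono[of "\<lambda>_. 0" "\<lambda>s. min (real m) (cell (hi m) (- \<eta> m) (w (hi m) s n \<omega>))" "Suc (Suc n)"]
      sign_avg_mono[of "\<lambda>s. min (real m) (cell (hi m) (- \<eta> m) (w (hi m) s n \<omega>))" "\<lambda>_. real m" "Suc (Suc n)"]
      sign_avg_mono[of "\<lambda>_. 0" "\<lambda>s. cell (lo m) (\<eta> m) (w (lo m) s n \<omega>)" "Suc (Suc n)"]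
    unfolding l_def u_def sign_avg_const by (simp_all add: cell_nonneg del: sign_avg.simps)
  have nn: "(\<integral>\<^sup>+\<omega>. ennreal (l m n \<omega>) \<partial>M) = ennreal (Hl m)" "(\<integral>\<^sup>+\<omega>. ennreal (u m n \<omega>) \<partial>M) = ennreal (Hu m)" for m n
    using l_int[of m n] u_int[of m n] nonneg
    by (auto simp: has_bochner_integral_iff nn_integral_eq_integral)
  have path: "AE \<omega> in M. \<forall>m. \<forall>\<^sub>F n in sequentially. l m n \<omega> \<le> N \<omega> \<and> N \<omega> \<le> u m n \<omega>"
    using start_zero continuous_paths
  proof eventually_elim
    case (elim \<omega>)
    show ?case
    proof
      fix m
      have "\<forall>\<^sub>F n in sequentially.
          sign_avg (Suc n) (\<lambda>s. cell (hi m) (- \<eta> m) (walk (hi m) s n (\<lambda>i. grid_step t n i \<omega>))) \<le> N \<omega> \<and>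
          N \<omega> \<le> sign_avg (Suc n) (\<lambda>s. cell (lo m) (\<eta> m) (walk (lo m) s n (\<lambda>i. grid_step t n i \<omega>)))"
        unfolding N_def grid_step_def
        by (rule grid_bar_count_bounds[OF elim(2,1) assms(1) lo(1,2) hi(1) \<eta>(1)])
      then have "\<forall>\<^sub>F n in sequentially.
          sign_avg (Suc (Suc n)) (\<lambda>s. cell (hi m) (- \<eta> m) (w (hi m) s n \<omega>)) \<le> N \<omega> \<and> N \<omega> \<le> u m n \<omega>"
        unfolding w_def u_def by (subst eventually_sequentially_Suc) assumption
      then show "\<forall>\<^sub>F n in sequentially. l m n \<omega> \<le> N \<omega> \<and> N \<omega> \<le> u m n \<omega>"
      proof eventually_elim
        case (elim n)
        have "l m n \<omega> \<le> sign_avg (Suc (Suc n)) (\<lambda>s. cell (hi m) (- \<eta> m) (w (hi m) s n \<omega>))"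
          unfolding l_def by (rule sign_avg_mono) simp
        with elim show ?case by linarith
      qed
    qed
  qed
  define L where "L \<omega> = (SUP m. limsup (\<lambda>n. ennreal (l m n \<omega>)))" for \<omega>
  define U where "U \<omega> = (INF m. liminf (\<lambda>n. ennreal (u m n \<omega>)))" for \<omega>
  have meas [measurable]: "L \<in> borel_measurable M" "U \<in> borel_measurable M"
    unfolding L_def[abs_def] U_def[abs_def] by measurable
  have LU: "AE \<omega> in M. L \<omega> \<le> ennreal (N \<omega>) \<and> ennreal (N \<omega>) \<le> U \<omega>"
    using path
  proof eventually_elim
    case (elim \<omega>)
    have "limsup (\<lambda>n. ennreal (l m n \<omega>)) \<le> ennreal (N \<omega>)" for m
      by (rule Limsup_bounded) (use elim[rule_format, of m] in \<open>auto elim!: eventually_mono intro: ennreal_leI\<close>)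
    moreover have "ennreal (N \<omega>) \<le> liminf (\<lambda>n. ennreal (u m n \<omega>))" for m
      by (rule Liminf_bounded) (use elim[rule_format, of m] in \<open>auto elim!: eventually_mono intro: ennreal_leI\<close>)
    ultimately show ?case unfolding L_def U_def by (auto intro: SUP_least INF_greatest)
  qed
  have Hl_le: "ennreal (Hl m) \<le> (\<integral>\<^sup>+\<omega>. L \<omega> \<partial>M)" for m
  proof -
    have "ennreal (Hl m) = limsup (\<lambda>n. \<integral>\<^sup>+\<omega>. ennreal (l m n \<omega>) \<partial>M)"
      by (simp add: nn Limsup_const)
    also have "\<dots> \<le> (\<integral>\<^sup>+\<omega>. limsup (\<lambda>n. ennreal (l m n \<omega>)) \<partial>M)"
      by (rule nn_integral_limsup[where w = "\<lambda>_. ennreal (real m)"])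
         (auto simp: nonneg emeasure_space_1 ennreal_mult_less_top intro!: ennreal_leI)
    also have "\<dots> \<le> (\<integral>\<^sup>+\<omega>. L \<omega> \<partial>M)"
      unfolding L_def by (intro nn_integral_mono SUP_upper) simp
    finally show ?thesis .
  qed
  have Hu_ge: "(\<integral>\<^sup>+\<omega>. U \<omega> \<partial>M) \<le> ennreal (Hu m)" for m
  proof -
    have "(\<integral>\<^sup>+\<omega>. U \<omega> \<partial>M) \<le> (\<integral>\<^sup>+\<omega>. liminf (\<lambda>n. ennreal (u m n \<omega>)) \<partial>M)"
      unfolding U_def by (intro nn_integral_mono INF_lower) simp
    also have "\<dots> \<le> liminf (\<lambda>n. \<integral>\<^sup>+\<omega>. ennreal (u m n \<omega>) \<partial>M)"
      by (rule nn_integral_liminf) simp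
    also have "\<dots> = ennreal (Hu m)" by (simp add: nn Liminf_const)
    finally show ?thesis .
  qed
  have "ennreal H \<le> (\<integral>\<^sup>+\<omega>. L \<omega> \<partial>M)"
    by (rule LIMSEQ_le_const2[OF tendsto_ennrealI[OF Hl]]) (use Hl_le in auto)
  moreover have "(\<integral>\<^sup>+\<omega>. U \<omega> \<partial>M) \<le> ennreal H"
    by (rule LIMSEQ_le_const[OF tendsto_ennrealI[OF Hu]]) (use Hu_ge in auto)
  ultimately have sq: "AE \<omega> in M. ennreal (N \<omega>) = U \<omega>" "(\<integral>\<^sup>+\<omega>. U \<omega> \<partial>M) = ennreal H"
    using nn_integral_squeeze[OF meas LU, of "ennreal H"] by auto
  have N_meas: "N \<in> borel_measurable (completion M)"
  proof (rule borel_measurable_completion_AE)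
    show "(\<lambda>\<omega>. enn2real (U \<omega>)) \<in> borel_measurable M" by measurable
    show "AE \<omega> in M. enn2real (U \<omega>) = N \<omega>"
      using sq(1) by eventually_elim (metis N_def enn2real_ennreal of_nat_0_le_iff)
  qed
  have "(\<integral>\<^sup>+\<omega>. ennreal (N \<omega>) \<partial>completion M) = (\<integral>\<^sup>+\<omega>. U \<omega> \<partial>completion M)"
    using AE_completion[OF sq(1)] by (rule nn_integral_cong_AE)
  also have "\<dots> = ennreal H" by (simp add: nn_integral_completion sq(2))
  finally have "(\<integral>\<^sup>+\<omega>. ennreal (N \<omega>) \<partial>completion M) = ennreal H" .
  moreover have "0 \<le> H" unfolding H_def by (simp add: cell_nonneg)
  ultimately have "has_bochner_integral (completion M) N H"
    using N_meas by (intro has_bochner_integral_nn_integral) (auto simp: N_def)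
  thus ?thesis by (simp add: N_def[abs_def] H_def)
qed

end

subsection \<open>The series of error functions\<close>

lemma gauss_tail:
  assumes "0 < t" "0 \<le> c"
  shows "measure (gauss t) {x. c \<le> \<bar>x\<bar>} = erfc (c / sqrt (2 * t))"
proof -
  interpret prob_space "gauss t" using assms(1) by (rule prob_space_gauss)
  let ?f = "\<lambda>x. indicator {x. c \<le> \<bar>x\<bar>} x * normal_density 0 (sqrt t) x :: real"
  let ?s = "sqrt (2 * t)"
  have s: "0 < ?s" "?s\<^sup>2 = 2 * t" using assms by auto
  have nd: "0 < sqrt t" using assms by simp
  have int: "integrable lborel ?f"
    using integrable_mult_indicator[of "{x. c \<le> \<bar>x\<bar>}" lborel "normal_density 0 (sqrt t)"] nd
    by (simp add: integrable_normal_density)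
  have "measure (gauss t) {x. c \<le> \<bar>x\<bar>} = (\<integral>x. indicator {x. c \<le> \<bar>x\<bar>} x \<partial>gauss t)"
    by simp
  also have "\<dots> = (\<integral>x. ?f x \<partial>lborel)"
    by (subst integral_density) (auto simp: mult.commute)
  also have "\<dots> = 2 * (\<integral>x. indicator {0..} x *\<^sub>R ?f x \<partial>lborel)"
  proof -
    have "integrable lborel (\<lambda>x. indicator {0..} x *\<^sub>R ?f x)"
      using int by (intro integrable_mult_indicator) auto
    then have "has_bochner_integral lborel (\<lambda>x. indicator {0..} x *\<^sub>R ?f x) (\<integral>x. indicator {0..} x *\<^sub>R ?f x \<partial>lborel)"
      by (rule has_bochner_integral_integrable)
    moreover have "?f (- x) = ?f x" for x by (simp add: indicator_def normal_density_def)
    ultimately have "has_bochner_integral lborel ?f (2 *\<^sub>R (\<integral>x. indicator {0..} x *\<^sub>R ?f x \<partial>lborel))"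
      by (rule has_bochner_integral_even_function)
    then show ?thesis unfolding has_bochner_integral_iff by simp
  qed
  also have "(\<integral>x. indicator {0..} x *\<^sub>R ?f x \<partial>lborel) =
      (\<integral>x. indicator {c..} x * normal_density 0 (sqrt t) x \<partial>lborel)"
    using assms by (intro Bochner_Integration.integral_cong) (auto simp: indicator_def)
  also have "\<dots> = \<bar>?s\<bar> * (\<integral>u. indicator {c..} (0 + ?s * u) * normal_density 0 (sqrt t) (0 + ?s * u) \<partial>lborel)"
    using s lborel_integral_real_affine[of ?s "\<lambda>x. indicator {c..} x * normal_density 0 (sqrt t) x" 0] by simp
  also have "(\<integral>u. indicator {c..} (0 + ?s * u) * normal_density 0 (sqrt t) (0 + ?s * u) \<partial>lborel) =
      (\<integral>u. 1 / (?s * sqrt pi) * (indicator {c / ?s..} u *\<^sub>R exp (- u\<^sup>2)) \<partial>lborel)"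
  proof (rule Bochner_Integration.integral_cong[OF refl])
    fix u
    have "c \<le> ?s * u \<longleftrightarrow> c / ?s \<le> u" using s(1) by (simp add: field_simps)
    moreover have "normal_density 0 (sqrt t) (?s * u) = 1 / (?s * sqrt pi) * exp (- u\<^sup>2)"
      using assms(1) by (simp add: normal_density_def power_mult_distrib real_sqrt_mult mult.assoc mult.commute mult.left_commute)
    ultimately show "indicator {c..} (0 + ?s * u) * normal_density 0 (sqrt t) (0 + ?s * u) =
       1 / (?s * sqrt pi) * (indicator {c / ?s..} u *\<^sub>R exp (- u\<^sup>2))"
      by (simp add: indicator_def)
  qed
  also have "\<dots> = 1 / (?s * sqrt pi) * (LBINT u:{c / ?s..}. exp (- u\<^sup>2))"
    unfolding set_lebesgue_integral_def by (rule integral_mult_right_zero)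
  also have "2 * (\<bar>?s\<bar> * \<dots>) = erfc (c / ?s)"
    using s(1) by (simp add: erfc_def)
  finally show ?thesis .
qed

lemma sum_odd_squares: "(\<Sum>j<n. 2 * real (2 * j + 1)) = 2 * (real n)\<^sup>2"
  by (induction n) (auto simp: power2_eq_square algebra_simps)

text \<open>At \<open>\<bar>x\<bar> = (2 * j + 1) * \<epsilon>\<close> the value jumps from
  \<open>2 * j^2\<close> to \<open>2 * (j + 1)^2\<close>, that is, by
  \<open>2 * (2 * j + 1)\<close>.\<close>

lemma cell_layers:
  assumes "0 < \<epsilon>"
  shows "(\<Sum>j. ennreal (2 * real (2 * j + 1)) * indicator {x. real (2 * j + 1) * \<epsilon> \<le> \<bar>x\<bar>} x) = ennreal (cell \<epsilon> 0 x)"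
proof -
  let ?y = "(\<bar>x\<bar> + \<epsilon>) / (2 * \<epsilon>)"
  define n where "n = nat \<lfloor>?y\<rfloor>"
  have y: "0 \<le> ?y" using assms by simp
  have n: "real n = of_int \<lfloor>?y\<rfloor>" using y by (simp add: n_def)
  have iff: "real (2 * j + 1) * \<epsilon> \<le> \<bar>x\<bar> \<longleftrightarrow> j < n" for j
  proof -
    have "real (2 * j + 1) * \<epsilon> \<le> \<bar>x\<bar> \<longleftrightarrow> real_of_int (int j + 1) \<le> ?y"
      using assms by (simp add: field_simps)
    also have "\<dots> \<longleftrightarrow> int j + 1 \<le> \<lfloor>?y\<rfloor>" by (rule le_floor_iff[symmetric])
    also have "\<dots> \<longleftrightarrow> j < n" unfolding n_def by linarith
    finally show ?thesis .
  qed
  have "(\<Sum>j. ennreal (2 * real (2 * j + 1)) * indicator {x. real (2 * j + 1) * \<epsilon> \<le> \<bar>x\<bar>} x) =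
      (\<Sum>j<n. ennreal (2 * real (2 * j + 1)) * indicator {x. real (2 * j + 1) * \<epsilon> \<le> \<bar>x\<bar>} x)"
    using iff by (intro suminf_finite) (auto simp: indicator_def)
  also have "\<dots> = (\<Sum>j<n. ennreal (2 * real (2 * j + 1)))"
    using iff by (intro sum.cong) (auto simp: indicator_def)
  also have "\<dots> = ennreal (\<Sum>j<n. 2 * real (2 * j + 1))"
    by (rule sum_ennreal) simp
  also have "(\<Sum>j<n. 2 * real (2 * j + 1)) = 2 * (real n)\<^sup>2" by (rule sum_odd_squares)
  also have "2 * (real n)\<^sup>2 = cell \<epsilon> 0 x" by (simp add: cell_def n)
  finally show ?thesis .
qed

lemma cell_integral_sums:
  assumes "0 < t" "0 < \<epsilon>"
  shows "(\<lambda>j. 2 * real (2 * j + 1) * erfc (real (2 * j + 1) * \<epsilon> / sqrt (2 * t))) sums (\<integral>x. cell \<epsilon> 0 x \<partial>gauss t)"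
proof -
  interpret prob_space "gauss t" using assms(1) by (rule prob_space_gauss)
  let ?v = "\<lambda>j. 2 * real (2 * j + 1) * erfc (real (2 * j + 1) * \<epsilon> / sqrt (2 * t))"
  let ?H = "\<integral>x. cell \<epsilon> 0 x \<partial>gauss t"
  have e: "erfc (real (2 * j + 1) * \<epsilon> / sqrt (2 * t)) = prob {x. real (2 * j + 1) * \<epsilon> \<le> \<bar>x\<bar>}" for j
    using assms by (intro gauss_tail[symmetric]) auto
  have nn: "0 \<le> ?v j" for j unfolding e by simp
  have "ennreal ?H = (\<integral>\<^sup>+x. ennreal (cell \<epsilon> 0 x) \<partial>gauss t)"
    using assms by (intro nn_integral_eq_integral[symmetric] integrable_gauss_cell) (auto simp: cell_nonneg)
  also have "\<dots> = (\<Sum>j. \<integral>\<^sup>+x. ennreal (2 * real (2 * j + 1)) * indicator {x. real (2 * j + 1) * \<epsilon> \<le> \<bar>x\<bar>} x \<partial>gauss t)"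
    unfolding cell_layers[OF assms(2), symmetric] by (rule nn_integral_suminf) simp
  also have "\<dots> = (\<Sum>j. ennreal (?v j))"
  proof (rule suminf_cong)
    fix j
    have "(\<integral>\<^sup>+x. ennreal (2 * real (2 * j + 1)) * indicator {x. real (2 * j + 1) * \<epsilon> \<le> \<bar>x\<bar>} x \<partial>gauss t) =
        ennreal (2 * real (2 * j + 1)) * emeasure (gauss t) {x. real (2 * j + 1) * \<epsilon> \<le> \<bar>x\<bar>}"
      by (rule nn_integral_cmult_indicator) simp
    also have "\<dots> = ennreal (?v j)"
      unfolding e emeasure_eq_measure by (rule ennreal_mult[symmetric]) auto
    finally show "(\<integral>\<^sup>+x. ennreal (2 * real (2 * j + 1)) * indicator {x. real (2 * j + 1) * \<epsilon> \<le> \<bar>x\<bar>} x \<partial>gauss t) = ennreal (?v j)" .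
  qed
  finally have eq: "ennreal ?H = (\<Sum>j. ennreal (?v j))" .
  have "summable ?v" using nn eq by (intro summable_suminf_not_top) (auto simp flip: eq)
  moreover from this have "ennreal ?H = ennreal (\<Sum>j. ?v j)" using nn by (simp only: eq suminf_ennreal2)
  hence "?H = (\<Sum>j. ?v j)"
    using suminf_nonneg[OF \<open>summable ?v\<close> nn] by (subst (asm) ennreal_inj) (auto simp: cell_nonneg)
  ultimately show ?thesis by (simp add: sums_iff)
qed

text \<open>With \<open>v k = 2 * k * erfc (k * \<epsilon> / sqrt (2 * t))\<close> the term is
  \<open>v k - v (2 * k)\<close>: all indices minus the even ones leave the odd layers. The even
  part has to converge by itself for this, which follows by comparing each even term with the odd
  one before it.\<close>

lemma cell_integral_has_sum:
  assumes "0 < t" "0 < \<epsilon>"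
  shows "((\<lambda>k. 2 * real k * (erfc (real k * \<epsilon> / sqrt (2 * t)) - 2 * erfc (2 * real k * \<epsilon> / sqrt (2 * t))))
    has_sum (\<integral>x. cell \<epsilon> 0 x \<partial>gauss t)) {1..}"
proof -
  interpret prob_space "gauss t" using assms(1) by (rule prob_space_gauss)
  let ?H = "\<integral>x. cell \<epsilon> 0 x \<partial>gauss t"
  define v where "v k = 2 * real k * erfc (real k * \<epsilon> / sqrt (2 * t))" for k
  have e: "erfc (real k * \<epsilon> / sqrt (2 * t)) = prob {x. real k * \<epsilon> \<le> \<bar>x\<bar>}" for k
    using assms by (intro gauss_tail[symmetric]) auto
  have nn: "0 \<le> v k" for k unfolding v_def e by simp
  have odd: "(\<lambda>j. v (2 * j + 1)) sums ?H" using cell_integral_sums[OF assms] by (simp add: v_def)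
  have even: "v (2 * (j + 1)) \<le> 2 * v (2 * j + 1)" for j
  proof -
    have "prob {x. real (2 * (j + 1)) * \<epsilon> \<le> \<bar>x\<bar>} \<le> prob {x. real (2 * j + 1) * \<epsilon> \<le> \<bar>x\<bar>}"
    proof (rule finite_measure_mono)
      have "real (2 * j + 1) * \<epsilon> \<le> real (2 * (j + 1)) * \<epsilon>" using assms by (intro mult_right_mono) auto
      then show "{x. real (2 * (j + 1)) * \<epsilon> \<le> \<bar>x\<bar>} \<subseteq> {x. real (2 * j + 1) * \<epsilon> \<le> \<bar>x\<bar>}" by auto
    qed simp
    then have "v (2 * (j + 1)) \<le> (2 * (2 * real (2 * j + 1))) * prob {x. real (2 * j + 1) * \<epsilon> \<le> \<bar>x\<bar>}"
      unfolding v_def e by (intro mult_mono) auto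
    then show ?thesis by (simp only: v_def e mult.assoc)
  qed
  have "summable (\<lambda>j. v (2 * (j + 1)))"
    by (rule summable_comparison_test'[OF summable_mult[OF sums_summable[OF odd], of 2], of 0])
       (use even nn in auto)
  hence "summable (\<lambda>j. v (2 * j))" using summable_Suc_iff[of "\<lambda>j. v (2 * j)"] by simp
  then obtain E where E: "(\<lambda>j. v (2 * j)) sums E" by blast
  have E': "((\<lambda>j. v (2 * j)) has_sum E) UNIV"
    using E nn by (intro sums_nonneg_imp_has_sum) auto
  have O': "((\<lambda>j. v (2 * j + 1)) has_sum ?H) UNIV"
    using odd nn by (intro sums_nonneg_imp_has_sum) auto
  have "(v has_sum E) (range (\<lambda>j. 2 * j))"
    using E' by (subst has_sum_reindex) (auto simp: o_def inj_on_def)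
  moreover have "(v has_sum ?H) (range (\<lambda>j. 2 * j + 1))"
    using O' by (subst has_sum_reindex) (auto simp: o_def inj_on_def)
  moreover have "range (\<lambda>j. 2 * j) \<inter> range (\<lambda>j. 2 * j + 1) = ({} :: nat set)" by (auto, presburger)
  ultimately have "(v has_sum (E + ?H)) (range (\<lambda>j. 2 * j) \<union> range (\<lambda>j. 2 * j + 1))"
    by (rule has_sum_Un_disjoint)
  moreover have "range (\<lambda>j. 2 * j) \<union> range (\<lambda>j. 2 * j + 1) = (UNIV :: nat set)"
  proof (intro equalityI subsetI)
    fix k :: nat
    show "k \<in> range (\<lambda>j. 2 * j) \<union> range (\<lambda>j. 2 * j + 1)"
      by (cases "even k") (auto elim!: evenE oddE)
  qed simp
  ultimately have "(v has_sum (E + ?H)) UNIV" by simp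
  from has_sum_add[OF this has_sum_uminusI[OF E']] have "((\<lambda>k. v k - v (2 * k)) has_sum ?H) UNIV" by simp
  moreover have "((\<lambda>k. v k - v (2 * k)) has_sum ?H) UNIV \<longleftrightarrow>
     ((\<lambda>k. 2 * real k * (erfc (real k * \<epsilon> / sqrt (2 * t)) - 2 * erfc (2 * real k * \<epsilon> / sqrt (2 * t)))) has_sum ?H) {1..}"
    by (rule has_sum_cong_neutral) (auto simp: v_def algebra_simps not_le)
  ultimately show ?thesis by simp
qed

subsection \<open>The dual series\<close>

text \<open>Count the even terms twice and subtract all terms. This links the alternating Fourier
  coefficients to a dual series with terms \<open>2 * q (2 * k) - q k\<close>.\<close>

lemma has_sum_alternating:
  fixes q :: "nat \<Rightarrow> real"
  assumes Q: "(q has_sum Q) {1..}" and E: "((\<lambda>k. q (2 * k)) has_sum E) {1..}"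
  shows "((\<lambda>k. (-1) ^ k * q k) has_sum (2 * E - Q)) {1..}"
proof -
  have "(q has_sum E) ((\<lambda>k. 2 * k) ` {1..})"
    using E by (subst has_sum_reindex) (auto simp: o_def inj_on_def)
  then have "((\<lambda>k. 2 * q k) has_sum (2 * E)) ((\<lambda>k. 2 * k) ` {1..})"
    by (rule has_sum_cmult_right)
  also have "?this \<longleftrightarrow> ((\<lambda>k. if even k then 2 * q k else 0) has_sum (2 * E)) {1..}"
    by (rule has_sum_cong_neutral) (auto elim!: evenE)
  finally have "((\<lambda>k. (if even k then 2 * q k else 0) + - q k) has_sum (2 * E + - Q)) {1..}"
    using has_sum_uminusI[OF Q] by (rule has_sum_add)
  also have "?this \<longleftrightarrow> ((\<lambda>k. (-1) ^ k * q k) has_sum (2 * E + - Q)) {1..}"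
    by (rule has_sum_cong) auto
  finally show ?thesis by simp
qed

lemma has_sum_atLeast_1_imp_sums:
  fixes f :: "nat \<Rightarrow> real"
  assumes "(f has_sum S) {1..}" "f 0 = 0"
  shows "f sums S"
proof -
  have "(f has_sum S) UNIV \<longleftrightarrow> (f has_sum S) {1..}"
    by (rule has_sum_cong_neutral) (use assms(2) in \<open>auto simp: not_le\<close>)
  then show ?thesis using assms(1) has_sum_imp_sums by blast
qed

text \<open>The term at \<open>k = 0\<close> is 0, since division by zero yields zero; the
  trigonometric series below also start at index 0 on this basis.\<close>

lemma alternating_inverse_squares: "(\<lambda>k. (-1) ^ k / (real k)\<^sup>2) sums (- (pi\<^sup>2 / 12))"
proof -
  let ?q = "\<lambda>k. 1 / (real k)\<^sup>2"
  have "((\<lambda>n. 1 / (real n + 1)\<^sup>2) has_sum (pi\<^sup>2 / 6)) UNIV"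
    using inverse_squares_sums by (intro sums_nonneg_imp_has_sum) (auto simp: add.commute)
  then have "(?q has_sum (pi\<^sup>2 / 6)) (Suc ` UNIV)"
    by (subst has_sum_reindex) (auto simp: o_def add.commute)
  also have "Suc ` UNIV = {1..}"
    by (auto simp: image_iff) (metis Suc_le_D)
  finally have Q: "(?q has_sum (pi\<^sup>2 / 6)) {1..}" .
  have "((\<lambda>k. 1 / 4 * ?q k) has_sum (1 / 4 * (pi\<^sup>2 / 6))) {1..}"
    using Q by (rule has_sum_cmult_right)
  then have E: "((\<lambda>k. ?q (2 * k)) has_sum (1 / 4 * (pi\<^sup>2 / 6))) {1..}"
    by (simp add: power_mult_distrib)
  have "((\<lambda>k. (-1) ^ k * ?q k) has_sum (2 * (1 / 4 * (pi\<^sup>2 / 6)) - pi\<^sup>2 / 6)) {1..}"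
    by (rule has_sum_alternating[OF Q E])
  then have "(\<lambda>k. (-1) ^ k * ?q k) sums (2 * (1 / 4 * (pi\<^sup>2 / 6)) - pi\<^sup>2 / 6)"
    by (rule has_sum_atLeast_1_imp_sums) simp
  then show ?thesis by simp
qed

section \<open>The Fourier series of the parabola\<close>

lemma abs_arctan_diff_le: "\<bar>arctan x - arctan y\<bar> \<le> \<bar>x - y\<bar>"
proof -
  have "norm (arctan x - arctan y) \<le> 1 * norm (x - y)"
  proof (rule field_differentiable_bound[of UNIV arctan "\<lambda>x. inverse (1 + x\<^sup>2)"])
    show "norm (inverse (1 + z\<^sup>2)) \<le> 1" for z :: real
      by (simp add: inverse_le_1_iff)
  qed (auto intro: DERIV_arctan)
  then show ?thesis by simp
qed

text \<open>The imaginary part of the power series of \<open>ln (1 + z)\<close> at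
  \<open>z = r * cis x\<close>. As \<open>1 + z\<close> has positive real part, its argument is an
  arctangent.\<close>

lemma sin_series_arctan:
  assumes "0 \<le> r" "r < 1"
  shows "(\<lambda>n. - ((-1) ^ n * r ^ n * sin (real n * x)) / real n) sums arctan (r * sin x / (1 + r * cos x))"
proof -
  let ?z = "of_real r * cis x"
  have "cmod ?z < 1" using assms by (simp add: norm_mult)
  from sums_Im[OF Ln_series'[OF this]]
  have "(\<lambda>n. Im (- ((- ?z) ^ n) / of_nat n)) sums Im (ln (1 + ?z))" .
  moreover have "Im (- ((- ?z) ^ n) / of_nat n) = - ((-1) ^ n * r ^ n * sin (real n * x)) / real n" for n
  proof -
    have "(- ?z) ^ n = of_real ((-1) ^ n * r ^ n) * cis (real n * x)"
      by (simp add: power_minus[of ?z] power_mult_distrib Complex.DeMoivre)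
    then have "Im ((- ?z) ^ n) = (-1) ^ n * r ^ n * sin (real n * x)"
      by (simp del: of_real_mult of_real_power)
    then show ?thesis by (simp add: Im_divide_of_nat)
  qed
  moreover have "Im (ln (1 + ?z)) = arctan (r * sin x / (1 + r * cos x))"
  proof -
    have "\<bar>r * cos x\<bar> \<le> r * 1" unfolding abs_mult using assms by (intro mult_mono) auto
    then have "0 < Re (1 + ?z)" using assms by simp
    then show ?thesis using Im_Ln_eq[of "1 + ?z"] by (auto simp: complex_eq_iff)
  qed
  ultimately show ?thesis by (simp only:)
qed

text \<open>The derivative of this series at \<open>r = 1\<close> converges only conditionally; hence the detour through
  \<open>r < 1\<close>, as in Abel summation.\<close>

definition cos_series :: "real \<Rightarrow> real \<Rightarrow> real" where
  "cos_series r x = (\<Sum>n. - ((-1) ^ n * r ^ n * (1 - cos (real n * x))) / (real n)\<^sup>2)"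

text \<open>For \<open>r < 1\<close> the differentiated terms are dominated by \<open>r ^ n\<close>,
  so the series may be differentiated term by term.\<close>

lemma cos_series_deriv:
  assumes "0 \<le> r" "r < 1"
  shows "(cos_series r has_field_derivative arctan (r * sin x / (1 + r * cos x))) (at x)"
proof -
  let ?f = "\<lambda>n x. - ((-1) ^ n * r ^ n * (1 - cos (real n * x))) / (real n)\<^sup>2"
  let ?f' = "\<lambda>n x. - ((-1) ^ n * r ^ n * sin (real n * x)) / real n"
  have "((\<lambda>x. \<Sum>n. ?f n x) has_field_derivative (\<Sum>n. ?f' n x)) (at x)"
  proof (rule has_field_derivative_series'(2)[of UNIV])
    fix n x
    show "(?f n has_field_derivative ?f' n x) (at x within UNIV)"
      by (cases "n = 0") (auto intro!: derivative_eq_intros simp: power2_eq_square field_simps)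
  next
    show "uniformly_convergent_on UNIV (\<lambda>n x. \<Sum>i<n. ?f' i x)"
    proof (rule Weierstrass_m_test')
      show "summable (\<lambda>n. r ^ n)" using assms by (intro summable_geometric) simp
      fix n x
      have "\<bar>sin (real n * x)\<bar> / real n \<le> 1" by (cases "n = 0") (auto simp: divide_le_eq intro: order_trans[OF abs_sin_le_one])
      then have "r ^ n * (\<bar>sin (real n * x)\<bar> / real n) \<le> r ^ n * 1"
        using assms by (intro mult_left_mono) auto
      then show "norm (?f' n x) \<le> r ^ n" using assms by (simp add: abs_mult power_abs)
    qed
  next
    show "summable (\<lambda>n. ?f n 0)" by simp
  qed auto
  then show ?thesis
    using sums_unique[OF sin_series_arctan[OF assms, of x]] by (simp add: cos_series_def[abs_def])
qed

text \<open>For \<open>r = 1\<close> the derivative would be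
  \<open>arctan (sin x / (1 + cos x)) = x / 2\<close>. Since \<open>arctan\<close> is 1-Lipschitz,
  the derivative at \<open>r < 1\<close> differs from \<open>x / 2\<close> by at most
  \<open>(1 - r) / m^2\<close>, where \<open>m\<close> bounds both denominators
  \<open>1 + cos x\<close> and \<open>1 + r * cos x\<close> from below; then the mean value
  inequality applies on the interval around 0.\<close>

lemma cos_series_close:
  assumes "0 \<le> r" "r < 1" and u: "\<bar>u\<bar> < pi"
  defines "m \<equiv> min 1 (1 + cos u)"
  shows "\<bar>cos_series r u - u\<^sup>2 / 4\<bar> \<le> (1 - r) / m\<^sup>2 * \<bar>u\<bar>"
proof -
  have cu: "- 1 < cos u"
  proof -
    have "cos pi < cos \<bar>u\<bar>" using u by (intro cos_monotone_0_pi) auto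
    then show ?thesis by simp
  qed
  have m: "0 < m" using cu by (simp add: m_def)
  let ?S = "{- \<bar>u\<bar>..\<bar>u\<bar>}"
  have "norm ((cos_series r u - u\<^sup>2 / 4) - (cos_series r 0 - 0\<^sup>2 / 4)) \<le> (1 - r) / m\<^sup>2 * norm (u - 0)"
  proof (rule field_differentiable_bound[of ?S _ "\<lambda>x. arctan (r * sin x / (1 + r * cos x)) - x / 2"])
    fix x assume x: "x \<in> ?S"
    show "((\<lambda>x. cos_series r x - x\<^sup>2 / 4) has_field_derivative
       arctan (r * sin x / (1 + r * cos x)) - x / 2) (at x within ?S)"
      by (rule has_field_derivative_at_within)
         (auto intro!: derivative_eq_intros cos_series_deriv assms(1,2))
    have "cos \<bar>u\<bar> \<le> cos \<bar>x\<bar>" using x u by (intro cos_monotone_0_pi_le) auto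
    then have c: "cos u \<le> cos x" by simp
    have 1: "m \<le> 1 + cos x" using c by (simp add: m_def)
    have 2: "m \<le> 1 + r * cos x"
    proof (cases "0 \<le> cos x")
      case True
      then have "0 \<le> r * cos x" using assms by simp
      then show ?thesis by (simp add: m_def)
    next
      case False
      then have "1 * cos x \<le> r * cos x" using assms by (intro mult_right_mono_neg) auto
      then show ?thesis using c by (simp add: m_def)
    qed
    have "- (pi / 2) < x / 2" "x / 2 < pi / 2" using x u by auto
    then have half: "x / 2 = arctan (sin x / (cos x + 1))"
      using arctan_tan[of "x / 2"] tan_half[of "x / 2"] by simp
    then have "\<bar>arctan (r * sin x / (1 + r * cos x)) - x / 2\<bar> \<le> \<bar>r * sin x / (1 + r * cos x) - sin x / (cos x + 1)\<bar>"
      by (simp only: half abs_arctan_diff_le)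
    also have "r * sin x / (1 + r * cos x) - sin x / (cos x + 1) =
        - (1 - r) * sin x / ((1 + r * cos x) * (1 + cos x))"
      using 1 2 m by (simp add: field_simps)
    also have "\<bar>\<dots>\<bar> = (1 - r) * \<bar>sin x\<bar> / ((1 + r * cos x) * (1 + cos x))"
      using assms 1 2 m by (simp add: abs_mult)
    also have "\<dots> \<le> (1 - r) * 1 / (m * m)"
      using assms 1 2 m by (intro frac_le mult_left_mono mult_mono) auto
    finally show "norm (arctan (r * sin x / (1 + r * cos x)) - x / 2) \<le> (1 - r) / m\<^sup>2"
      by (simp add: power2_eq_square)
  qed auto
  then show ?thesis by (simp add: cos_series_def)
qed

lemma cos_series_summable_bound: "0 \<le> r \<Longrightarrow> r \<le> 1 \<Longrightarrow>
  norm (- ((-1) ^ n * r ^ n * (1 - cos (real n * x))) / (real n)\<^sup>2) \<le> 2 * (1 / (real n)\<^sup>2)"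
proof -
  assume r: "0 \<le> r" "r \<le> 1"
  have "r ^ n * \<bar>1 - cos (real n * x)\<bar> \<le> 1 * 2"
    using r cos_ge_minus_one[of "real n * x"] cos_le_one[of "real n * x"]
    by (intro mult_mono power_le_one) (auto simp: abs_le_iff simp del: cos_ge_minus_one cos_le_one)
  then show ?thesis using r by (simp add: abs_mult power_abs divide_right_mono)
qed

lemma summable_inverse_squares: "summable (\<lambda>n. 1 / (real n)\<^sup>2)"
  using inverse_power_summable[of 2, where 'a = real] by (simp add: field_simps)

text \<open>Tannery's theorem lets \<open>r\<close> tend to 1, with majorant \<open>2 / k^2\<close>
  valid up to \<open>r = 1\<close>. The form \<open>1 - cos\<close> made the series vanish at
  \<open>u = 0\<close>; adding the alternating inverse squares turns it back into the cosine
  series.\<close>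

lemma quadratic_Fourier_series:
  assumes "\<bar>u\<bar> < pi"
  shows "(\<lambda>k. (-1) ^ k * cos (real k * u) / (real k)\<^sup>2) sums (u\<^sup>2 / 4 - pi\<^sup>2 / 12)"
proof -
  define r where "r n = 1 - 1 / real (Suc n)" for n
  have r: "0 \<le> r n" "r n < 1" for n by (auto simp: r_def)
  have lim1: "(\<lambda>n. 1 / real (Suc n)) \<longlonglongrightarrow> 0" using LIMSEQ_inverse_real_of_nat by (simp add: inverse_eq_divide)
  have r_lim: "r \<longlonglongrightarrow> 1" unfolding r_def using tendsto_diff[OF tendsto_const lim1, of 1] by simp
  let ?a = "\<lambda>n r. - ((-1) ^ n * r ^ n * (1 - cos (real n * u))) / (real n)\<^sup>2"
  have tan: "summable (\<lambda>n. norm (?a n 1)) \<and> (\<lambda>n. \<Sum>k. ?a k (r n)) \<longlonglongrightarrow> (\<Sum>k. ?a k 1)"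
  proof -
    have "eventually (\<lambda>n. summable (\<lambda>k. norm (?a k (r n)))) sequentially \<and>
           summable (\<lambda>n. norm (?a n 1)) \<and> ((\<lambda>n. suminf (\<lambda>k. ?a k (r n))) \<longlonglongrightarrow> suminf (\<lambda>k. ?a k 1))"
    proof (rule tannerys_theorem)
      show "(\<lambda>n. ?a k (r n)) \<longlonglongrightarrow> ?a k 1" for k
        unfolding divide_inverse by (intro tendsto_intros r_lim)
      show "summable (\<lambda>n. 2 * (1 / (real n)\<^sup>2))"
        using summable_inverse_squares by (rule summable_mult)
      show "eventually (\<lambda>(k, n). norm (?a k (r n)) \<le> 2 * (1 / (real k)\<^sup>2)) (at_top \<times>\<^sub>F sequentially)"
        using cos_series_summable_bound r less_imp_le by (intro always_eventually) fast
    qed simp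
    then show ?thesis by blast
  qed
  have "(\<lambda>n. cos_series (r n) u) \<longlonglongrightarrow> u\<^sup>2 / 4"
  proof -
    let ?m = "min 1 (1 + cos u)"
    have "(\<lambda>n. 1 / real (Suc n) / ?m\<^sup>2 * \<bar>u\<bar>) \<longlonglongrightarrow> 0 / ?m\<^sup>2 * \<bar>u\<bar>"
      unfolding divide_inverse[of _ "?m\<^sup>2"] by (intro tendsto_intros lim1)
    then have "(\<lambda>n. 1 / real (Suc n) / ?m\<^sup>2 * \<bar>u\<bar>) \<longlonglongrightarrow> 0" by simp
    moreover have "\<forall>\<^sub>F n in sequentially. norm (cos_series (r n) u - u\<^sup>2 / 4) \<le> 1 / real (Suc n) / ?m\<^sup>2 * \<bar>u\<bar>"
      using cos_series_close[OF r assms] by (auto simp: r_def intro!: always_eventually)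
    ultimately have "(\<lambda>n. cos_series (r n) u - u\<^sup>2 / 4) \<longlonglongrightarrow> 0"
      by (rule Lim_null_comparison[rotated])
    then show ?thesis by (rule LIM_zero_cancel)
  qed
  then have val: "(\<Sum>k. ?a k 1) = u\<^sup>2 / 4"
    using tan LIMSEQ_unique unfolding cos_series_def by blast
  have "summable (\<lambda>k. ?a k 1)" using tan by (blast intro: summable_norm_cancel)
  then have "(\<lambda>k. ?a k 1) sums (u\<^sup>2 / 4)" using val by (simp add: sums_iff)
  from sums_add[OF this alternating_inverse_squares]
  show ?thesis by (simp add: algebra_simps add_divide_distrib diff_divide_distrib)
qed

text \<open>Integration by parts over the whole line: the boundary terms vanish along the integers,
  and \<open>E\<close> leaves room for corners of \<open>F\<close>.\<close>

lemma integral_derivative_eq_0: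
  fixes F f :: "real \<Rightarrow> real"
  assumes cont: "continuous_on UNIV F" and int: "integrable lborel f"
    and fin: "\<And>n::nat. finite (E \<inter> {- real n..real n})"
    and deriv: "\<And>x. x \<notin> E \<Longrightarrow> (F has_field_derivative f x) (at x)"
    and lim: "(\<lambda>n. F (real n)) \<longlonglongrightarrow> 0" "(\<lambda>n. F (- real n)) \<longlonglongrightarrow> 0"
  shows "(\<integral>x. f x \<partial>lborel) = 0"
proof -
  let ?I = "\<lambda>n::nat. {- real n..real n}"
  have eq: "(\<integral>x. indicator (?I n) x *\<^sub>R f x \<partial>lborel) = F (real n) - F (- real n)" for n
  proof -
    have "(f has_integral (F (real n) - F (- real n))) (?I n)"
      using cont deriv by (intro fundamental_theorem_of_calculus_strong[OF fin[of n]])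
        (auto simp flip: has_real_derivative_iff_has_vector_derivative intro: continuous_on_subset)
    moreover have "set_integrable lborel (?I n) f"
      unfolding set_integrable_def using int by (intro integrable_mult_indicator) auto
    ultimately show ?thesis
      using set_borel_integral_eq_integral(2)[of "?I n" f] by (simp add: set_lebesgue_integral_def integral_unique)
  qed
  have A: "(\<lambda>n. \<integral>x. indicator (?I n) x *\<^sub>R f x \<partial>lborel) \<longlonglongrightarrow> (\<integral>x. f x \<partial>lborel)"
  proof (rule integral_dominated_convergence[where w = "\<lambda>x. norm (f x)"])
    have "\<forall>\<^sub>F n in sequentially. indicator (?I n) x *\<^sub>R f x = f x" for x
      using eventually_ge_at_top[of "nat \<lceil>\<bar>x\<bar>\<rceil>"]
    proof eventually_elim
      case (elim n)
      then have "\<bar>x\<bar> \<le> real n" by linarith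
      then show ?case by (auto simp: indicator_def abs_le_iff)
    qed
    then show "AE x in lborel. (\<lambda>n. indicator (?I n) x *\<^sub>R f x) \<longlonglongrightarrow> f x"
      by (intro AE_I2 tendsto_eventually)
  qed (use int in \<open>auto simp: indicator_def\<close>)
  have "(\<lambda>n. F (real n) - F (- real n)) \<longlonglongrightarrow> 0 - 0" by (intro tendsto_diff lim)
  from LIMSEQ_unique[OF A[unfolded eq] this] show ?thesis by simp
qed

section \<open>Integrals against the standard normal density\<close>

lemma std_normal_density_deriv:
  "(std_normal_density has_field_derivative - x * std_normal_density x) (at x)"
  unfolding std_normal_density_def[abs_def]
  by (auto intro!: derivative_eq_intros simp: field_simps)

lemma std_normal_density_minus [simp]: "std_normal_density (- x) = std_normal_density x"
  by (simp add: std_normal_density_def)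

lemma std_normal_density_tendsto:
  "(\<lambda>n. std_normal_density (real n)) \<longlonglongrightarrow> 0" "(\<lambda>n. real n * std_normal_density (real n)) \<longlonglongrightarrow> 0"
  unfolding std_normal_density_def by real_asymp+

lemma integrable_std_normal_bounded:
  fixes g :: "real \<Rightarrow> real"
  assumes [measurable]: "g \<in> borel_measurable borel" and "\<And>x. \<bar>g x\<bar> \<le> C"
  shows "integrable lborel (\<lambda>x. std_normal_density x * x ^ k * g x)"
proof -
  have "integrable lborel (\<lambda>x. C * (std_normal_density x * \<bar>x\<bar> ^ k))"
    using integrable_std_normal_moment_abs by (rule integrable_mult_right)
  then show ?thesis
  proof (rule Bochner_Integration.integrable_bound)
    have "std_normal_density x * \<bar>x\<bar> ^ k * \<bar>g x\<bar> \<le> std_normal_density x * \<bar>x\<bar> ^ k * \<bar>C\<bar>" for x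
      using assms(2)[of x] by (intro mult_left_mono) auto
    then show "AE x in lborel. norm (std_normal_density x * x ^ k * g x) \<le> norm (C * (std_normal_density x * \<bar>x\<bar> ^ k))"
      by (simp add: abs_mult power_abs mult.commute mult.left_commute)
  qed simp
qed

lemma integral_std_normal_cos:
  "(\<integral>x. std_normal_density x * cos (c * x) \<partial>lborel) = exp (- c\<^sup>2 / 2)"
proof -
  interpret prob_space "density lborel std_normal_density" by (rule prob_space_normal_density) simp
  have "integrable (density lborel std_normal_density) (\<lambda>x. iexp (c * x))"
    by (rule integrable_const_bound[of _ 1]) auto
  then have "Re (\<integral>x. iexp (c * x) \<partial>density lborel std_normal_density) =
      (\<integral>x. Re (iexp (c * x)) \<partial>density lborel std_normal_density)"
    by (rule integral_Re[symmetric])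
  also have "(\<integral>x. iexp (c * x) \<partial>density lborel std_normal_density) = exp (- c\<^sup>2 / 2)"
    using fun_cong[OF char_std_normal_distribution, of c] by (simp add: char_def)
  also have "(\<integral>x. Re (iexp (c * x)) \<partial>density lborel std_normal_density) = (\<integral>x. std_normal_density x * cos (c * x) \<partial>lborel)"
    by (subst integral_density) (auto simp: Re_exp)
  finally show ?thesis by simp
qed

lemma integral_std_normal_square_cos:
  "(\<integral>x. std_normal_density x * x\<^sup>2 * cos (c * x) \<partial>lborel) = (1 - c\<^sup>2) * exp (- c\<^sup>2 / 2)"
proof -
  let ?\<phi> = std_normal_density
  have i: "integrable lborel (\<lambda>x. ?\<phi> x * x\<^sup>2 * cos (c * x))" "integrable lborel (\<lambda>x. ?\<phi> x * cos (c * x))"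
    using integrable_std_normal_bounded[of "\<lambda>x. cos (c * x)" 1 2] integrable_std_normal_bounded[of "\<lambda>x. cos (c * x)" 1 0] by simp_all
  let ?f = "\<lambda>x. ?\<phi> x * x\<^sup>2 * cos (c * x) - (1 - c\<^sup>2) * (?\<phi> x * cos (c * x))"
  have "(\<integral>x. ?f x \<partial>lborel) = 0"
  \<comment> \<open>This \<open>F\<close> is an antiderivative of \<open>?f\<close>: the sine terms
    produced by the product rule cancel.\<close>
  proof (rule integral_derivative_eq_0[where E = "{}" and F = "\<lambda>x. ?\<phi> x * (c * sin (c * x) - x * cos (c * x))"])
    show deriv: "((\<lambda>x. ?\<phi> x * (c * sin (c * x) - x * cos (c * x))) has_field_derivative ?f x) (at x)" for x
      by (auto intro!: derivative_eq_intros std_normal_density_deriv simp: power2_eq_square algebra_simps)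
    show "continuous_on UNIV (\<lambda>x. ?\<phi> x * (c * sin (c * x) - x * cos (c * x)))"
      using deriv by (intro continuous_at_imp_continuous_on ballI DERIV_isCont) blast
    show "integrable lborel ?f" using i by auto
    have b: "\<bar>?\<phi> y * (c * sin (c * y) - y * cos (c * y))\<bar> \<le> \<bar>c\<bar> * ?\<phi> (real n) + real n * ?\<phi> (real n)"
      if "\<bar>y\<bar> = real n" for y n
    proof -
      have "?\<phi> y = ?\<phi> (real n)" using that by (auto simp: abs_if split: if_splits) (metis std_normal_density_minus)
      moreover have "\<bar>c * sin (c * y) - y * cos (c * y)\<bar> \<le> \<bar>c\<bar> * 1 + \<bar>y\<bar> * 1"
        by (rule order_trans[OF abs_triangle_ineq4]) (unfold abs_mult, intro add_mono mult_left_mono, auto)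
      then have "?\<phi> (real n) * \<bar>c * sin (c * y) - y * cos (c * y)\<bar> \<le> ?\<phi> (real n) * (\<bar>c\<bar> + real n)"
        using that by (intro mult_left_mono) auto
      moreover have "\<bar>?\<phi> y * (c * sin (c * y) - y * cos (c * y))\<bar> = ?\<phi> y * \<bar>c * sin (c * y) - y * cos (c * y)\<bar>"
        unfolding abs_mult[of "?\<phi> y"] by simp
      ultimately show ?thesis by (simp only:) (simp add: distrib_left mult.commute)
    qed
    have lim: "(\<lambda>n. \<bar>c\<bar> * ?\<phi> (real n) + real n * ?\<phi> (real n)) \<longlonglongrightarrow> 0"
      using tendsto_add[OF tendsto_mult[OF tendsto_const std_normal_density_tendsto(1)] std_normal_density_tendsto(2), of "\<bar>c\<bar>"] by simp
    show "(\<lambda>n. ?\<phi> (real n) * (c * sin (c * real n) - real n * cos (c * real n))) \<longlonglongrightarrow> 0"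
      by (rule Lim_null_comparison[OF _ lim]) (use b in \<open>auto intro!: always_eventually\<close>)
    show "(\<lambda>n. ?\<phi> (- real n) * (c * sin (c * - real n) - - real n * cos (c * - real n))) \<longlonglongrightarrow> 0"
      by (rule Lim_null_comparison[OF _ lim], rule always_eventually, rule allI, unfold real_norm_def, rule b) simp
  qed simp
  then show ?thesis using i by (simp add: integral_std_normal_cos)
qed

text \<open>The squared distance of \<open>x / (2 * \<epsilon>)\<close> from the nearest integer,
  with mean value 1/12. Taking the Fourier series as the definition makes continuity and boundedness
  immediate from its absolute convergence.\<close>

definition sq_saw :: "real \<Rightarrow> real \<Rightarrow> real" where
  "sq_saw \<epsilon> x = 1 / 12 + (\<Sum>k. (-1) ^ k * cos (pi * real k / \<epsilon> * x) / (pi\<^sup>2 * (real k)\<^sup>2))"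

lemma sq_saw_term_bound: "\<bar>(-1) ^ k * cos a / (pi\<^sup>2 * (real k)\<^sup>2)\<bar> \<le> 1 / (real k)\<^sup>2"
proof (cases "k = 0")
  case False
  have "1 \<le> pi\<^sup>2" using pi_gt3 by (simp add: one_le_power)
  have "\<bar>cos a\<bar> / (pi\<^sup>2 * (real k)\<^sup>2) \<le> 1 / (1 * (real k)\<^sup>2)"
    using False \<open>1 \<le> pi\<^sup>2\<close> by (intro frac_le mult_right_mono) auto
  then show ?thesis by (simp add: abs_mult)
qed simp

lemma sq_saw_continuous: "continuous_on UNIV (sq_saw \<epsilon>)"
proof -
  let ?f = "\<lambda>k x. (-1) ^ k * cos (pi * real k / \<epsilon> * x) / (pi\<^sup>2 * (real k)\<^sup>2)"
  have "uniform_limit UNIV (\<lambda>n x. \<Sum>k<n. ?f k x) (\<lambda>x. \<Sum>k. ?f k x) sequentially"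
    by (rule Weierstrass_m_test[OF _ summable_inverse_squares]) (use sq_saw_term_bound in simp)
  then have "continuous_on UNIV (\<lambda>x. \<Sum>k. ?f k x)"
    by (rule uniform_limit_theorem[rotated]) (auto intro!: always_eventually continuous_intros simp: divide_inverse)
  then show ?thesis unfolding sq_saw_def[abs_def] by (intro continuous_intros)
qed

lemma sq_saw_measurable [measurable]: "sq_saw \<epsilon> \<in> borel_measurable borel"
  by (rule borel_measurable_continuous_onI[OF sq_saw_continuous])

lemma sq_saw_bounded: "\<bar>sq_saw \<epsilon> x\<bar> \<le> 1 / 12 + (\<Sum>k. 1 / (real k)\<^sup>2)"
proof -
  let ?f = "\<lambda>k. (-1) ^ k * cos (pi * real k / \<epsilon> * x) / (pi\<^sup>2 * (real k)\<^sup>2)"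
  have "norm (\<Sum>k. ?f k) \<le> (\<Sum>k. 1 / (real k)\<^sup>2)"
    by (rule norm_suminf_le[OF _ summable_inverse_squares]) (use sq_saw_term_bound in simp)
  then show ?thesis unfolding sq_saw_def by simp
qed

text \<open>Subtracting the multiple \<open>2 * \<epsilon> * j\<close> of the period moves the
  scaled point into the open interval from \<open>-pi\<close> to \<open>pi\<close>, where the series
  of the parabola applies.\<close>

lemma sq_saw_eq:
  assumes "0 < \<epsilon>" "\<bar>x - 2 * \<epsilon> * real_of_int j\<bar> < \<epsilon>"
  shows "sq_saw \<epsilon> x = (x / (2 * \<epsilon>) - real_of_int j)\<^sup>2"
proof -
  define u where "u = pi * x / \<epsilon> - 2 * pi * real_of_int j"
  have "u = pi / \<epsilon> * (x - 2 * \<epsilon> * real_of_int j)" using assms(1) by (simp add: u_def field_simps)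
  then have "\<bar>u\<bar> = pi / \<epsilon> * \<bar>x - 2 * \<epsilon> * real_of_int j\<bar>" using assms(1) by (simp add: abs_mult)
  also have "\<dots> < pi / \<epsilon> * \<epsilon>" using assms by (intro mult_strict_left_mono) auto
  finally have u: "\<bar>u\<bar> < pi" using assms(1) by simp
  have c: "cos (real k * u) = cos (pi * real k / \<epsilon> * x)" for k
  proof -
    have "pi * real k / \<epsilon> * x = real k * u + 2 * pi * real_of_int (int k * j)"
      by (simp add: u_def algebra_simps)
    then show ?thesis using cos_add[of "real k * u" "2 * pi * real_of_int (int k * j)"]
      by (simp add: cos_int_2pin sin_int_2pin del: of_int_mult)
  qed
  have "(\<lambda>k. 1 / pi\<^sup>2 * ((-1) ^ k * cos (real k * u) / (real k)\<^sup>2)) sums (1 / pi\<^sup>2 * (u\<^sup>2 / 4 - pi\<^sup>2 / 12))"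
    by (rule sums_mult[OF quadratic_Fourier_series[OF u]])
  then have "(\<Sum>k. (-1) ^ k * cos (pi * real k / \<epsilon> * x) / (pi\<^sup>2 * (real k)\<^sup>2)) = 1 / pi\<^sup>2 * (u\<^sup>2 / 4 - pi\<^sup>2 / 12)"
    by (simp add: c sums_iff)
  also have "\<dots> = (u / (2 * pi))\<^sup>2 - 1 / 12" by (simp add: power2_eq_square field_simps)
  also have "u / (2 * pi) = x / (2 * \<epsilon>) - real_of_int j" by (simp add: u_def diff_divide_distrib)
  finally show ?thesis by (simp add: sq_saw_def)
qed

text \<open>\<open>x / (2 * \<epsilon>)\<close> rounded to the nearest integer with its sign,
  whereas \<open>cell\<close> rounds the modulus. Ties go up, so the two can disagree only at
  jumps.\<close>

definition saw_index :: "real \<Rightarrow> real \<Rightarrow> int" where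
  "saw_index \<epsilon> x = \<lfloor>(x + \<epsilon>) / (2 * \<epsilon>)\<rfloor>"

lemma saw_index_bounds:
  assumes "0 < \<epsilon>" "(x + \<epsilon>) / (2 * \<epsilon>) \<notin> \<int>"
  shows "\<bar>x - 2 * \<epsilon> * real_of_int (saw_index \<epsilon> x)\<bar> < \<epsilon>"
proof -
  let ?y = "(x + \<epsilon>) / (2 * \<epsilon>)"
  have "real_of_int \<lfloor>?y\<rfloor> \<noteq> ?y" using assms(2) by (metis Ints_of_int)
  then have "real_of_int \<lfloor>?y\<rfloor> < ?y" "?y < real_of_int \<lfloor>?y\<rfloor> + 1" by linarith+
  then have "2 * \<epsilon> * real_of_int \<lfloor>?y\<rfloor> < x + \<epsilon>" "x + \<epsilon> < 2 * \<epsilon> * real_of_int \<lfloor>?y\<rfloor> + 2 * \<epsilon>"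
    using assms(1) by (simp_all add: field_simps)
  then show ?thesis unfolding saw_index_def by linarith
qed

lemma cell_eq_saw_index:
  assumes "0 < \<epsilon>" "(x + \<epsilon>) / (2 * \<epsilon>) \<notin> \<int>"
  shows "cell \<epsilon> 0 x = 2 * (real_of_int (saw_index \<epsilon> x))\<^sup>2"
proof (cases "0 \<le> x")
  case True
  then show ?thesis by (simp add: cell_def saw_index_def)
next
  case False
  let ?y = "(x + \<epsilon>) / (2 * \<epsilon>)"
  have "real_of_int \<lfloor>?y\<rfloor> \<noteq> ?y" using assms(2) by (metis Ints_of_int)
  moreover have "(- x + \<epsilon>) / (2 * \<epsilon>) = 1 - ?y" using assms(1) by (simp add: field_simps)
  ultimately have "\<lfloor>(- x + \<epsilon>) / (2 * \<epsilon>)\<rfloor> = - \<lfloor>?y\<rfloor>" by linarith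
  then show ?thesis using False by (simp add: cell_def saw_index_def)
qed

lemma finite_saw_exceptions:
  fixes \<epsilon> a :: real
  assumes "0 < \<epsilon>"
  shows "finite ({x. (x + \<epsilon>) / (2 * \<epsilon>) \<in> \<int>} \<inter> {- a..a :: real})"
proof (rule finite_subset)
  let ?J = "{\<lfloor>(- a + \<epsilon>) / (2 * \<epsilon>)\<rfloor>..\<lceil>(a + \<epsilon>) / (2 * \<epsilon>)\<rceil>}"
  show "{x. (x + \<epsilon>) / (2 * \<epsilon>) \<in> \<int>} \<inter> {- a..a} \<subseteq> (\<lambda>j. 2 * \<epsilon> * real_of_int j - \<epsilon>) ` ?J"
  proof
    fix x assume x: "x \<in> {x. (x + \<epsilon>) / (2 * \<epsilon>) \<in> \<int>} \<inter> {- a..a}"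
    then obtain j where j: "(x + \<epsilon>) / (2 * \<epsilon>) = real_of_int j" by (auto elim: Ints_cases)
    have "(- a + \<epsilon>) / (2 * \<epsilon>) \<le> real_of_int j" "real_of_int j \<le> (a + \<epsilon>) / (2 * \<epsilon>)"
      unfolding j[symmetric] using x assms by (auto intro!: divide_right_mono)
    then have "j \<in> ?J" by (auto; linarith)
    moreover have "x = 2 * \<epsilon> * real_of_int j - \<epsilon>" using j assms by (simp add: field_simps)
    ultimately show "x \<in> (\<lambda>j. 2 * \<epsilon> * real_of_int j - \<epsilon>) ` ?J" by blast
  qed
qed simp

lemma AE_not_saw_exception:
  fixes \<epsilon> :: real
  assumes "0 < \<epsilon>"
  shows "AE x in lborel. (x + \<epsilon>) / (2 * \<epsilon>) \<notin> \<int>"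
proof -
  have "countable ((\<lambda>j::int. 2 * \<epsilon> * real_of_int j - \<epsilon>) ` UNIV)" by auto
  then have "AE x in lborel. x \<notin> (\<lambda>j::int. 2 * \<epsilon> * real_of_int j - \<epsilon>) ` UNIV"
    by (intro AE_not_in countable_imp_null_set_lborel)
  then show ?thesis
  proof eventually_elim
    case (elim x)
    show ?case
    proof
      assume "(x + \<epsilon>) / (2 * \<epsilon>) \<in> \<int>"
      then obtain j where "(x + \<epsilon>) / (2 * \<epsilon>) = real_of_int j" by (auto elim: Ints_cases)
      then have "x = 2 * \<epsilon> * real_of_int j - \<epsilon>" using assms by (simp add: field_simps)
      then show False using elim by blast
    qed
  qed
qed

lemma sq_saw_deriv:
  assumes "0 < \<epsilon>" "(x + \<epsilon>) / (2 * \<epsilon>) \<notin> \<int>"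
  shows "(sq_saw \<epsilon> has_field_derivative (x / (2 * \<epsilon>) - real_of_int (saw_index \<epsilon> x)) / \<epsilon>) (at x)"
proof -
  let ?j = "saw_index \<epsilon> x"
  let ?S = "ball (2 * \<epsilon> * real_of_int ?j) \<epsilon>"
  have "((\<lambda>x. (x / (2 * \<epsilon>) - real_of_int ?j)\<^sup>2) has_field_derivative (x / (2 * \<epsilon>) - real_of_int ?j) / \<epsilon>) (at x)"
    using assms(1) by (auto intro!: derivative_eq_intros simp: power2_eq_square field_simps)
  then show ?thesis
  proof (rule has_field_derivative_transform_within_open[where S = ?S])
    show "x \<in> ?S" using saw_index_bounds[OF assms] by (simp add: dist_real_def abs_minus_commute)
    fix y assume "y \<in> ?S"
    then show "(y / (2 * \<epsilon>) - real_of_int ?j)\<^sup>2 = sq_saw \<epsilon> y"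
      using sq_saw_eq[OF assms(1), of y ?j] by (simp add: dist_real_def abs_minus_commute)
  qed simp
qed

text \<open>Gaussian integration by parts: the jump function \<^const>\<open>cell\<close> is traded for the continuous
  periodic function \<^const>\<open>sq_saw\<close>, whose Fourier series converges absolutely.\<close>

lemma integral_cell_sq_saw:
  assumes "0 < \<epsilon>"
  shows "(\<integral>x. cell \<epsilon> 0 x \<partial>gauss 1) =
    1 / (2 * \<epsilon>\<^sup>2) + (\<integral>x. std_normal_density x * (4 - 2 * x\<^sup>2) * sq_saw \<epsilon> x \<partial>lborel)"
proof -
  let ?\<phi> = std_normal_density and ?P = "sq_saw \<epsilon>"
  let ?saw = "\<lambda>x. x / (2 * \<epsilon>) - real_of_int (saw_index \<epsilon> x)"
  define C where "C = 1 / 12 + (\<Sum>k. 1 / (real k)\<^sup>2)"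
  have C: "\<bar>?P x\<bar> \<le> C" for x using sq_saw_bounded by (simp add: C_def)
  have i: "integrable lborel (\<lambda>x. ?\<phi> x * x ^ k * ?P x)" for k
    by (rule integrable_std_normal_bounded[OF _ C]) simp
  have [measurable]: "(\<lambda>x. real_of_int (saw_index \<epsilon> x)) \<in> borel_measurable borel"
    unfolding saw_index_def by measurable
  have saw_le: "\<bar>?saw x\<bar> \<le> 1" for x
  proof -
    have "x / (2 * \<epsilon>) + 1 / 2 = (x + \<epsilon>) / (2 * \<epsilon>)" using assms by (simp add: field_simps)
    then show ?thesis unfolding saw_index_def by linarith
  qed
  have isw: "integrable lborel (\<lambda>x. ?\<phi> x * x ^ k * ?saw x)" for k
    by (rule integrable_std_normal_bounded[OF _ saw_le]) measurable
  have i2: "integrable lborel (\<lambda>x. ?\<phi> x * x\<^sup>2)" "(\<integral>x. ?\<phi> x * x\<^sup>2 \<partial>lborel) = 1"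
    using std_normal_moment_even[of 1] by (auto simp: has_bochner_integral_iff)
  \<comment> \<open>The derivative of \<open>?\<phi> x * x * ?P x\<close>, as \<open>?P\<close> has
    derivative \<open>?saw x / \<epsilon>\<close> off the corners.\<close>
  let ?f = "\<lambda>x. ?\<phi> x * x ^ 0 * ?P x - ?\<phi> x * x ^ 2 * ?P x + 1 / \<epsilon> * (?\<phi> x * x ^ 1 * ?saw x)"
  have parts: "(\<integral>x. ?f x \<partial>lborel) = 0"
  proof (rule integral_derivative_eq_0[where E = "{x. (x + \<epsilon>) / (2 * \<epsilon>) \<in> \<int>}" and F = "\<lambda>x. ?\<phi> x * x * ?P x"])
    show "continuous_on UNIV (\<lambda>x. ?\<phi> x * x * ?P x)"
      unfolding std_normal_density_def by (intro continuous_intros sq_saw_continuous) auto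
    show "integrable lborel ?f"
      by (intro Bochner_Integration.integrable_add Bochner_Integration.integrable_diff integrable_mult_right i isw)
    show "finite ({x. (x + \<epsilon>) / (2 * \<epsilon>) \<in> \<int>} \<inter> {- real n..real n})" for n
      by (rule finite_saw_exceptions[OF assms])
    fix x assume "x \<notin> {x. (x + \<epsilon>) / (2 * \<epsilon>) \<in> \<int>}"
    then have x: "(x + \<epsilon>) / (2 * \<epsilon>) \<notin> \<int>" by simp
    show "((\<lambda>x. ?\<phi> x * x * ?P x) has_field_derivative ?f x) (at x)"
      by (auto intro!: derivative_eq_intros std_normal_density_deriv sq_saw_deriv[OF assms x]
          simp: power2_eq_square algebra_simps diff_divide_distrib)
  next
    have lim: "(\<lambda>n. real n * ?\<phi> (real n) * C) \<longlonglongrightarrow> 0"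
      using tendsto_mult[OF std_normal_density_tendsto(2) tendsto_const, of C] by simp
    have b: "\<bar>?\<phi> (real n) * real n * ?P y\<bar> \<le> real n * ?\<phi> (real n) * C" for n y
      using mult_left_mono[OF C[of y], of "real n * ?\<phi> (real n)"] by (simp add: abs_mult mult.commute)
    show "(\<lambda>n. ?\<phi> (real n) * real n * ?P (real n)) \<longlonglongrightarrow> 0"
      by (rule Lim_null_comparison[OF _ lim]) (use b in \<open>auto intro!: always_eventually\<close>)
    have "\<bar>?\<phi> (- real n) * - real n * ?P (- real n)\<bar> \<le> real n * ?\<phi> (real n) * C" for n
      using b[of n "- real n"] by simp
    then show "(\<lambda>n. ?\<phi> (- real n) * - real n * ?P (- real n)) \<longlonglongrightarrow> 0"
      by (intro Lim_null_comparison[OF _ lim]) (auto intro!: always_eventually)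
  qed
  have "(\<integral>x. cell \<epsilon> 0 x \<partial>gauss 1) = (\<integral>x. ?\<phi> x * cell \<epsilon> 0 x \<partial>lborel)"
    by (subst integral_density) auto
  \<comment> \<open>The rounded integer is \<open>x / (2 * \<epsilon>) - ?saw x\<close>. Squaring it
    gives a square of \<open>x\<close>, a mixed term, which \<open>parts\<close> converts, and the
    square of \<open>?saw x\<close>, which is \<open>?P x\<close>.\<close>
  also have "\<dots> = (\<integral>x. 1 / (2 * \<epsilon>\<^sup>2) * (?\<phi> x * x\<^sup>2) - 2 / \<epsilon> * (?\<phi> x * x ^ 1 * ?saw x) + 2 * (?\<phi> x * x ^ 0 * ?P x) \<partial>lborel)"
  proof (rule integral_cong_AE)
    show "AE x in lborel. ?\<phi> x * cell \<epsilon> 0 x =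
        1 / (2 * \<epsilon>\<^sup>2) * (?\<phi> x * x\<^sup>2) - 2 / \<epsilon> * (?\<phi> x * x ^ 1 * ?saw x) + 2 * (?\<phi> x * x ^ 0 * ?P x)"
      using AE_not_saw_exception[OF assms]
    proof eventually_elim
      case (elim x)
      have "?P x = (?saw x)\<^sup>2" using sq_saw_eq[OF assms saw_index_bounds[OF assms elim]] .
      moreover have "cell \<epsilon> 0 x = 2 * (x / (2 * \<epsilon>) - ?saw x)\<^sup>2"
        using cell_eq_saw_index[OF assms elim] by simp
      moreover have "1 / (2 * \<epsilon>\<^sup>2) * x\<^sup>2 = 2 * (x / (2 * \<epsilon>))\<^sup>2" "2 / \<epsilon> * x = 4 * (x / (2 * \<epsilon>))"
        using assms by (auto simp: power2_eq_square field_simps)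
      ultimately have eq: "cell \<epsilon> 0 x = 1 / (2 * \<epsilon>\<^sup>2) * x\<^sup>2 - 2 / \<epsilon> * x * ?saw x + 2 * ?P x"
        by (simp only:) (simp add: power2_eq_square algebra_simps)
      have "f * (a * y - b * x * s + 2 * p) = a * (f * y) - b * (f * x ^ 1 * s) + 2 * (f * x ^ 0 * p)"
        for f a b s p y :: real by (simp add: algebra_simps)
      then show ?case unfolding eq .
    qed
  qed measurable
  also have "\<dots> = 1 / (2 * \<epsilon>\<^sup>2) * 1 - 2 / \<epsilon> * (\<integral>x. ?\<phi> x * x ^ 1 * ?saw x \<partial>lborel) + 2 * (\<integral>x. ?\<phi> x * x ^ 0 * ?P x \<partial>lborel)"
    using i[of 0] isw[of 1] i2 by simp
  also have "1 / \<epsilon> * (\<integral>x. ?\<phi> x * x ^ 1 * ?saw x \<partial>lborel) =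
     (\<integral>x. ?\<phi> x * x ^ 2 * ?P x \<partial>lborel) - (\<integral>x. ?\<phi> x * x ^ 0 * ?P x \<partial>lborel)"
    using parts i[of 0] i[of 2] isw[of 1] by simp
  then have "2 / \<epsilon> * (\<integral>x. ?\<phi> x * x ^ 1 * ?saw x \<partial>lborel) =
     2 * (\<integral>x. ?\<phi> x * x ^ 2 * ?P x \<partial>lborel) - 2 * (\<integral>x. ?\<phi> x * x ^ 0 * ?P x \<partial>lborel)" by simp
  also have "1 / (2 * \<epsilon>\<^sup>2) * 1 - (2 * (\<integral>x. ?\<phi> x * x ^ 2 * ?P x \<partial>lborel) - 2 * (\<integral>x. ?\<phi> x * x ^ 0 * ?P x \<partial>lborel)) + 2 * (\<integral>x. ?\<phi> x * x ^ 0 * ?P x \<partial>lborel)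
     = 1 / (2 * \<epsilon>\<^sup>2) + (\<integral>x. 4 * (?\<phi> x * x ^ 0 * ?P x) - 2 * (?\<phi> x * x ^ 2 * ?P x) \<partial>lborel)"
    using i[of 0] i[of 2] by simp
  also have "(\<lambda>x. 4 * (?\<phi> x * x ^ 0 * ?P x) - 2 * (?\<phi> x * x ^ 2 * ?P x)) = (\<lambda>x. ?\<phi> x * (4 - 2 * x\<^sup>2) * ?P x)"
    by (simp add: fun_eq_iff algebra_simps)
  finally show ?thesis .
qed

text \<open>Termwise integration, justified by absolute convergence. The weight
  \<open>std_normal_density x * (4 - 2 * x^2)\<close> has integral 2, so the constant 1/12 of
  \<open>sq_saw\<close> accounts for the 1/6.\<close>

lemma integral_gauss_series:
  assumes "0 < \<epsilon>"
  shows "(\<lambda>k. (-1) ^ k * ((2 + 2 * (pi * real k / \<epsilon>)\<^sup>2) * exp (- (pi * real k / \<epsilon>)\<^sup>2 / 2) / (pi\<^sup>2 * (real k)\<^sup>2)))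
    sums ((\<integral>x. std_normal_density x * (4 - 2 * x\<^sup>2) * sq_saw \<epsilon> x \<partial>lborel) - 1 / 6)"
proof -
  let ?\<phi> = std_normal_density
  let ?\<psi> = "\<lambda>x. ?\<phi> x * (4 - 2 * x\<^sup>2)"
  let ?c = "\<lambda>k. pi * real k / \<epsilon>"
  let ?f = "\<lambda>k x. ?\<psi> x * ((-1) ^ k * cos (?c k * x) / (pi\<^sup>2 * (real k)\<^sup>2))"
  have ic: "integrable lborel (\<lambda>x. ?\<phi> x * cos (c * x))" "integrable lborel (\<lambda>x. ?\<phi> x * x\<^sup>2 * cos (c * x))" for c
    using integrable_std_normal_bounded[of "\<lambda>x. cos (c * x)" 1 0] integrable_std_normal_bounded[of "\<lambda>x. cos (c * x)" 1 2] by simp_all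
  have eq: "?\<psi> x * cos (c * x) = 4 * (?\<phi> x * cos (c * x)) - 2 * (?\<phi> x * x\<^sup>2 * cos (c * x))" for c x
    by (simp add: algebra_simps)
  have \<psi>: "integrable lborel (\<lambda>x. ?\<psi> x * cos (c * x))"
    "(\<integral>x. ?\<psi> x * cos (c * x) \<partial>lborel) = (2 + 2 * c\<^sup>2) * exp (- c\<^sup>2 / 2)" for c
  proof -
    show "integrable lborel (\<lambda>x. ?\<psi> x * cos (c * x))"
      unfolding eq by (intro Bochner_Integration.integrable_diff integrable_mult_right ic)
    have "(\<integral>x. ?\<psi> x * cos (c * x) \<partial>lborel) =
        4 * (\<integral>x. ?\<phi> x * cos (c * x) \<partial>lborel) - 2 * (\<integral>x. ?\<phi> x * x\<^sup>2 * cos (c * x) \<partial>lborel)"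
      unfolding eq using ic[of c] by simp
    also have "\<dots> = (2 + 2 * c\<^sup>2) * exp (- c\<^sup>2 / 2)"
      unfolding integral_std_normal_cos integral_std_normal_square_cos by (simp add: algebra_simps)
    finally show "(\<integral>x. ?\<psi> x * cos (c * x) \<partial>lborel) = (2 + 2 * c\<^sup>2) * exp (- c\<^sup>2 / 2)" .
  qed
  have \<psi>0: "integrable lborel ?\<psi>" "(\<integral>x. ?\<psi> x \<partial>lborel) = 2" using \<psi>[of 0] by simp_all
  have f: "?f k x = (-1) ^ k / (pi\<^sup>2 * (real k)\<^sup>2) * (?\<psi> x * cos (?c k * x))" for k x by simp
  have fi: "integrable lborel (?f k)" for k unfolding f using \<psi>(1) by (rule integrable_mult_right)
  have fv: "(\<integral>x. ?f k x \<partial>lborel) = (-1) ^ k * ((2 + 2 * (?c k)\<^sup>2) * exp (- (?c k)\<^sup>2 / 2) / (pi\<^sup>2 * (real k)\<^sup>2))" for k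
    unfolding f integral_mult_right_zero \<psi>(2) by simp
  have bound: "norm (?f k x) \<le> \<bar>?\<psi> x\<bar> * (1 / (real k)\<^sup>2)" for k x
    unfolding real_norm_def abs_mult[of "?\<psi> x"] by (intro mult_left_mono sq_saw_term_bound) simp
  have S: "(\<lambda>k. \<integral>x. ?f k x \<partial>lborel) sums (\<integral>x. (\<Sum>k. ?f k x) \<partial>lborel)"
  proof (rule sums_integral[OF fi])
    show "AE x in lborel. summable (\<lambda>k. norm (?f k x))"
      by (intro AE_I2 summable_comparison_test'[OF summable_mult[OF summable_inverse_squares], of 0])
         (use bound in auto)
    show "summable (\<lambda>k. \<integral>x. norm (?f k x) \<partial>lborel)"
    proof (rule summable_comparison_test'[OF summable_mult[OF summable_inverse_squares], of 0])
      fix k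
      have "(\<integral>x. norm (?f k x) \<partial>lborel) \<le> (\<integral>x. \<bar>?\<psi> x\<bar> * (1 / (real k)\<^sup>2) \<partial>lborel)"
        using bound fi \<psi>0(1) by (intro integral_mono integrable_norm integrable_mult_left integrable_abs) auto
      then show "norm (\<integral>x. norm (?f k x) \<partial>lborel) \<le> (\<integral>x. \<bar>?\<psi> x\<bar> \<partial>lborel) * (1 / (real k)\<^sup>2)"
        by simp
    qed
  qed
  have J: "(\<integral>x. (\<Sum>k. ?f k x) \<partial>lborel) = (\<integral>x. ?\<psi> x * sq_saw \<epsilon> x - 1 / 12 * ?\<psi> x \<partial>lborel)"
  proof (rule Bochner_Integration.integral_cong[OF refl])
    fix x
    have "summable (\<lambda>k. (-1) ^ k * cos (?c k * x) / (pi\<^sup>2 * (real k)\<^sup>2))"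
      by (rule summable_comparison_test'[OF summable_inverse_squares, of 0])
         (use sq_saw_term_bound in auto)
    then show "(\<Sum>k. ?f k x) = ?\<psi> x * sq_saw \<epsilon> x - 1 / 12 * ?\<psi> x"
      by (subst suminf_mult) (simp_all add: sq_saw_def algebra_simps)
  qed
  have "integrable lborel (\<lambda>x. ?\<psi> x * sq_saw \<epsilon> x)"
  proof -
    have "integrable lborel (\<lambda>x. 4 * (?\<phi> x * x ^ 0 * sq_saw \<epsilon> x) - 2 * (?\<phi> x * x ^ 2 * sq_saw \<epsilon> x))"
      using integrable_std_normal_bounded[OF sq_saw_measurable sq_saw_bounded]
      by (intro Bochner_Integration.integrable_diff integrable_mult_right)
    then show ?thesis by (simp add: algebra_simps)
  qed
  then have "(\<integral>x. ?\<psi> x * sq_saw \<epsilon> x - 1 / 12 * ?\<psi> x \<partial>lborel) = (\<integral>x. ?\<psi> x * sq_saw \<epsilon> x \<partial>lborel) - 1 / 6"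
    using \<psi>0 by simp
  then show ?thesis using S unfolding fv J by (simp only:)
qed

text \<open>\<open>b k\<close> is \<open>2 * q (2 * k) - q k\<close>, where \<open>q k\<close> is
  the modulus of the \<open>k\<close>-th term of the alternating series. Both parts converge
  separately because \<open>q k\<close> is bounded by a multiple of \<open>1 / k^2\<close>.\<close>

lemma cell_integral_dual_has_sum:
  assumes "0 < \<epsilon>"
  defines "b \<equiv> \<lambda>k. (4 * pi\<^sup>2 * (real k)\<^sup>2 * exp (- (2 * pi\<^sup>2 * (real k)\<^sup>2 / \<epsilon>\<^sup>2))
            + \<epsilon>\<^sup>2 * exp (- (2 * pi\<^sup>2 * (real k)\<^sup>2 / \<epsilon>\<^sup>2))
            - 2 * exp (- (pi\<^sup>2 * (real k)\<^sup>2 / (2 * \<epsilon>\<^sup>2))) * (pi\<^sup>2 * (real k)\<^sup>2 + \<epsilon>\<^sup>2))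
           / (pi\<^sup>2 * (real k)\<^sup>2 * \<epsilon>\<^sup>2)"
  shows "(b has_sum ((\<integral>x. cell \<epsilon> 0 x \<partial>gauss 1) - 1 / (2 * \<epsilon>\<^sup>2) - 1 / 6)) {1..}"
proof -
  let ?c = "\<lambda>k. pi * real k / \<epsilon>"
  define q where "q k = (2 + 2 * (?c k)\<^sup>2) * exp (- (?c k)\<^sup>2 / 2) / (pi\<^sup>2 * (real k)\<^sup>2)" for k
  let ?T = "(\<integral>x. cell \<epsilon> 0 x \<partial>gauss 1) - 1 / (2 * \<epsilon>\<^sup>2) - 1 / 6"
  have q0: "0 \<le> q k" for k by (simp add: q_def)
  have q_le: "q k \<le> 6 * (1 / (real k)\<^sup>2)" for k
  proof -
    let ?y = "(?c k)\<^sup>2 / 2"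
    have "2 + 2 * (?c k)\<^sup>2 \<le> 4 * exp ?y" using exp_ge_add_one_self[of ?y] by linarith
    then have "(2 + 2 * (?c k)\<^sup>2) * exp (- ?y) \<le> (4 * exp ?y) * exp (- ?y)"
      by (intro mult_right_mono) auto
    also have "\<dots> = 4" by (simp flip: exp_add)
    finally have "(2 + 2 * (?c k)\<^sup>2) * exp (- (?c k)\<^sup>2 / 2) \<le> 6" by simp
    moreover have "1 \<le> pi\<^sup>2" using pi_gt3 by (simp add: one_le_power)
    then have "(real k)\<^sup>2 \<le> pi\<^sup>2 * (real k)\<^sup>2" by (simp add: mult_le_cancel_right1)
    ultimately show ?thesis
      unfolding q_def by (cases "k = 0") (auto intro!: frac_le)
  qed
  have q_summable: "summable q"
    by (rule summable_comparison_test'[OF summable_mult[OF summable_inverse_squares, of 6], of 0])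
       (use q0 q_le in auto)
  have "q (2 * k) \<le> 6 * (1 / (real k)\<^sup>2)" for k
  proof -
    have "1 / (real (2 * k))\<^sup>2 \<le> 1 / (real k)\<^sup>2" by (cases "k = 0") (auto intro!: divide_left_mono)
    then show ?thesis using q_le[of "2 * k"] by linarith
  qed
  then have q2_summable: "summable (\<lambda>k. q (2 * k))"
    by (intro summable_comparison_test'[OF summable_mult[OF summable_inverse_squares, of 6], of 0])
       (use q0 in auto)
  obtain Q E where QE: "(q has_sum Q) {1..}" "((\<lambda>k. q (2 * k)) has_sum E) {1..}"
    using summable_nonneg_imp_summable_on[OF q_summable q0] summable_nonneg_imp_summable_on[OF q2_summable q0]
      summable_on_subset_banach[of _ UNIV "{1..}"] by (metis has_sum_infsum subset_UNIV)
  have "(\<lambda>k. (-1) ^ k * q k) sums (2 * E - Q)"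
    by (rule has_sum_atLeast_1_imp_sums[OF has_sum_alternating[OF QE]]) (simp add: q_def)
  moreover have "(\<lambda>k. (-1) ^ k * q k) sums ?T"
    using integral_gauss_series[OF assms(1)] integral_cell_sq_saw[OF assms(1)] by (simp add: q_def)
  ultimately have T: "?T = 2 * E + - Q" using sums_unique2 by force
  have "((\<lambda>k. 2 * q (2 * k) + - q k) has_sum (2 * E + - Q)) {1..}"
    by (intro has_sum_add has_sum_cmult_right has_sum_uminusI QE)
  also have "?this \<longleftrightarrow> (b has_sum (2 * E + - Q)) {1..}"
  proof (rule has_sum_cong)
    fix k :: nat assume "k \<in> {1..}"
    then have k: "0 < real k" by simp
    define e1 where "e1 = exp (- (2 * pi\<^sup>2 * (real k)\<^sup>2 / \<epsilon>\<^sup>2))"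
    define e2 where "e2 = exp (- (pi\<^sup>2 * (real k)\<^sup>2 / (2 * \<epsilon>\<^sup>2)))"
    have "exp (- (?c (2 * k))\<^sup>2 / 2) = e1" by (simp add: e1_def power_mult_distrib power_divide)
    moreover have "exp (- (?c k)\<^sup>2 / 2) = e2" by (simp add: e2_def power_mult_distrib power_divide mult.commute)
    ultimately show "2 * q (2 * k) + - q k = b k"
      unfolding q_def b_def e1_def[symmetric] e2_def[symmetric]
      using k assms(1) by (simp add: power_mult_distrib power_divide) (simp add: field_simps)
  qed
  finally show ?thesis by (simp only: T)
qed

subsection \<open>The expected number of bars\<close>

text \<open>
  Paths are continuous only almost surely, so expectations are taken with respect to the completion
  of the probability measure; integrability (hence measurability and finiteness) is asserted.
\<close>

theorem proposition4p12:
  fixes M :: "'a measure" and B :: "real \<Rightarrow> 'a \<Rightarrow> real" and \<epsilon> t :: real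
    and N :: "real \<Rightarrow> 'a \<Rightarrow> real" and a b :: "nat \<Rightarrow> real"
  assumes "standard_brownian_motion M B" and "t > 0" and "\<epsilon> > 0"
  defines "N \<equiv> \<lambda>s \<omega>. real (bar_count \<epsilon> (\<lambda>u. \<bar>B u \<omega>\<bar>) s)"
    and "a \<equiv> \<lambda>k. 2 * real k *
           (erfc (real k * \<epsilon> / sqrt (2 * t)) - 2 * erfc (2 * real k * \<epsilon> / sqrt (2 * t)))"
    and "b \<equiv> \<lambda>k.
           (4 * pi\<^sup>2 * (real k)\<^sup>2 * exp (- (2 * pi\<^sup>2 * (real k)\<^sup>2 / \<epsilon>\<^sup>2))
            + \<epsilon>\<^sup>2 * exp (- (2 * pi\<^sup>2 * (real k)\<^sup>2 / \<epsilon>\<^sup>2))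
            - 2 * exp (- (pi\<^sup>2 * (real k)\<^sup>2 / (2 * \<epsilon>\<^sup>2))) * (pi\<^sup>2 * (real k)\<^sup>2 + \<epsilon>\<^sup>2))
           / (pi\<^sup>2 * (real k)\<^sup>2 * \<epsilon>\<^sup>2)"
  shows "(integrable (completion M) (N t) \<and> a summable_on {1..} \<and>
          (\<integral>\<omega>. N t \<omega> \<partial>completion M) = (\<Sum>\<^sub>\<infinity>k\<in>{1..}. a k)) \<and>
         (integrable (completion M) (N 1) \<and> b summable_on {1..} \<and>
          (\<integral>\<omega>. N 1 \<omega> \<partial>completion M) = 1 / (2 * \<epsilon>\<^sup>2) + 1 / 6 + (\<Sum>\<^sub>\<infinity>k\<in>{1..}. b k))"
proof -
  interpret standard_brownian_motion M B by fact
  have N: "has_bochner_integral (completion M) (N s) (\<integral>x. cell \<epsilon> 0 x \<partial>gauss s)" if "0 < s" for s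
    unfolding N_def using has_bochner_integral_bar_count[OF that \<open>\<epsilon> > 0\<close>] .
  have a: "(a has_sum (\<integral>x. cell \<epsilon> 0 x \<partial>gauss t)) {1..}"
    unfolding a_def by (rule cell_integral_has_sum[OF \<open>t > 0\<close> \<open>\<epsilon> > 0\<close>])
  have b: "(b has_sum ((\<integral>x. cell \<epsilon> 0 x \<partial>gauss 1) - 1 / (2 * \<epsilon>\<^sup>2) - 1 / 6)) {1..}"
    unfolding b_def by (rule cell_integral_dual_has_sum[OF \<open>\<epsilon> > 0\<close>])
  show ?thesis
    using N[OF \<open>t > 0\<close>] N[of 1] has_sum_imp_summable[OF a] infsumI[OF a] has_sum_imp_summable[OF b] infsumI[OF b]
    by (simp add: has_bochner_integral_iff)
qed

end
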